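(* Let $n\ge 3$, and let $(u,d)\in C^\infty(\mathbb{R}^n\setminus\{0\},\mathbb{R}^n\times\mathbb{S}^{n-1})$ be a self-similar solution of the steady simplified Ericksen-Leslie system in $\mathbb{R}^n\setminus\{0\}$. If, in addition, $$|\nabla d(x)|<\frac{1}{2|x|}\qquad\text{for all }x\in\mathbb{R}^n\setminus\{0\},$$ then: (i) if $n\ge 4$, then $u\equiv 0$ and $d$ is a constant map; (ii) if $n=3$, then $u$ is either $0$ or a Landau solution of the steady Navier-Stokes equations, and $d$ is a constant map.
   Context: The steady simplified Ericksen-Leslie system for $u$ with values in $\mathbb{R}^n$, a scalar pressure $p$, and $d$ with values in $\mathbb{S}^{n-1}\subset\mathbb{R}^n$ is $$-\Delta u+u\cdot\nabla u+\nabla p=-\operatorname{div}(\nabla d\odot\nabla d),\qquad \operatorname{div}u=0,\qquad \Delta d+|\nabla d|^2d=u\cdot\nabla d,$$ where $(\nabla d\odot\nabla d)_{ij}=\partial_{x_i}d\cdot\partial_{x_j}d$. A solution (with smooth pressure $p$) on $\mathbb{R}^n\setminus\{0\}$ is called self-similar if $u(x)=\lambda u(\lambda x)$, $p(x)=\lambda^2p(\lambda x)$ and $d(x)=d(\lambda x)$ for all $x\in\mathbb{R}^n\setminus\{0\}$ and all $\lambda>0$. The steady Navier-Stokes equations are $-\Delta u+u\cdot\nabla u+\nabla p=0$, $\operatorname{div}u=0$. Landau solutions ($n=3$) are the vector fields on $\mathbb{R}^3\setminus\{0\}$ given, in spherical coordinates with polar angle $\phi\in(0,\pi)$ and azimuthal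 angle $\theta\in[0,2\pi)$ about some axis through the origin (any direction of the axis is allowed), by $$u_a=\operatorname{curl}(\psi_a e_\theta),\qquad \psi_a=\frac{2\sin\phi}{a-\cos\phi},\qquad a\in(1,\infty],$$ where $e_\theta$ is the azimuthal unit vector and $a=\infty$ corresponds to $u\equiv0$. The norm $|\nabla d|$ is the Euclidean (Hilbert-Schmidt) norm, $|\nabla d|^2=\sum_i|\partial_{x_i}d|^2$. *)

theory Defs
  imports "HOL-Analysis.Analysis"
begin

text \<open>
  Fields on the punctured space are total functions on \<^typ>\<open>real^'n\<close> whose values at the origin are
  irrelevant: every condition below is imposed at nonzero points only, and derivatives at such
  points depend only on values nearby.
\<close>

abbreviation punctured :: "(real^'n) set"
  where "punctured \<equiv> UNIV - {0}"

definition partial :: "'n \<Rightarrow> (real^'n \<Rightarrow> 'b::real_normed_vector) \<Rightarrow> real^'n \<Rightarrow> 'b"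
  where "partial i f x = frechet_derivative f (at x) (axis i 1)"

text \<open>The set \<open>S\<close> is meant to be open, since the derivatives are taken in the whole space.\<close>

primrec Ck_on :: "nat \<Rightarrow> (real^'n \<Rightarrow> 'b::real_normed_vector) \<Rightarrow> (real^'n) set \<Rightarrow> bool" where
  "Ck_on 0 f S \<longleftrightarrow> continuous_on S f"
| "Ck_on (Suc k) f S \<longleftrightarrow> (\<forall>x\<in>S. f differentiable (at x)) \<and> (\<forall>i. Ck_on k (partial i f) S)"

definition smooth_on :: "(real^'n \<Rightarrow> 'b::real_normed_vector) \<Rightarrow> (real^'n) set \<Rightarrow> bool"
  where "smooth_on f S \<longleftrightarrow> (\<forall>k. Ck_on k f S)"

definition grad :: "(real^'n \<Rightarrow> real) \<Rightarrow> real^'n \<Rightarrow> real^'n"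
  where "grad f x = (\<chi> i. partial i f x)"

definition divergence :: "(real^'n \<Rightarrow> real^'n) \<Rightarrow> real^'n \<Rightarrow> real"
  where "divergence u x = (\<Sum>i\<in>UNIV. partial i (\<lambda>y. u y $ i) x)"

definition laplacian :: "(real^'n \<Rightarrow> 'b::real_normed_vector) \<Rightarrow> real^'n \<Rightarrow> 'b"
  where "laplacian f x = (\<Sum>i\<in>UNIV. partial i (partial i f) x)"

text \<open>The transport term \<open>u \<cdot> \<nabla>f\<close>.\<close>

definition advect :: "(real^'n \<Rightarrow> real^'n) \<Rightarrow> (real^'n \<Rightarrow> 'b::real_normed_vector) \<Rightarrow> real^'n \<Rightarrow> 'b"
  where "advect u f x = (\<Sum>j\<in>UNIV. (u x $ j) *\<^sub>R partial j f x)"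

definition grad_norm :: "(real^'n \<Rightarrow> 'b::real_normed_vector) \<Rightarrow> real^'n \<Rightarrow> real"
  where "grad_norm f x = sqrt (\<Sum>i\<in>UNIV. (norm (partial i f x))\<^sup>2)"

text \<open>The tensor \<open>\<nabla>d \<odot> \<nabla>d\<close>, and the row-wise divergence of a tensor field.\<close>

definition ericksen_tensor :: "(real^'n \<Rightarrow> real^'n) \<Rightarrow> real^'n \<Rightarrow> real^'n^'n"
  where "ericksen_tensor d x = (\<chi> i j. partial i d x \<bullet> partial j d x)"

definition tensor_div :: "(real^'n \<Rightarrow> real^'n^'n) \<Rightarrow> real^'n \<Rightarrow> real^'n"
  where "tensor_div M x = (\<chi> i. \<Sum>j\<in>UNIV. partial j (\<lambda>y. M y $ i $ j) x)"

definition ericksen_leslie ::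
  "(real^'n \<Rightarrow> real^'n) \<Rightarrow> (real^'n \<Rightarrow> real) \<Rightarrow> (real^'n \<Rightarrow> real^'n) \<Rightarrow> bool"
  where "ericksen_leslie u p d \<longleftrightarrow>
    (\<forall>x\<in>punctured.
        - laplacian u x + advect u u x + grad p x = - tensor_div (ericksen_tensor d) x
      \<and> divergence u x = 0
      \<and> laplacian d x + (grad_norm d x)\<^sup>2 *\<^sub>R d x = advect u d x)"

definition self_similar ::
  "(real^'n \<Rightarrow> real^'n) \<Rightarrow> (real^'n \<Rightarrow> real) \<Rightarrow> (real^'n \<Rightarrow> real^'n) \<Rightarrow> bool"
  where "self_similar u p d \<longleftrightarrow>
    (\<forall>x\<in>punctured. \<forall>l>0.
        u x = l *\<^sub>R u (l *\<^sub>R x)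
      \<and> p x = l\<^sup>2 * p (l *\<^sub>R x)
      \<and> d x = d (l *\<^sub>R x))"

definition self_similar_solution :: "(real^'n \<Rightarrow> real^'n) \<Rightarrow> (real^'n \<Rightarrow> real^'n) \<Rightarrow> bool"
  where "self_similar_solution u d \<longleftrightarrow>
    (\<exists>p. smooth_on p punctured \<and> ericksen_leslie u p d \<and> self_similar u p d)"

definition navier_stokes :: "(real^'n \<Rightarrow> real^'n) \<Rightarrow> (real^'n \<Rightarrow> real) \<Rightarrow> bool"
  where "navier_stokes u p \<longleftrightarrow>
    (\<forall>x\<in>punctured.
        - laplacian u x + advect u u x + grad p x = 0 \<and> divergence u x = 0)"

definition curl :: "(real^3 \<Rightarrow> real^3) \<Rightarrow> real^3 \<Rightarrow> real^3"
  where "curl v x = vector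
    [partial 2 (\<lambda>y. v y $ 3) x - partial 3 (\<lambda>y. v y $ 2) x,
     partial 3 (\<lambda>y. v y $ 1) x - partial 1 (\<lambda>y. v y $ 3) x,
     partial 1 (\<lambda>y. v y $ 2) x - partial 2 (\<lambda>y. v y $ 1) x]"

text \<open>
  Spherical coordinates about the axis spanned by a unit vector \<open>e\<close>. The azimuthal unit vector is
  undefined on the axis; there division by zero makes it \<open>0\<close>. As \<open>sin \<phi>\<close> also vanishes there,
  the potential below is still the smooth field \<open>2 (e \<times> x) / (a |x| - e \<bullet> x)\<close> on the whole
  punctured space, so that its curl is meaningful on the axis too.
\<close>

definition polar_angle :: "real^3 \<Rightarrow> real^3 \<Rightarrow> real"
  where "polar_angle e x = arccos (e \<bullet> x / norm x)"

definition azimuthal :: "real^3 \<Rightarrow> real^3 \<Rightarrow> real^3"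
  where "azimuthal e x = cross3 e x /\<^sub>R norm (cross3 e x)"

definition landau_psi :: "real \<Rightarrow> real \<Rightarrow> real"
  where "landau_psi a \<phi> = 2 * sin \<phi> / (a - cos \<phi>)"

definition landau_field :: "real^3 \<Rightarrow> real \<Rightarrow> real^3 \<Rightarrow> real^3"
  where "landau_field e a = curl (\<lambda>x. landau_psi a (polar_angle e x) *\<^sub>R azimuthal e x)"

text \<open>
  The dimension is a type, so for an index type with three elements the space \<^typ>\<open>real^'n\<close> is
  identified with \<^typ>\<open>real^3\<close> by an enumeration of the coordinates. Which enumeration is taken
  does not matter: a permutation of the coordinates maps the Landau field about \<open>e\<close> to the one
  about the permuted axis, also when it reverses the orientation, because that changes the sign
  both of the curl and of the azimuthal vector.
  The first disjunct is the parameter \<open>a = \<infinity>\<close>.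
\<close>

definition relabel :: "(3 \<Rightarrow> 'n) \<Rightarrow> real^'n \<Rightarrow> real^3"
  where "relabel s x = (\<chi> k. x $ s k)"

definition landau_solution :: "(real^'n \<Rightarrow> real^'n) \<Rightarrow> bool"
  where "landau_solution u \<longleftrightarrow>
    (\<forall>x\<in>punctured. u x = 0) \<or>
    (\<exists>s e a. bij s \<and> norm e = 1 \<and> 1 < a \<and>
       (\<forall>x\<in>punctured. relabel s (u x) = landau_field e a (relabel s x)))"

end

theory Submission
  imports Defs
begin

text \<open>
  The only analytic tool is the strong maximum principle for homogeneous functions of degree 0, which
  attain their maximum on the unit sphere.

  Since \<open>|\<nabla>d| \<le> 1/2\<close> on the unit sphere, the values of \<open>d\<close> lie in an open hemisphere: \<open>v \<cdot> d > 0\<close>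
  for some \<open>v\<close>. As \<open>(\<Delta> - u \<cdot> \<nabla>)(v \<cdot> d) = - |\<nabla>d|\<^sup>2 (v \<cdot> d) \<le> 0\<close>, the function \<open>v \<cdot> d\<close> is constant
  and \<open>\<nabla>d = 0\<close>, which leaves a self-similar solution of the Navier-Stokes equations.

  With \<open>f = x \<cdot> u\<close>, \<open>H = |u|\<^sup>2/2 + p\<close>, the vorticity \<open>\<omega>\<close> and \<open>r = |x|\<close>, one has
  \<open>(\<Delta> - u \<cdot> \<nabla>) f = - 2 H\<close> and \<open>(\<Delta> - u \<cdot> \<nabla>) H = |\<omega>|\<^sup>2\<close>. Hence \<open>G = r\<^sup>2 H - f\<^sup>2/2 + (n - 4) f\<close> satisfies
  \<open>(\<Delta> - u \<cdot> \<nabla>) G = r\<^sup>2 |\<omega>|\<^sup>2 - |\<nabla>f|\<^sup>2\<close>, which is nonnegative because \<open>\<omega> x = \<nabla>f\<close>. So \<open>G\<close> is a constant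
  \<open>c\<close>, the tangential vorticity vanishes, and the tangential velocity is a gradient \<open>\<nabla>\<phi>\<close> with
  \<open>\<Delta>\<phi> = - (n - 2) f / r\<^sup>2\<close>. A suitable \<open>q = (f + b) e\<^sup>-\<^sup>\<phi>\<close> satisfies
  \<open>(\<Delta> + \<nabla>\<phi> \<cdot> \<nabla>) q = e\<^sup>-\<^sup>\<phi> ((n - 3) f\<^sup>2 - 2 c) / r\<^sup>2\<close>. For \<open>n \<ge> 4\<close> this forces \<open>f = 0\<close> and then
  \<open>u = 0\<close>. For \<open>n = 3\<close> it gives \<open>f + 2 = C e\<^sup>\<phi>\<close>, a Liouville equation on the sphere; the function
  \<open>\<Psi> = r (2 / (f + 2))\<^sup>1\<^sup>/\<^sup>2\<close> solves \<open>\<Psi> \<Delta>\<Psi> = 1 + |\<nabla>\<Psi>|\<^sup>2\<close>, and \<open>r \<Delta>\<Psi>\<close> is subharmonic, hence constant,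
  so that \<open>\<Psi> = a r - e \<cdot> x\<close>, which is a Landau solution.
\<close>

section \<open>Partial derivatives and smooth functions\<close>

text \<open>Homogeneous functions on the punctured space keep every computation in Euclidean partial
  derivatives; Euler's relation replaces calculus on the sphere. \<open>G\<close> is found by
  cancellation: \<Delta> - u . \<nabla> applied to r^2 H leaves the terms (2 n - 8) H - 2 f H of
  unknown sign, and -f^2/2 and (n - 4) f remove them because f is mapped to -2 H. The factor
  exp(-\<phi>) in \<open>q\<close> turns the drift -\<nabla>\<phi> in the equation of f into
  +\<nabla>\<phi>; the terms quadratic in \<nabla>\<phi> cancel, and the remaining zero-order term
  -(f + b) \<Delta>\<phi> is a polynomial in f over r^2. The obstacle is the unknown sign of c. For
  n = 3 the right-hand side of the equation for \<open>q\<close> has one sign whatever c is; for n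
  \<ge> 4 and c > 0 the equation of f at a minimum of f takes over. The geometry behind \<Psi>: on
  the unit sphere, \<Psi>^(-2) times the round metric is a conformal metric of curvature 1, and the
  last step classifies these by showing that the Hessian of \<Psi> is that of a multiple of
  r.\<close>

lemma partial_eq_has_derivative:
  "(f has_derivative f') (at x) \<Longrightarrow> partial i f x = f' (axis i 1)"
  unfolding partial_def by (metis frechet_derivative_at)

lemma partial_cong:
  assumes "open S" "x \<in> S" "\<And>y. y \<in> S \<Longrightarrow> f y = g y"
  shows "partial i f x = partial i g x"
proof -
  have "(f has_derivative F) (at x) \<longleftrightarrow> (g has_derivative F) (at x)" for F
    using has_derivative_transform_within_open[OF _ assms(1,2), of f F UNIV g]
      has_derivative_transform_within_open[OF _ assms(1,2), of g F UNIV f] assms(3) by auto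
  then show ?thesis unfolding partial_def frechet_derivative_def by simp
qed

lemma differentiable_cong:
  assumes "open S" "x \<in> S" "\<And>y. y \<in> S \<Longrightarrow> f y = g y" "f differentiable (at x)"
  shows "g differentiable (at x)"
proof -
  obtain F where "(f has_derivative F) (at x)"
    using assms(4) unfolding differentiable_def by blast
  then have "(g has_derivative F) (at x)"
    using has_derivative_transform_within_open[OF _ assms(1,2)] assms(3) by blast
  then show ?thesis unfolding differentiable_def by blast
qed

lemma has_derivative_partial:
  fixes f :: "real^'n \<Rightarrow> 'b::real_normed_vector"
  assumes "f differentiable (at x)"
  shows "(f has_derivative (\<lambda>h. \<Sum>i\<in>UNIV. h $ i *\<^sub>R partial i f x)) (at x)"
proof -
  have D: "(f has_derivative frechet_derivative f (at x)) (at x)"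
    using assms frechet_derivative_works by blast
  then interpret L: linear "frechet_derivative f (at x)"
    by (rule has_derivative_linear)
  have "frechet_derivative f (at x) h = (\<Sum>i\<in>UNIV. h $ i *\<^sub>R partial i f x)" for h
  proof -
    have "frechet_derivative f (at x) h = frechet_derivative f (at x) (\<Sum>i\<in>UNIV. h $ i *\<^sub>R axis i 1)"
      using basis_expansion[of h] by (simp add: scalar_mult_eq_scaleR)
    then show ?thesis
      unfolding partial_def by (simp add: L.sum L.scaleR)
  qed
  then have "frechet_derivative f (at x) = (\<lambda>h. \<Sum>i\<in>UNIV. h $ i *\<^sub>R partial i f x)" by blast
  with D show ?thesis by simp
qed

lemma partial_const [simp]: "partial i (\<lambda>x. c) x = 0"
  unfolding partial_def by simp

lemma partial_coord: "partial i (\<lambda>y. y $ j) x = (if i = j then 1 else 0)"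
proof -
  have "((\<lambda>y. y $ j) has_derivative (\<lambda>h. h $ j)) (at x)"
    by (simp add: bounded_linear_imp_has_derivative bounded_linear_vec_nth)
  from partial_eq_has_derivative[OF this] show ?thesis by (simp add: axis_def)
qed

lemma partial_add:
  assumes "f differentiable (at x)" "g differentiable (at x)"
  shows "partial i (\<lambda>y. f y + g y) x = partial i f x + partial i g x"
  unfolding partial_def
  by (rule partial_eq_has_derivative[unfolded partial_def, OF has_derivative_add])
     (use assms frechet_derivative_works in blast)+

lemma partial_diff:
  assumes "f differentiable (at x)" "g differentiable (at x)"
  shows "partial i (\<lambda>y. f y - g y) x = partial i f x - partial i g x"
  unfolding partial_def
  by (rule partial_eq_has_derivative[unfolded partial_def, OF has_derivative_diff])
     (use assms frechet_derivative_works in blast)+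

lemma partial_minus:
  assumes "f differentiable (at x)"
  shows "partial i (\<lambda>y. - f y) x = - partial i f x"
  unfolding partial_def
  by (rule partial_eq_has_derivative[unfolded partial_def, OF has_derivative_minus])
     (use assms frechet_derivative_works in blast)

lemma partial_mult:
  fixes f g :: "real^'n \<Rightarrow> real"
  assumes "f differentiable (at x)" "g differentiable (at x)"
  shows "partial i (\<lambda>y. f y * g y) x = f x * partial i g x + partial i f x * g x"
  unfolding partial_def
  by (rule partial_eq_has_derivative[unfolded partial_def, OF has_derivative_mult])
     (use assms frechet_derivative_works in blast)+

lemma partial_cmult:
  fixes f :: "real^'n \<Rightarrow> real"
  assumes "f differentiable (at x)"
  shows "partial i (\<lambda>y. c * f y) x = c * partial i f x"
  using partial_mult[OF differentiable_const assms] by simp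

lemma partial_sum:
  assumes "\<And>j. j \<in> J \<Longrightarrow> f j differentiable (at x)"
  shows "partial i (\<lambda>y. \<Sum>j\<in>J. f j y) x = (\<Sum>j\<in>J. partial i (f j) x)"
  unfolding partial_def
  by (rule partial_eq_has_derivative[unfolded partial_def, OF has_derivative_sum])
     (use assms frechet_derivative_works in blast)

lemma partial_linear:
  assumes "bounded_linear l" "f differentiable (at x)"
  shows "partial i (\<lambda>y. l (f y)) x = l (partial i f x)"
  unfolding partial_def
  by (rule partial_eq_has_derivative[unfolded partial_def, OF bounded_linear.has_derivative[OF assms(1)]])
     (use assms(2) frechet_derivative_works in blast)

lemma partial_compose_real:
  fixes f :: "real^'n \<Rightarrow> real"
  assumes "f differentiable (at x)" "(h has_field_derivative h') (at (f x))"
  shows "partial i (\<lambda>y. h (f y)) x = h' * partial i f x"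
proof -
  have "(f has_derivative frechet_derivative f (at x)) (at x)"
    using assms(1) frechet_derivative_works by blast
  from has_derivative_compose[OF this assms(2)[unfolded has_field_derivative_def]]
  show ?thesis by (subst partial_eq_has_derivative, assumption) (simp add: partial_def)
qed

lemma differentiable_compose_real:
  fixes f :: "real^'n \<Rightarrow> real"
  assumes "f differentiable (at x)" "(h has_field_derivative h') (at (f x))"
  shows "(\<lambda>y. h (f y)) differentiable (at x)"
proof -
  have "(f has_derivative frechet_derivative f (at x)) (at x)"
    using assms(1) frechet_derivative_works by blast
  from has_derivative_compose[OF this assms(2)[unfolded has_field_derivative_def]]
  show ?thesis unfolding differentiable_def by blast
qed

lemma differentiable_coord: "(\<lambda>y::real^'n. y $ j) differentiable (at x)"
  by (intro bounded_linear_imp_differentiable bounded_linear_vec_nth)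

section \<open>Closure properties of C^k and smooth functions\<close>

lemma Ck_on_cong:
  assumes "open S"
  shows "(\<And>x. x \<in> S \<Longrightarrow> f x = g x) \<Longrightarrow> Ck_on k f S \<Longrightarrow> Ck_on k g S"
proof (induction k arbitrary: f g)
  case 0
  then show ?case by (metis Ck_on.simps(1) continuous_on_cong)
next
  case (Suc k)
  have "Ck_on k (partial i g) S" for i
    using Suc.IH[of "partial i f" "partial i g"] Suc.prems partial_cong[OF assms, of _ f g i] by auto
  moreover have "g differentiable (at x)" if "x \<in> S" for x
    using differentiable_cong[OF assms that] Suc.prems that by auto
  ultimately show ?case by simp
qed

lemma Ck_on_Suc_imp: "Ck_on (Suc k) f S \<Longrightarrow> Ck_on k f S"
proof (induction k arbitrary: f)
  case 0
  then show ?case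
    by (auto intro!: continuous_at_imp_continuous_on differentiable_imp_continuous_within)
next
  case (Suc k)
  then show ?case by (metis Ck_on.simps(2))
qed

lemma Ck_on_const: "Ck_on k (\<lambda>x. c) S"
proof (induction k arbitrary: c)
  case (Suc k)
  have "partial i (\<lambda>x. c) = (\<lambda>x. 0)" for i :: 'a by (simp add: fun_eq_iff)
  with Suc show ?case by simp
qed simp

lemma Ck_on_coord: "Ck_on k (\<lambda>y::real^'n. y $ j) S"
proof (cases k)
  case 0
  then show ?thesis by (simp add: continuous_on_component)
next
  case (Suc m)
  have "partial i (\<lambda>y::real^'n. y $ j) = (\<lambda>x. if i = j then 1 else 0)" for i
    by (simp add: fun_eq_iff partial_coord)
  then show ?thesis using Suc differentiable_coord Ck_on_const by auto
qed

lemma Ck_on_linear: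
  assumes "open S" "bounded_linear l"
  shows "Ck_on k f S \<Longrightarrow> Ck_on k (\<lambda>x. l (f x)) S"
proof (induction k arbitrary: f)
  case 0
  then show ?case
    using assms(2) by (simp add: bounded_linear.continuous_on)
next
  case (Suc k)
  have "Ck_on k (partial i (\<lambda>x. l (f x))) S" for i
    by (rule Ck_on_cong[OF assms(1), of "\<lambda>x. l (partial i f x)"])
       (use Suc in \<open>auto simp: partial_linear[OF assms(2)]\<close>)
  moreover have "(\<lambda>x. l (f x)) differentiable (at x)" if "x \<in> S" for x
  proof -
    have "(f has_derivative frechet_derivative f (at x)) (at x)"
      using Suc.prems that frechet_derivative_works by auto
    from bounded_linear.has_derivative[OF assms(2) this] show ?thesis
      unfolding differentiable_def by blast
  qed
  ultimately show ?case by simp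
qed

lemma Ck_on_add:
  assumes "open S"
  shows "Ck_on k f S \<Longrightarrow> Ck_on k g S \<Longrightarrow> Ck_on k (\<lambda>x. f x + g x) S"
proof (induction k arbitrary: f g)
  case 0
  then show ?case by (simp add: continuous_on_add)
next
  case (Suc k)
  have "Ck_on k (partial i (\<lambda>x. f x + g x)) S" for i
    by (rule Ck_on_cong[OF assms(1), of "\<lambda>x. partial i f x + partial i g x"])
       (use Suc in \<open>auto simp: partial_add\<close>)
  then show ?case using Suc.prems by simp
qed

lemma Ck_on_mult:
  fixes f g :: "real^'n \<Rightarrow> real"
  assumes "open S"
  shows "Ck_on k f S \<Longrightarrow> Ck_on k g S \<Longrightarrow> Ck_on k (\<lambda>x. f x * g x) S"
proof (induction k arbitrary: f g)
  case 0
  then show ?case by (simp add: continuous_on_mult)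
next
  case (Suc k)
  have "Ck_on k (partial i (\<lambda>x. f x * g x)) S" for i
    by (rule Ck_on_cong[OF assms(1), of "\<lambda>x. f x * partial i g x + partial i f x * g x"])
       (use Suc Ck_on_Suc_imp[OF Suc.prems(1)] Ck_on_Suc_imp[OF Suc.prems(2)]
         in \<open>auto simp: partial_mult intro!: Ck_on_add[OF assms]\<close>)
  then show ?case using Suc.prems by simp
qed

lemma Ck_on_subset: "Ck_on k f S \<Longrightarrow> T \<subseteq> S \<Longrightarrow> Ck_on k f T"
proof (induction k arbitrary: f)
  case 0
  then show ?case using continuous_on_subset by auto
qed auto

lemma smooth_on_subset: "smooth_on f S \<Longrightarrow> T \<subseteq> S \<Longrightarrow> smooth_on f T"
  unfolding smooth_on_def using Ck_on_subset by blast

text \<open>A description of smoothness by itself, without the order k. With it, smoothness can be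
  read off from a formula for the partial derivatives.\<close>

lemma smooth_on_rec:
  "smooth_on f S \<longleftrightarrow> (\<forall>x\<in>S. f differentiable (at x)) \<and> (\<forall>i. smooth_on (partial i f) S)"
proof
  assume f: "smooth_on f S"
  then have "Ck_on (Suc k) f S" for k unfolding smooth_on_def by blast
  then show "(\<forall>x\<in>S. f differentiable (at x)) \<and> (\<forall>i. smooth_on (partial i f) S)"
    unfolding smooth_on_def Ck_on.simps(2) by blast
next
  assume f: "(\<forall>x\<in>S. f differentiable (at x)) \<and> (\<forall>i. smooth_on (partial i f) S)"
  then have "Ck_on (Suc k) f S" for k unfolding smooth_on_def Ck_on.simps(2) by blast
  then show "smooth_on f S" unfolding smooth_on_def using Ck_on_Suc_imp by blast
qed

lemma smooth_on_partial: "smooth_on f S \<Longrightarrow> smooth_on (partial i f) S"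
  using smooth_on_rec by blast

lemma smooth_on_differentiable: "smooth_on f S \<Longrightarrow> x \<in> S \<Longrightarrow> f differentiable (at x)"
  using smooth_on_rec by blast

lemma smooth_on_continuous_on: "smooth_on f S \<Longrightarrow> continuous_on S f"
  unfolding smooth_on_def by (metis Ck_on.simps(1))

lemma smooth_on_cong:
  "open S \<Longrightarrow> (\<And>x. x \<in> S \<Longrightarrow> f x = g x) \<Longrightarrow> smooth_on f S \<Longrightarrow> smooth_on g S"
  unfolding smooth_on_def using Ck_on_cong by metis

lemma smooth_on_const: "smooth_on (\<lambda>x. c) S"
  unfolding smooth_on_def by (simp add: Ck_on_const)

lemma smooth_on_coord: "smooth_on (\<lambda>x. x $ j) S"
  unfolding smooth_on_def by (simp add: Ck_on_coord)

lemma smooth_on_linear: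
  "open S \<Longrightarrow> bounded_linear l \<Longrightarrow> smooth_on f S \<Longrightarrow> smooth_on (\<lambda>x. l (f x)) S"
  unfolding smooth_on_def by (simp add: Ck_on_linear)

lemma smooth_on_add:
  "open S \<Longrightarrow> smooth_on f S \<Longrightarrow> smooth_on g S \<Longrightarrow> smooth_on (\<lambda>x. f x + g x) S"
  unfolding smooth_on_def by (simp add: Ck_on_add)

lemma smooth_on_mult:
  fixes f g :: "real^'n \<Rightarrow> real"
  shows "open S \<Longrightarrow> smooth_on f S \<Longrightarrow> smooth_on g S \<Longrightarrow> smooth_on (\<lambda>x. f x * g x) S"
  unfolding smooth_on_def by (simp add: Ck_on_mult)

lemma smooth_on_minus: "open S \<Longrightarrow> smooth_on f S \<Longrightarrow> smooth_on (\<lambda>x. - f x) S"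
  by (rule smooth_on_linear[OF _ bounded_linear_minus[OF bounded_linear_ident]])

lemma smooth_on_diff:
  "open S \<Longrightarrow> smooth_on f S \<Longrightarrow> smooth_on g S \<Longrightarrow> smooth_on (\<lambda>x. f x - g x) S"
  using smooth_on_add[OF _ _ smooth_on_minus, of S f g] by simp

lemma smooth_on_sum:
  assumes "open S" "finite J" "\<And>j. j \<in> J \<Longrightarrow> smooth_on (f j) S"
  shows "smooth_on (\<lambda>x. \<Sum>j\<in>J. f j x) S"
  using assms(2,3)
  by (induction rule: finite_induct) (auto simp: smooth_on_const intro!: smooth_on_add[OF assms(1)])

text \<open>The induction runs over the order with f fixed: each partial derivative of exp f is exp
  f times a smooth function, so the induction hypothesis for exp f itself gives the next order. The
  same works for the reciprocal.\<close>

lemma Ck_on_exp: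
  fixes f :: "real^'n \<Rightarrow> real"
  assumes S: "open S" and f: "smooth_on f S"
  shows "Ck_on k (\<lambda>x. exp (f x)) S"
proof (induction k)
  case 0
  then show ?case using smooth_on_continuous_on[OF f] by (simp add: continuous_on_exp)
next
  case (Suc k)
  have "Ck_on k (partial i (\<lambda>x. exp (f x))) S" for i
    by (rule Ck_on_cong[OF S, of "\<lambda>x. exp (f x) * partial i f x"])
       (use Suc smooth_on_partial[OF f] in \<open>auto simp: smooth_on_def partial_compose_real[OF smooth_on_differentiable[OF f] DERIV_exp]
         intro!: Ck_on_mult[OF S]\<close>)
  then show ?case
    using differentiable_compose_real[OF smooth_on_differentiable[OF f] DERIV_exp] by auto
qed

lemma smooth_on_exp:
  fixes f :: "real^'n \<Rightarrow> real"
  shows "open S \<Longrightarrow> smooth_on f S \<Longrightarrow> smooth_on (\<lambda>x. exp (f x)) S"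
  unfolding smooth_on_def[of "\<lambda>x. exp (f x)"] using Ck_on_exp by blast

lemma Ck_on_inverse:
  fixes f :: "real^'n \<Rightarrow> real"
  assumes S: "open S" and f: "smooth_on f S" and nz: "\<And>x. x \<in> S \<Longrightarrow> f x \<noteq> 0"
  shows "Ck_on k (\<lambda>x. inverse (f x)) S"
proof (induction k)
  case 0
  then show ?case using smooth_on_continuous_on[OF f] nz by (simp add: continuous_on_inverse)
next
  case (Suc k)
  note D = DERIV_inverse[OF nz]
  have "Ck_on k (partial i (\<lambda>x. inverse (f x))) S" for i
    by (rule Ck_on_cong[OF S, of "\<lambda>x. - 1 * ((inverse (f x) * inverse (f x)) * partial i f x)"])
       (use Suc smooth_on_partial[OF f] in \<open>auto simp: smooth_on_def partial_compose_real[OF smooth_on_differentiable[OF f] D] power2_eq_square numeral_2_eq_2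
         intro!: Ck_on_mult[OF S] Ck_on_linear[OF S bounded_linear_minus[OF bounded_linear_ident]]\<close>)
  then show ?case
    using differentiable_compose_real[OF smooth_on_differentiable[OF f] D] by auto
qed

lemma smooth_on_inverse:
  fixes f :: "real^'n \<Rightarrow> real"
  shows "open S \<Longrightarrow> smooth_on f S \<Longrightarrow> (\<And>x. x \<in> S \<Longrightarrow> f x \<noteq> 0) \<Longrightarrow> smooth_on (\<lambda>x. inverse (f x)) S"
  unfolding smooth_on_def[of "\<lambda>x. inverse (f x)"] using Ck_on_inverse by blast

section \<open>The strong maximum principle\<close>

lemma has_real_derivative_along_line:
  fixes f :: "real^'n \<Rightarrow> real"
  assumes "f differentiable (at (y + s *\<^sub>R v))"
  shows "((\<lambda>s. f (y + s *\<^sub>R v)) has_real_derivative (\<Sum>i\<in>UNIV. v $ i * partial i f (y + s *\<^sub>R v))) (at s)"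
proof -
  have "((\<lambda>s. y + s *\<^sub>R v) has_derivative (\<lambda>h. h *\<^sub>R v)) (at s)"
    by (auto intro!: derivative_eq_intros)
  from has_derivative_compose[OF this has_derivative_partial[OF assms]]
  show ?thesis
    unfolding has_field_derivative_def
    by (rule has_derivative_eq_rhs) (auto simp: fun_eq_iff sum_distrib_right sum_distrib_left algebra_simps)
qed

lemma has_real_derivative_along_axis:
  fixes f :: "real^'n \<Rightarrow> real"
  assumes "f differentiable (at (y + s *\<^sub>R axis i 1))"
  shows "((\<lambda>s. f (y + s *\<^sub>R axis i 1)) has_real_derivative partial i f (y + s *\<^sub>R axis i 1)) (at s)"
  using has_real_derivative_along_line[OF assms]
  by (simp add: axis_def if_distrib[of "\<lambda>c. c * _"] cong: if_cong)

text \<open>The mean value theorem in direction i and then in direction j. The second difference is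
  symmetric in i and j, so comparing both orders for small h gives the symmetry of second
  derivatives.\<close>

lemma second_difference_mean_value:
  fixes f :: "real^'n \<Rightarrow> real"
  assumes f: "smooth_on f S" and h: "h > 0" and S: "cball x (2 * h) \<subseteq> S"
  shows "\<exists>y\<in>cball x (2 * h). f (x + h *\<^sub>R axis i 1 + h *\<^sub>R axis j 1) - f (x + h *\<^sub>R axis i 1)
    - f (x + h *\<^sub>R axis j 1) + f x = h\<^sup>2 * partial j (partial i f) y"
proof -
  define P where "P s t = x + t *\<^sub>R axis j 1 + s *\<^sub>R axis i 1" for s t
  have inc: "P s t \<in> cball x (2 * h)" if "0 \<le> s" "s \<le> h" "0 \<le> t" "t \<le> h" for s t
  proof -
    have "norm (t *\<^sub>R axis j 1 + s *\<^sub>R axis i 1 :: real^'n) \<le> t + s"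
      using norm_triangle_ineq[of "t *\<^sub>R axis j 1 :: real^'n" "s *\<^sub>R axis i 1"] that by simp
    then show ?thesis
      unfolding P_def using that
      by (simp add: dist_norm norm_minus_commute add.assoc) (simp add: add.commute)
  qed
  have PS: "P s t \<in> S" if "0 \<le> s" "s \<le> h" "0 \<le> t" "t \<le> h" for s t
    using inc[OF that] S by blast
  have 1: "((\<lambda>s. f (P s h) - f (P s 0)) has_real_derivative partial i f (P s h) - partial i f (P s 0)) (at s)"
    if "0 \<le> s" "s \<le> h" for s
    unfolding P_def
    by (intro DERIV_diff has_real_derivative_along_axis smooth_on_differentiable[OF f])
       (use PS[of s h] PS[of s 0] that h in \<open>auto simp: P_def\<close>)
  obtain \<sigma> where \<sigma>: "0 < \<sigma>" "\<sigma> < h"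
    and e1: "(f (P h h) - f (P h 0)) - (f (P 0 h) - f (P 0 0)) = (h - 0) * (partial i f (P \<sigma> h) - partial i f (P \<sigma> 0))"
    using MVT2[OF h 1] by blast
  define Q where "Q t = x + \<sigma> *\<^sub>R axis i 1 + t *\<^sub>R axis j 1" for t
  have QP: "Q t = P \<sigma> t" for t by (simp add: Q_def P_def)
  have 2: "((\<lambda>t. partial i f (Q t)) has_real_derivative partial j (partial i f) (Q t)) (at t)"
    if "0 \<le> t" "t \<le> h" for t
    unfolding Q_def
    by (intro has_real_derivative_along_axis smooth_on_differentiable[OF smooth_on_partial[OF f]])
       (use PS[of \<sigma> t] that \<sigma> in \<open>auto simp: QP[symmetric] Q_def\<close>)
  obtain \<tau> where \<tau>: "0 < \<tau>" "\<tau> < h"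
    and e2: "partial i f (Q h) - partial i f (Q 0) = (h - 0) * partial j (partial i f) (Q \<tau>)"
    using MVT2[OF h 2] by blast
  have "f (x + h *\<^sub>R axis i 1 + h *\<^sub>R axis j 1) - f (x + h *\<^sub>R axis i 1)
    - f (x + h *\<^sub>R axis j 1) + f x = h\<^sup>2 * partial j (partial i f) (Q \<tau>)"
    using e1 e2 unfolding QP[symmetric] by (simp add: P_def power2_eq_square algebra_simps)
  then show ?thesis using inc[of \<sigma> \<tau>] \<sigma> \<tau> QP by (metis less_imp_le)
qed

lemma partial_commute:
  fixes f :: "real^'n \<Rightarrow> real"
  assumes f: "smooth_on f S" and S: "open S" "x \<in> S"
  shows "partial i (partial j f) x = partial j (partial i f) x"
proof (rule ccontr)
  let ?A = "partial i (partial j f)" and ?B = "partial j (partial i f)"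
  assume ne: "?A x \<noteq> ?B x"
  define e where "e = \<bar>?A x - ?B x\<bar> / 2"
  have e: "e > 0" using ne by (simp add: e_def)
  have cA: "isCont ?A x" and cB: "isCont ?B x"
    using smooth_on_continuous_on[OF smooth_on_partial[OF smooth_on_partial[OF f]]] S
    by (auto simp: continuous_on_eq_continuous_at)
  obtain d1 where d1: "d1 > 0" "\<And>y. dist y x < d1 \<Longrightarrow> \<bar>?A y - ?A x\<bar> < e"
    using cA e unfolding continuous_at_eps_delta dist_real_def by meson
  obtain d2 where d2: "d2 > 0" "\<And>y. dist y x < d2 \<Longrightarrow> \<bar>?B y - ?B x\<bar> < e"
    using cB e unfolding continuous_at_eps_delta dist_real_def by meson
  obtain d3 where d3: "d3 > 0" "ball x d3 \<subseteq> S"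
    using S openE by blast
  \<comment> \<open>The intermediate points lie within 2 h of x, so a quarter keeps them strictly
    inside all three balls.\<close>
  define h where "h = min d1 (min d2 d3) / 4"
  have h: "h > 0" "2 * h < d1" "2 * h < d2" "2 * h < d3"
    using d1(1) d2(1) d3(1) by (auto simp: h_def)
  have sub: "cball x (2 * h) \<subseteq> S"
    using d3(2) h(4) by (auto simp: subset_iff)
  obtain y where y: "y \<in> cball x (2 * h)" "f (x + h *\<^sub>R axis i 1 + h *\<^sub>R axis j 1) - f (x + h *\<^sub>R axis i 1)
    - f (x + h *\<^sub>R axis j 1) + f x = h\<^sup>2 * ?B y"
    using second_difference_mean_value[OF f h(1) sub, of i j] by blast
  obtain z where z: "z \<in> cball x (2 * h)" "f (x + h *\<^sub>R axis j 1 + h *\<^sub>R axis i 1) - f (x + h *\<^sub>R axis j 1)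
    - f (x + h *\<^sub>R axis i 1) + f x = h\<^sup>2 * ?A z"
    using second_difference_mean_value[OF f h(1) sub, of j i] by blast
  have "h\<^sup>2 * ?B y = h\<^sup>2 * ?A z"
    using y(2) z(2) by (simp add: algebra_simps)
  then have "?B y = ?A z" using h(1) by simp
  moreover have "\<bar>?A z - ?A x\<bar> < e" "\<bar>?B y - ?B x\<bar> < e"
    using d1(2)[of z] d2(2)[of y] y(1) z(1) h by (auto simp: dist_commute)
  moreover have "\<bar>?A x - ?B x\<bar> = 2 * e" by (simp add: e_def)
  moreover have "\<bar>?A x - ?B x\<bar> \<le> \<bar>?A z - ?A x\<bar> + \<bar>?A z - ?B x\<bar>" by linarith
  ultimately show False by simp
qed

lemma partial_local_max:
  fixes f :: "real^'n \<Rightarrow> real"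
  assumes f: "smooth_on f S" and r: "r > 0" "ball x r \<subseteq> S"
    and max: "\<And>y. y \<in> ball x r \<Longrightarrow> f y \<le> f x"
  shows "partial i f x = 0" "partial i (partial i f) x \<le> 0"
proof -
  define g where "g s = f (x + s *\<^sub>R axis i 1)" for s
  have inb: "x + s *\<^sub>R axis i 1 \<in> ball x r" if "\<bar>s\<bar> < r" for s
    using that by (simp add: dist_norm)
  have D: "(g has_real_derivative partial i f (x + s *\<^sub>R axis i 1)) (at s)" if "\<bar>s\<bar> < r" for s
    unfolding g_def using inb[OF that] r f
    by (intro has_real_derivative_along_axis smooth_on_differentiable[OF f]) auto
  have D2: "((\<lambda>s. partial i f (x + s *\<^sub>R axis i 1)) has_real_derivative partial i (partial i f) (x + 0 *\<^sub>R axis i 1)) (at 0)"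
    using inb[of 0] r f
    by (intro has_real_derivative_along_axis smooth_on_differentiable[OF smooth_on_partial[OF f]]) auto
  show p0: "partial i f x = 0"
    using DERIV_local_max[OF D[of 0] r(1)] max inb r(1) by (simp add: g_def)
  show "partial i (partial i f) x \<le> 0"
  \<comment> \<open>A positive second derivative would make the first derivative, which vanishes at
    0, positive just to the right of 0, and the function would exceed its maximum there.\<close>
  proof (rule ccontr)
    assume "\<not> ?thesis"
    then obtain d where d: "d > 0" "\<And>h. 0 < h \<Longrightarrow> h < d \<Longrightarrow> 0 < partial i f (x + h *\<^sub>R axis i 1)"
      using DERIV_pos_inc_right[OF D2] p0 by auto
    define s where "s = min d r / 2"
    have s: "0 < s" "s < d" "s < r" using d(1) r(1) by (auto simp: s_def)
    obtain z where z: "0 < z" "z < s" "g s - g 0 = (s - 0) * partial i f (x + z *\<^sub>R axis i 1)"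
      using MVT2[OF s(1), of g "\<lambda>s. partial i f (x + s *\<^sub>R axis i 1)"] D s(3) by force
    moreover have "s * partial i f (x + z *\<^sub>R axis i 1) > 0" using d(2)[of z] s z by simp
    ultimately have "g s > g 0" by simp
    then show False using max[OF inb[of s]] s by (simp add: g_def)
  qed
qed

text \<open>Hopf's barrier argument, in a ball touching the maximum set at a single point.\<close>

lemma hopf_touching_ball:
  fixes f :: "real^'n \<Rightarrow> real"
  assumes S: "open S" and f: "smooth_on f S" and b: "\<And>i. continuous_on S (b i)"
    and L: "\<And>x. x \<in> S \<Longrightarrow> (\<Sum>i\<in>UNIV. partial i (partial i f) x) + (\<Sum>i\<in>UNIV. b i x * partial i f x) \<ge> 0"
    and R: "R > 0" "cball y R \<subseteq> S" "dist y x0 = R" and M: "f x0 = M"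
    and less: "\<And>z. z \<in> cball y R \<Longrightarrow> z \<noteq> x0 \<Longrightarrow> f z < M"
    and le: "\<And>z. z \<in> S \<Longrightarrow> f z \<le> M"
  shows False
proof -
  have x0S: "x0 \<in> S" using R by auto
  obtain r where r: "r > 0" "cball x0 r \<subseteq> S" using S x0S open_contains_cball by blast
  \<comment> \<open>Points of the ball of radius \<rho> about x0 keep distance at least R/2 from y.
    The barrier is a strict subsolution there, but not near its centre y.\<close>
  define \<rho> where "\<rho> = min r (R / 2)"
  have \<rho>: "\<rho> > 0" "\<rho> \<le> R / 2" "cball x0 \<rho> \<subseteq> S" using r R by (auto simp: \<rho>_def)
  have "compact ((\<lambda>x. \<Sum>i\<in>UNIV. b i x * (x $ i - y $ i)) ` cball x0 \<rho>)"
    by (intro compact_continuous_image compact_cball continuous_intros continuous_on_subset[OF b \<rho>(3)])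
  then have "bounded ((\<lambda>x. \<Sum>i\<in>UNIV. b i x * (x $ i - y $ i)) ` cball x0 \<rho>)"
    by (rule compact_imp_bounded)
  then have "\<exists>C. \<forall>x\<in>cball x0 \<rho>. \<bar>\<Sum>i\<in>UNIV. b i x * (x $ i - y $ i)\<bar> \<le> C"
    unfolding bounded_iff by auto
  then obtain C where C: "\<And>x. x \<in> cball x0 \<rho> \<Longrightarrow> \<bar>\<Sum>i\<in>UNIV. b i x * (x $ i - y $ i)\<bar> \<le> C"
    by blast
  have C0: "C \<ge> 0" using C[of x0] \<rho>(1) by (smt (verit) centre_in_cball)
  define N where "N = real CARD('n)"
  \<comment> \<open>Chosen so that 2 \<alpha> (R/2)^2 = N + C + 1: at distance at least R/2 from y
    the leading term of the barrier beats both the dimension term N and the drift term, which is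
    bounded by C.\<close>
  define \<alpha> where "\<alpha> = (N + C + 1) / (2 * (R / 2)\<^sup>2)"
  have \<alpha>: "\<alpha> > 0" using C0 R(1) by (auto simp: \<alpha>_def N_def intro!: divide_pos_pos add_nonneg_pos)
  have \<alpha>2: "4 * \<alpha>\<^sup>2 * q - 2 * \<alpha> * N - 2 * \<alpha> * s > 0" if "q \<ge> (R / 2)\<^sup>2" "\<bar>s\<bar> \<le> C" for q s
  proof -
    have "2 * \<alpha> * (R / 2)\<^sup>2 = N + C + 1" using R(1) by (simp add: \<alpha>_def)
    moreover have "2 * \<alpha> * (R / 2)\<^sup>2 \<le> 2 * \<alpha> * q" using that(1) \<alpha> by simp
    ultimately have "2 * \<alpha> * q - N - s > 0" using that(2) by linarith
    then have "2 * \<alpha> * (2 * \<alpha> * q - N - s) > 0" using \<alpha> by simp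
    then show ?thesis by (simp add: algebra_simps power2_eq_square)
  qed
  define Q where "Q x = (\<Sum>i\<in>UNIV. (x $ i - y $ i) * (x $ i - y $ i))" for x :: "real^'n"
  define v where "v x = exp (- \<alpha> * Q x)" for x
  have Qd: "Q x = (dist y x)\<^sup>2" for x
    unfolding Q_def dist_norm power2_norm_eq_inner inner_vec_def
    by (intro sum.cong) (auto simp: algebra_simps)
  have sm: "smooth_on (\<lambda>x. x $ i - y $ i) UNIV" for i :: 'n
    by (intro smooth_on_diff smooth_on_coord smooth_on_const) auto
  have Qs: "smooth_on Q UNIV"
    unfolding Q_def by (intro smooth_on_sum smooth_on_mult sm) auto
  have aQ: "smooth_on (\<lambda>x. - \<alpha> * Q x) UNIV"
    by (intro smooth_on_mult smooth_on_const Qs) auto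
  have vs: "smooth_on v UNIV"
    unfolding v_def by (intro smooth_on_exp aQ) auto
  have pc: "partial i (\<lambda>x. x $ j - y $ j) x = (if i = j then 1 else 0)" for i j :: 'n and x
    by (subst partial_diff) (auto simp: differentiable_coord partial_coord)
  have dc: "(\<lambda>x. x $ j - y $ j) differentiable (at x)" for j :: 'n and x
    using smooth_on_differentiable[OF sm] by simp
  have pQ: "partial i Q x = 2 * (x $ i - y $ i)" for i x
  proof -
    have "partial i Q x = (\<Sum>j\<in>UNIV. partial i (\<lambda>x. (x $ j - y $ j) * (x $ j - y $ j)) x)"
      unfolding Q_def by (rule partial_sum) (intro derivative_intros dc)
    also have "\<dots> = (\<Sum>j\<in>UNIV. if i = j then 2 * (x $ j - y $ j) else 0)"
      by (intro sum.cong) (auto simp: partial_mult dc pc)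
    finally show ?thesis by simp
  qed
  have pv: "partial i v x = (- 2 * \<alpha>) * ((x $ i - y $ i) * v x)" for i x
  proof -
    have "partial i v x = exp (- \<alpha> * Q x) * partial i (\<lambda>x. - \<alpha> * Q x) x"
      unfolding v_def
      by (rule partial_compose_real[OF smooth_on_differentiable[OF aQ] DERIV_exp]) auto
    moreover have "partial i (\<lambda>x. - \<alpha> * Q x) x = - \<alpha> * partial i Q x"
      using smooth_on_differentiable[OF Qs] by (intro partial_cmult) auto
    ultimately show ?thesis by (simp add: pQ v_def)
  qed
  have ppv: "partial i (partial i v) x = (4 * \<alpha>\<^sup>2 * ((x $ i - y $ i) * (x $ i - y $ i)) - 2 * \<alpha>) * v x" for i x
  proof -
    have dv: "v differentiable (at x)" using smooth_on_differentiable[OF vs] by simp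
    have "partial i (partial i v) x = partial i (\<lambda>x. (- 2 * \<alpha>) * ((x $ i - y $ i) * v x)) x"
      using pv[of i] by presburger
    also have "\<dots> = (- 2 * \<alpha>) * ((x $ i - y $ i) * partial i v x + 1 * v x)"
      by (subst partial_cmult) (auto simp: partial_mult dv dc pc)
    finally show ?thesis by (simp add: pv algebra_simps power2_eq_square)
  qed
  have Lv: "(\<Sum>i\<in>UNIV. partial i (partial i v) x) + (\<Sum>i\<in>UNIV. b i x * partial i v x) > 0"
    if x: "x \<in> cball x0 \<rho>" for x
  proof -
    have "(\<Sum>i\<in>UNIV. partial i (partial i v) x) + (\<Sum>i\<in>UNIV. b i x * partial i v x)
      = (4 * \<alpha>\<^sup>2 * Q x - 2 * \<alpha> * N - 2 * \<alpha> * (\<Sum>i\<in>UNIV. b i x * (x $ i - y $ i))) * v x"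
      unfolding ppv unfolding pv Q_def N_def
      by (simp add: algebra_simps sum_distrib_left sum_distrib_right sum_subtractf sum.distrib)
    moreover have "R / 2 \<le> dist y x"
      using x R(3) \<rho>(2) dist_triangle[of y x0 x] by (simp add: dist_commute)
    then have "(R / 2)\<^sup>2 \<le> Q x" unfolding Qd using R(1) by (intro power_mono) auto
    then have "4 * \<alpha>\<^sup>2 * Q x - 2 * \<alpha> * N - 2 * \<alpha> * (\<Sum>i\<in>UNIV. b i x * (x $ i - y $ i)) > 0"
      using \<alpha>2 C[OF x] by blast
    moreover have "v x > 0" by (simp add: v_def)
    ultimately show ?thesis by simp
  qed
  \<comment> \<open>On the part of the small sphere inside the closed ball, compactness keeps f
    below M by a fixed amount, since x0 is not on that sphere. On the rest of it, f is only known to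
    be at most M, but the barrier is negative.\<close>
  define K where "K = sphere x0 \<rho> \<inter> cball y R"
  have KS: "K \<subseteq> S" using R(2) by (auto simp: K_def)
  obtain \<delta> where \<delta>: "\<delta> > 0" "\<And>z. z \<in> K \<Longrightarrow> f z \<le> M - \<delta>"
  proof (cases "K = {}")
    case True
    then show ?thesis using that[of 1] by simp
  next
    case False
    have "compact K" unfolding K_def by (intro compact_Int compact_sphere compact_cball)
    then obtain w where w: "w \<in> K" "\<And>z. z \<in> K \<Longrightarrow> f z \<le> f w"
      using continuous_attains_sup[OF _ False continuous_on_subset[OF smooth_on_continuous_on[OF f] KS]] by blast
    have "w \<noteq> x0" using w(1) \<rho>(1) by (auto simp: K_def)
    then have "f w < M" using less w(1) by (auto simp: K_def)
    then show ?thesis using that[of "M - f w"] w(2) by simp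
  qed
  \<comment> \<open>Since v - c < 1, the perturbation stays below the gap \<delta>.\<close>
  define \<epsilon> where "\<epsilon> = \<delta> / 2"
  \<comment> \<open>The value of v on the sphere of radius R about y. Hence v - c is positive inside
    it, zero at x0 and negative outside.\<close>
  define c where "c = exp (- \<alpha> * R\<^sup>2)"
  define z where "z x = f x + \<epsilon> * (v x - c)" for x
  have \<epsilon>: "\<epsilon> > 0" using \<delta> by (simp add: \<epsilon>_def)
  have bd: "z x < M" if x: "x \<in> sphere x0 \<rho>" for x
  proof (cases "x \<in> cball y R")
    case True
    have "Q x \<ge> 0" unfolding Qd by simp
    then have "v x \<le> 1" using \<alpha> by (simp add: v_def)
    moreover have "c > 0" by (simp add: c_def)
    ultimately have "\<epsilon> * (v x - c) < \<epsilon> * 1" using \<epsilon> by (intro mult_strict_left_mono) auto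
    then have "\<epsilon> * (v x - c) < \<epsilon>" by (simp only: mult_1_right)
    moreover have "f x \<le> M - \<delta>" using \<delta>(2) True x by (simp add: K_def)
    moreover have "\<epsilon> < \<delta>" using \<delta>(1) by (simp add: \<epsilon>_def)
    ultimately show ?thesis unfolding z_def by linarith
  next
    case False
    then have "R < dist y x" by simp
    then have "R\<^sup>2 < Q x" unfolding Qd using R(1) by (intro power_strict_mono) auto
    then have "v x < c" using \<alpha> by (simp add: v_def c_def)
    then have "\<epsilon> * (v x - c) < 0" using \<epsilon> by (simp add: mult_pos_neg)
    moreover have "f x \<le> M" using le x \<rho>(3) by auto
    ultimately show ?thesis by (simp add: z_def)
  qed
  have zx0: "z x0 = M"
    using R(3) M by (simp add: z_def v_def c_def Qd)
  have vS: "smooth_on v S" using smooth_on_subset[OF vs] by simp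
  have zs: "smooth_on z S"
    unfolding z_def by (intro smooth_on_add smooth_on_mult smooth_on_diff smooth_on_const S f vS)
  \<comment> \<open>As z < M on the boundary of the small ball while z x0 = M, the maximum of z is
    interior. There the operator applied to z is at most 0, yet it is positive because f is a
    subsolution and v a strict one.\<close>
  obtain x1 where x1: "x1 \<in> cball x0 \<rho>" "\<And>x. x \<in> cball x0 \<rho> \<Longrightarrow> z x \<le> z x1"
    using continuous_attains_sup[OF compact_cball, of x0 \<rho> z] \<rho>(1)
      continuous_on_subset[OF smooth_on_continuous_on[OF zs] \<rho>(3)] by auto
  have "z x1 \<ge> M" using x1(2)[of x0] zx0 \<rho>(1) by simp
  then have "x1 \<notin> sphere x0 \<rho>" using bd by force
  then have x1b: "x1 \<in> ball x0 \<rho>" using x1(1) by auto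
  obtain s where s: "s > 0" "ball x1 s \<subseteq> ball x0 \<rho>"
    using x1b open_ball openE by blast
  have sS: "ball x1 s \<subseteq> S" and smax: "\<And>y. y \<in> ball x1 s \<Longrightarrow> z y \<le> z x1"
    using s(2) \<rho>(3) x1(2) by (auto simp: subset_iff)
  note crit = partial_local_max[OF zs s(1) sS smax]
  have dd: "g differentiable (at x1)" if "smooth_on g S" for g :: "real^'n \<Rightarrow> real"
    using smooth_on_differentiable[OF that] x1(1) \<rho>(3) by blast
  have pz: "partial i z x = partial i f x + \<epsilon> * partial i v x" if "x \<in> S" for i x
  proof -
    have "f differentiable (at x)" "v differentiable (at x)"
      using smooth_on_differentiable f vS that by blast+
    then show ?thesis unfolding z_def
      by (subst partial_add) (auto simp: partial_cmult partial_diff)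
  qed
  have ppz: "partial i (partial i z) x1 = partial i (partial i f) x1 + \<epsilon> * partial i (partial i v) x1" for i
  proof -
    have "partial i (partial i z) x1 = partial i (\<lambda>x. partial i f x + \<epsilon> * partial i v x) x1"
      using x1(1) \<rho>(3) by (intro partial_cong[OF S] pz) auto
    also have "\<dots> = partial i (partial i f) x1 + \<epsilon> * partial i (partial i v) x1"
      using dd[OF smooth_on_partial[OF f]] dd[OF smooth_on_partial[OF vS]]
      by (subst partial_add) (auto simp: partial_cmult)
    finally show ?thesis .
  qed
  have x1S: "x1 \<in> S" using x1(1) \<rho>(3) by blast
  have "0 \<ge> (\<Sum>i\<in>UNIV. partial i (partial i z) x1) + (\<Sum>i\<in>UNIV. b i x1 * partial i z x1)"
    using crit by (simp add: sum_nonpos)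
  also have "(\<Sum>i\<in>UNIV. partial i (partial i z) x1) + (\<Sum>i\<in>UNIV. b i x1 * partial i z x1)
    = ((\<Sum>i\<in>UNIV. partial i (partial i f) x1) + (\<Sum>i\<in>UNIV. b i x1 * partial i f x1))
    + \<epsilon> * ((\<Sum>i\<in>UNIV. partial i (partial i v) x1) + (\<Sum>i\<in>UNIV. b i x1 * partial i v x1))"
    unfolding ppz pz[OF x1S] by (simp add: algebra_simps sum.distrib sum_distrib_left)
  also have "\<dots> > 0"
    using L[OF x1S] mult_pos_pos[OF \<epsilon> Lv[OF x1(1)]] by linarith
  finally show False by simp
qed

text \<open>If the set of maximum points were not open, a ball centred outside it could be grown
  until it first touches that set. A ball of half the radius inside it touches at one point only,
  which \<open>hopf_touching_ball\<close> excludes.\<close>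

theorem strong_maximum_principle:
  fixes f :: "real^'n \<Rightarrow> real"
  assumes S: "open S" "connected S" and f: "smooth_on f S" and b: "\<And>i. continuous_on S (b i)"
    and L: "\<And>x. x \<in> S \<Longrightarrow> (\<Sum>i\<in>UNIV. partial i (partial i f) x) + (\<Sum>i\<in>UNIV. b i x * partial i f x) \<ge> 0"
    and m: "m \<in> S" "\<And>z. z \<in> S \<Longrightarrow> f z \<le> f m"
    and x: "x \<in> S"
  shows "f x = f m"
proof (rule ccontr)
  assume "f x \<noteq> f m"
  define Z where "Z = {z \<in> S. f z = f m}"
  have cf: "continuous_on S f" using smooth_on_continuous_on[OF f] .
  have "closedin (top_of_set S) Z"
    unfolding Z_def using continuous_closedin_preimage_constant[OF cf] .
  moreover have "Z \<noteq> {}" "Z \<noteq> S" using m(1) x \<open>f x \<noteq> f m\<close> by (auto simp: Z_def)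
  ultimately have "\<not> open Z"
    using S connected_clopen[of S] openin_open_eq[OF S(1)] unfolding Z_def by auto
  then obtain p where p: "p \<in> Z" "\<And>e. e > 0 \<Longrightarrow> \<not> ball p e \<subseteq> Z"
    unfolding open_contains_ball by blast
  have pS: "p \<in> S" and fp: "f p = f m" using p(1) by (auto simp: Z_def)
  obtain r0 where r0: "r0 > 0" "cball p r0 \<subseteq> S" using S(1) pS open_contains_cball by blast
  \<comment> \<open>One third leaves room: y lies within r of p and the touching radius is below r,
    so the touching ball stays in the ball of radius 3 r.\<close>
  define r where "r = r0 / 3"
  have r: "r > 0" "cball p (3 * r) \<subseteq> S" using r0 by (auto simp: r_def)
  obtain y where y: "y \<in> ball p r" "y \<notin> Z" using p(2)[OF r(1)] by blast
  define Y where "Y = {z \<in> cball p (3 * r). f z = f m}"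
  have "closed Y"
    unfolding Y_def
    by (intro continuous_closed_preimage_constant continuous_on_subset[OF cf r(2)] closed_cball)
  moreover have "p \<in> Y" using r(1) fp by (simp add: Y_def)
  ultimately obtain x0 where x0: "x0 \<in> Y" "\<And>z. z \<in> Y \<Longrightarrow> dist y x0 \<le> dist y z"
    using distance_attains_inf[of Y y] by blast
  define R where "R = dist y x0"
  have yS: "y \<in> S" using y(1) r by auto
  have Rr: "R < r" unfolding R_def using x0(2)[OF \<open>p \<in> Y\<close>] y(1) by (simp add: dist_commute)
  have "y \<noteq> x0" using y(2) yS x0(1) by (auto simp: Y_def Z_def)
  then have R0: "R > 0" by (simp add: R_def)
  have near: "z \<in> cball p (3 * r)" if "dist y z \<le> R" for z
    using dist_triangle[of p z y] y(1) that Rr r(1) by (simp add: dist_commute)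
  have lt: "f z < f m" if "dist y z < R" for z
  proof -
    have "z \<in> cball p (3 * r)" using near that by simp
    moreover have "z \<notin> Y" using x0(2) that by (force simp: R_def)
    ultimately show ?thesis using m(2)[of z] r(2) by (force simp: Y_def)
  qed
  \<comment> \<open>The ball about y may meet the maximum set at several boundary points. The ball
    over the segment from y to x0 as diameter meets the larger sphere only at x0.\<close>
  define y' where "y' = (1/2) *\<^sub>R (y + x0)"
  have inner_ball: "dist y z < R" if z: "z \<in> cball y' (R/2)" "z \<noteq> x0" for z
  proof -
    define w where "w = z - y"
    define q where "q = x0 - y"
    have nq: "norm q = R" by (simp add: q_def R_def dist_norm norm_minus_commute)
    have "z - y' = w - (1/2) *\<^sub>R q"
      unfolding w_def q_def y'_def by (simp add: vec_eq_iff field_simps)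
    then have "norm (w - (1/2) *\<^sub>R q) \<le> R / 2"
      using z(1) by (metis dist_commute dist_norm mem_cball)
    then have "(norm (w - (1/2) *\<^sub>R q))\<^sup>2 \<le> (R / 2)\<^sup>2"
      by (intro power_mono) auto
    then have 1: "w \<bullet> w \<le> w \<bullet> q"
      unfolding power2_norm_eq_inner nq[symmetric] power_divide
      by (simp add: inner_diff_left inner_diff_right inner_commute)
    have "w - q \<noteq> 0" using z(2) by (simp add: w_def q_def)
    then have "(w - q) \<bullet> (w - q) > 0" by simp
    then have "w \<bullet> w < q \<bullet> q"
      using 1 by (simp add: inner_diff_left inner_diff_right inner_commute)
    then have "norm w < norm q" by (simp add: norm_eq_sqrt_inner)
    then show ?thesis using nq by (simp add: w_def dist_norm norm_minus_commute)
  qed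
  have d': "dist y' x0 = R / 2"
  proof -
    have "y' - x0 = (1/2) *\<^sub>R (y - x0)"
      by (simp add: y'_def vec_eq_iff field_simps)
    then show ?thesis by (simp add: R_def dist_norm)
  qed
  have sub: "cball y' (R/2) \<subseteq> S"
  proof
    fix z assume "z \<in> cball y' (R/2)"
    then have "dist y z \<le> R" using inner_ball by (cases "z = x0") (auto simp: R_def less_imp_le)
    then show "z \<in> S" using near r(2) by blast
  qed
  show False
    by (rule hopf_touching_ball[OF S(1) f b L _ sub d', of "f m"])
       (use R0 x0(1) inner_ball lt m(2) in \<open>auto simp: Y_def\<close>)
qed

lemma homogeneous_strong_maximum:
  fixes f :: "real^'n \<Rightarrow> real"
  assumes n: "CARD('n) \<ge> 2" and f: "smooth_on f punctured"
    and hom: "\<And>x l. x \<noteq> 0 \<Longrightarrow> l > 0 \<Longrightarrow> f (l *\<^sub>R x) = f x"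
    and b: "\<And>i. continuous_on punctured (b i)"
    and L: "\<And>x. x \<noteq> 0 \<Longrightarrow> (\<Sum>i\<in>UNIV. partial i (partial i f) x) + (\<Sum>i\<in>UNIV. b i x * partial i f x) \<ge> 0"
  shows "\<exists>c. \<forall>x. x \<noteq> 0 \<longrightarrow> f x = c"
proof -
  have con: "connected (punctured :: (real^'n) set)"
    using connected_punctured_universe[of "0 :: real^'n"] n
    by (simp add: Compl_eq_Diff_UNIV)
  have op: "open (punctured :: (real^'n) set)" by (simp add: open_delete)
  have sub: "sphere (0 :: real^'n) 1 \<subseteq> punctured" by auto
  obtain m where m: "m \<in> sphere 0 1" "\<And>z. z \<in> sphere 0 1 \<Longrightarrow> f z \<le> f m"
    using continuous_attains_sup[of "sphere (0 :: real^'n) 1" f]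
      continuous_on_subset[OF smooth_on_continuous_on[OF f] sub] by auto
  have max: "f z \<le> f m" if "z \<in> punctured" for z
    using hom[of z "inverse (norm z)"] m(2)[of "inverse (norm z) *\<^sub>R z"] that by simp
  have "f x = f m" if "x \<in> punctured" for x
    by (rule strong_maximum_principle[OF op con f b _ _ max that]) (use L m sub in auto)
  then show ?thesis by auto
qed

section \<open>The Poincare lemma on the punctured space\<close>

text \<open>The potential is the line integral along the segment from e to x, differentiated under
  the integral sign. Closedness turns the derivative of the integrand in direction k into the
  t-derivative of t W_k(e + t (x - e)), whose integral over the unit interval is W_k(x).\<close>

lemma poincare_lemma_star:
  fixes W :: "'n \<Rightarrow> real^'n \<Rightarrow> real"
  assumes S: "open S" and star: "\<And>x. x \<in> S \<Longrightarrow> closed_segment e x \<subseteq> S"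
    and W: "\<And>i. smooth_on (W i) S"
    and closed: "\<And>i j x. x \<in> S \<Longrightarrow> partial i (W j) x = partial j (W i) x"
  shows "\<exists>\<phi>. \<forall>x\<in>S. (\<phi> has_derivative (\<lambda>h. \<Sum>i\<in>UNIV. h $ i * W i x)) (at x)"
proof -
  define F where "F x t = (\<Sum>i\<in>UNIV. W i (e + t *\<^sub>R (x - e)) * (x $ i - e $ i))" for x t
  define \<phi> where "\<phi> x = integral (cbox 0 1) (F x)" for x
  \<comment> \<open>The k-th partial derivative of the integrand, with closedness already used to
    exchange the indices of the derivative of W.\<close>
  define c where "c x t k = W k (e + t *\<^sub>R (x - e))
      + t * (\<Sum>i\<in>UNIV. (x $ i - e $ i) * partial i (W k) (e + t *\<^sub>R (x - e)))" for x t k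
  define B where "B k = blinfun_inner_right (axis k (1::real) :: real^'n)" for k :: 'n
  define F' where "F' x t = (\<Sum>k\<in>UNIV. c x t k *\<^sub>R B k)" for x t
  have B: "blinfun_apply (B k) h = h $ k" for k h
    by (simp add: B_def inner_axis')
  have inS: "e + t *\<^sub>R (x - e) \<in> S" if "x \<in> S" "t \<in> cbox 0 1" for x t
  proof -
    have "e + t *\<^sub>R (x - e) = (1 - t) *\<^sub>R e + t *\<^sub>R x" by (simp add: algebra_simps)
    then show ?thesis using star[OF that(1)] that(2) by (auto simp: closed_segment_def subset_iff)
  qed
  have "(\<phi> has_derivative (\<lambda>h. \<Sum>i\<in>UNIV. h $ i * W i x0)) (at x0)" if x0: "x0 \<in> S" for x0
  proof -
    obtain r where r: "r > 0" "ball x0 r \<subseteq> S" using S x0 openE by blast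
    define U where "U = ball x0 r"
    have U: "U \<subseteq> S" "x0 \<in> U" "convex U" "open U" using r by (auto simp: U_def)
    have cont: "continuous_on (U \<times> cbox 0 1) (\<lambda>z. g (e + snd z *\<^sub>R (fst z - e)))"
      if "smooth_on g S" for g :: "real^'n \<Rightarrow> real"
      by (rule continuous_on_compose2[OF smooth_on_continuous_on[OF that]])
         (use U inS in \<open>auto intro!: continuous_intros\<close>)
    have d: "((\<lambda>x. F x t) has_derivative blinfun_apply (F' x t)) (at x within U)"
      if x: "x \<in> U" and t: "t \<in> cbox 0 1" for x t
    proof -
      have inn: "e + t *\<^sub>R (x - e) \<in> S" using inS x t U(1) by blast
      have l: "((\<lambda>x. e + t *\<^sub>R (x - e)) has_derivative (\<lambda>h. t *\<^sub>R h)) (at x within U)"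
        by (auto intro!: derivative_eq_intros)
      have Wd: "((\<lambda>x. W i (e + t *\<^sub>R (x - e))) has_derivative
          (\<lambda>h. \<Sum>k\<in>UNIV. (t *\<^sub>R h) $ k *\<^sub>R partial k (W i) (e + t *\<^sub>R (x - e)))) (at x within U)" for i
        by (rule has_derivative_compose[OF l has_derivative_partial[OF smooth_on_differentiable[OF W inn]]])
      have xd: "((\<lambda>x. x $ i - e $ i) has_derivative (\<lambda>h. h $ i)) (at x within U)" for i
      proof -
        have "((\<lambda>x. x $ i) has_derivative (\<lambda>h. h $ i)) (at x within U)"
          by (rule bounded_linear_imp_has_derivative[OF bounded_linear_vec_nth])
        from has_derivative_diff[OF this has_derivative_const[of "e $ i"]] show ?thesis by simp
      qed
      have "((\<lambda>x. F x t) has_derivative (\<lambda>h. \<Sum>i\<in>UNIV. W i (e + t *\<^sub>R (x - e)) * h $ i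
        + (\<Sum>k\<in>UNIV. (t *\<^sub>R h) $ k *\<^sub>R partial k (W i) (e + t *\<^sub>R (x - e))) * (x $ i - e $ i))) (at x within U)"
        unfolding F_def by (intro has_derivative_sum has_derivative_mult Wd xd)
      then show ?thesis
      proof (rule has_derivative_eq_rhs, intro ext)
        fix h :: "real^'n"
        have F'h: "F' x t h = (\<Sum>k\<in>UNIV. c x t k * h $ k)"
          by (simp add: F'_def blinfun.sum_left blinfun.scaleR_left B)
        define P where "P k i = partial k (W i) (e + t *\<^sub>R (x - e))" for k i
        have "(\<Sum>i\<in>UNIV. (\<Sum>k\<in>UNIV. (t *\<^sub>R h) $ k *\<^sub>R P k i) * (x $ i - e $ i))
          = (\<Sum>i\<in>UNIV. \<Sum>k\<in>UNIV. h $ k * (t * ((x $ i - e $ i) * P k i)))"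
          by (intro sum.cong refl) (simp add: sum_distrib_right sum_distrib_left mult_ac)
        also have "\<dots> = (\<Sum>k\<in>UNIV. \<Sum>i\<in>UNIV. h $ k * (t * ((x $ i - e $ i) * P k i)))"
          by (rule sum.swap)
        also have "\<dots> = (\<Sum>k\<in>UNIV. \<Sum>i\<in>UNIV. h $ k * (t * ((x $ i - e $ i) * P i k)))"
          using closed[OF inn] by (simp add: P_def)
        finally have "(\<Sum>i\<in>UNIV. (\<Sum>k\<in>UNIV. (t *\<^sub>R h) $ k *\<^sub>R partial k (W i) (e + t *\<^sub>R (x - e))) * (x $ i - e $ i))
          = (\<Sum>k\<in>UNIV. \<Sum>i\<in>UNIV. h $ k * (t * ((x $ i - e $ i) * partial i (W k) (e + t *\<^sub>R (x - e)))))"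
          unfolding P_def .
        then show "(\<Sum>i\<in>UNIV. W i (e + t *\<^sub>R (x - e)) * h $ i
          + (\<Sum>k\<in>UNIV. (t *\<^sub>R h) $ k *\<^sub>R partial k (W i) (e + t *\<^sub>R (x - e))) * (x $ i - e $ i)) = F' x t h"
          unfolding F'h c_def
          by (simp only: sum.distrib distrib_right sum_distrib_left sum_distrib_right)
            (simp only: mult_ac)
      qed
    qed
    have int: "F x integrable_on cbox 0 1" if "x \<in> U" for x
    proof (rule integrable_continuous)
      have "continuous_on (cbox 0 1) (\<lambda>t. W i (e + t *\<^sub>R (x - e)))" for i
        by (rule continuous_on_compose2[OF smooth_on_continuous_on[OF W]])
           (use U inS that in \<open>auto intro!: continuous_intros\<close>)
      then show "continuous_on (cbox 0 1) (F x)"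
        unfolding F_def by (intro continuous_intros)
    qed
    have cF': "continuous_on (U \<times> cbox 0 1) (\<lambda>(x, t). F' x t)"
      unfolding F'_def c_def case_prod_beta
      by (intro continuous_intros cont W smooth_on_partial)
    have lr: "(\<phi> has_derivative blinfun_apply (integral (cbox 0 1) (F' x0))) (at x0 within U)"
      unfolding \<phi>_def by (rule leibniz_rule[OF d int cF' U(2,3)])
    have vd: "((\<lambda>t. \<Sum>k\<in>UNIV. (t * W k (e + t *\<^sub>R (x0 - e))) *\<^sub>R B k) has_vector_derivative F' x0 t) (at t within {0..1})"
      if t: "t \<in> {0..1}" for t
    proof -
      have "((\<lambda>t. W k (e + t *\<^sub>R (x0 - e))) has_real_derivative
          (\<Sum>i\<in>UNIV. (x0 - e) $ i * partial i (W k) (e + t *\<^sub>R (x0 - e)))) (at t within {0..1})" for k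
        by (rule has_field_derivative_at_within[OF has_real_derivative_along_line[OF smooth_on_differentiable[OF W]]])
           (use inS[OF x0] t in auto)
      note D = DERIV_mult[OF DERIV_ident this]
      have "((\<lambda>t. t * W k (e + t *\<^sub>R (x0 - e))) has_vector_derivative c x0 t k) (at t within {0..1})" for k
        unfolding has_real_derivative_iff_has_vector_derivative[symmetric]
        by (rule DERIV_cong[OF D]) (simp add: c_def algebra_simps)
      then show ?thesis unfolding F'_def
        by (intro has_vector_derivative_sum bounded_linear.has_vector_derivative[OF bounded_linear_scaleR_left])
    qed
    have "(F' x0 has_integral (\<Sum>k\<in>UNIV. W k x0 *\<^sub>R B k)) {0..1}"
      using fundamental_theorem_of_calculus[OF _ vd] by simp
    then have "integral (cbox 0 1) (F' x0) = (\<Sum>k\<in>UNIV. W k x0 *\<^sub>R B k)"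
      by (simp add: integral_unique)
    then have "blinfun_apply (integral (cbox 0 1) (F' x0)) = (\<lambda>h. \<Sum>i\<in>UNIV. h $ i * W i x0)"
      by (auto simp: fun_eq_iff blinfun.sum_left blinfun.scaleR_left B mult.commute)
    then show ?thesis using lr at_within_open[OF U(2,4)] by simp
  qed
  then show ?thesis by blast
qed

text \<open>
  The complement of a closed ray. Two opposite ones cover the punctured space, and for \<open>n \<ge> 3\<close> their
  intersection is connected, so that potentials on the two can be glued.
\<close>

definition slit :: "real^'n \<Rightarrow> (real^'n) set"
  where "slit e = {x. norm x + x \<bullet> e > 0}"

lemma open_slit: "open (slit e)"
  unfolding slit_def by (intro open_Collect_less continuous_intros)

text \<open>A point y outside the slit domain satisfies y = -|y| e. The component of y orthogonal to
  e is s times that of x, so s = 0 and y = e, or x is a positive multiple of e and y . e > 0; both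
  are impossible.\<close>

lemma slit_star:
  assumes e: "norm e = 1" and x: "x \<in> slit e"
  shows "closed_segment e x \<subseteq> slit e"
proof
  fix y assume "y \<in> closed_segment e x"
  then obtain s where s: "0 \<le> s" "s \<le> 1" and y: "y = (1 - s) *\<^sub>R e + s *\<^sub>R x"
    by (auto simp: closed_segment_def)
  have ee: "e \<bullet> e = 1" using e by (simp add: dot_square_norm)
  have ye: "y \<bullet> e = (1 - s) + s * (x \<bullet> e)"
    by (simp add: y inner_add_left ee)
  have orth: "y \<bullet> y - (y \<bullet> e)\<^sup>2 = s\<^sup>2 * (x \<bullet> x - (x \<bullet> e)\<^sup>2)"
    unfolding ye by (simp add: y inner_add_left inner_add_right ee inner_commute power2_eq_square algebra_simps)
  have cs: "\<bar>z \<bullet> e\<bar> \<le> norm z" for z using Cauchy_Schwarz_ineq2[of z e] e by simp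
  have xp: "norm x + x \<bullet> e > 0" using x by (simp add: slit_def)
  show "y \<in> slit e"
  proof (rule ccontr)
    assume "y \<notin> slit e"
    then have eq: "y \<bullet> e = - norm y" using cs[of y] by (simp add: slit_def)
    then have "y \<bullet> y - (y \<bullet> e)\<^sup>2 = 0" by (simp add: dot_square_norm)
    with orth have "s = 0 \<or> x \<bullet> x = (x \<bullet> e)\<^sup>2" by auto
    then show False
    proof
      assume "s = 0"
      then show False using ye eq norm_ge_zero[of y] by simp
    next
      assume "x \<bullet> x = (x \<bullet> e)\<^sup>2"
      then have "norm x = \<bar>x \<bullet> e\<bar>" by (simp add: norm_eq_sqrt_inner)
      then have p: "x \<bullet> e > 0" using xp by linarith
      then have "y \<bullet> e > 0"
        using ye s by (smt (verit) mult_nonneg_nonneg mult_pos_pos)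
      then show False using eq norm_ge_zero[of y] by linarith
    qed
  qed
qed

lemma slit_Un: "norm e = 1 \<Longrightarrow> slit e \<union> slit (- e) = punctured"
  by (auto simp: slit_def) (smt (verit) zero_less_norm_iff)

text \<open>The intersection is the complement of the line spanned by e, that is, the punctured
  hyperplane orthogonal to e times that line. The hyperplane has dimension n - 1 \<ge> 2, so it
  stays connected without its origin.\<close>

lemma connected_slit_Int:
  fixes e :: "real^'n"
  assumes n: "CARD('n) \<ge> 3" and e: "norm e = 1"
  shows "connected (slit e \<inter> slit (- e))"
proof -
  define H where "H = {y. e \<bullet> y = 0}"
  have ee: "e \<bullet> e = 1" using e by (simp add: dot_square_norm)
  have "e \<noteq> 0" using ee by auto
  then have "aff_dim H = int CARD('n) - 1"
    unfolding H_def using aff_dim_hyperplane[of e 0] by (simp add: of_nat_diff)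
  then have "connected (H - {0})"
    using n by (intro connected_punctured_convex) (auto simp: H_def convex_hyperplane)
  then have "connected ((\<lambda>(y, t). y + t *\<^sub>R e) ` ((H - {0}) \<times> (UNIV :: real set)))"
    by (intro connected_continuous_image connected_Times)
       (auto simp: case_prod_beta intro!: continuous_intros)
  also have "(\<lambda>(y, t). y + t *\<^sub>R e) ` ((H - {0}) \<times> (UNIV :: real set)) = slit e \<inter> slit (- e)"
  proof (intro equalityI subsetI)
    fix x assume "x \<in> (\<lambda>(y, t). y + t *\<^sub>R e) ` ((H - {0}) \<times> (UNIV :: real set))"
    then obtain y t where x: "x = y + t *\<^sub>R e" and y: "y \<in> H" "y \<noteq> 0" by auto
    have xe: "x \<bullet> e = t" using y(1) by (simp add: x H_def inner_add_left inner_add_right ee inner_commute)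
    have "x \<bullet> x = y \<bullet> y + t\<^sup>2"
      using y(1) by (simp add: x H_def inner_add_left inner_add_right ee inner_commute power2_eq_square)
    then have "(norm x)\<^sup>2 > t\<^sup>2" using y(2) by (simp add: dot_square_norm)
    then have "norm x > \<bar>t\<bar>" using power2_less_imp_less[of "\<bar>t\<bar>" "norm x"] by simp
    then show "x \<in> slit e \<inter> slit (- e)" by (auto simp: slit_def xe abs_less_iff)
  next
    fix x assume x: "x \<in> slit e \<inter> slit (- e)"
    define y where "y = x - (x \<bullet> e) *\<^sub>R e"
    have "y \<in> H" by (simp add: y_def H_def inner_diff_right ee inner_commute)
    moreover have "y \<noteq> 0"
    proof
      assume "y = 0"
      then have "norm x = norm ((x \<bullet> e) *\<^sub>R e)" by (simp add: y_def)
      then have "norm x = \<bar>x \<bullet> e\<bar>" using e by simp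
      then show False using x by (auto simp: slit_def)
    qed
    moreover have "x = y + (x \<bullet> e) *\<^sub>R e" by (simp add: y_def)
    ultimately show "x \<in> (\<lambda>(y, t). y + t *\<^sub>R e) ` ((H - {0}) \<times> (UNIV :: real set))"
      by (auto intro!: image_eqI[of _ _ "(y, x \<bullet> e)"])
  qed
  finally show ?thesis .
qed

lemma poincare_lemma_punctured:
  fixes W :: "'n \<Rightarrow> real^'n \<Rightarrow> real"
  assumes n: "CARD('n) \<ge> 3" and W: "\<And>i. smooth_on (W i) punctured"
    and closed: "\<And>i j x. x \<noteq> 0 \<Longrightarrow> partial i (W j) x = partial j (W i) x"
  shows "\<exists>\<phi>. smooth_on \<phi> punctured \<and> (\<forall>x i. x \<noteq> 0 \<longrightarrow> partial i \<phi> x = W i x)"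
proof -
  obtain i0 :: 'n where True by blast
  define e :: "real^'n" where "e = axis i0 1"
  have e: "norm e = 1" "norm (- e) = 1" by (auto simp: e_def)
  have sub: "slit e \<subseteq> punctured" "slit (- e) \<subseteq> punctured" using slit_Un[OF e(1)] by auto
  have ex: "\<exists>\<phi>. \<forall>x\<in>slit v. (\<phi> has_derivative (\<lambda>h. \<Sum>i\<in>UNIV. h $ i * W i x)) (at x)"
    if "norm v = 1" for v
    by (rule poincare_lemma_star[OF open_slit slit_star[OF that] smooth_on_subset[OF W]])
       (auto intro!: closed simp: slit_def)
  obtain \<phi>1 where \<phi>1: "\<And>x. x \<in> slit e \<Longrightarrow> (\<phi>1 has_derivative (\<lambda>h. \<Sum>i\<in>UNIV. h $ i * W i x)) (at x)"
    using ex[OF e(1)] by blast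
  obtain \<phi>2 where \<phi>2: "\<And>x. x \<in> slit (- e) \<Longrightarrow> (\<phi>2 has_derivative (\<lambda>h. \<Sum>i\<in>UNIV. h $ i * W i x)) (at x)"
    using ex[OF e(2)] by blast
  have "(\<lambda>x. \<phi>1 x - \<phi>2 x) constant_on (slit e \<inter> slit (- e))"
  proof (rule has_derivative_zero_connected_constant_on)
    show "continuous_on (slit e \<inter> slit (- e)) (\<lambda>x. \<phi>1 x - \<phi>2 x)"
      using \<phi>1 \<phi>2
      by (intro continuous_at_imp_continuous_on ballI continuous_diff) (auto dest!: has_derivative_continuous)
    show "\<forall>x\<in>slit e \<inter> slit (- e) - {}. ((\<lambda>x. \<phi>1 x - \<phi>2 x) has_derivative (\<lambda>h. 0)) (at x within (slit e \<inter> slit (- e)))"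
    proof
      fix x assume "x \<in> slit e \<inter> slit (- e) - {}"
      then show "((\<lambda>x. \<phi>1 x - \<phi>2 x) has_derivative (\<lambda>h. 0)) (at x within (slit e \<inter> slit (- e)))"
        using has_derivative_diff[OF \<phi>1[of x] \<phi>2[of x]] by (auto intro: has_derivative_at_withinI)
    qed
  qed (auto intro: connected_slit_Int[OF n e(1)] open_Int open_slit)
  then obtain k where k: "\<And>x. x \<in> slit e \<inter> slit (- e) \<Longrightarrow> \<phi>1 x - \<phi>2 x = k"
    unfolding constant_on_def by blast
  define \<phi> where "\<phi> x = (if x \<in> slit e then \<phi>1 x else \<phi>2 x + k)" for x
  have D: "(\<phi> has_derivative (\<lambda>h. \<Sum>i\<in>UNIV. h $ i * W i x)) (at x)" if "x \<noteq> 0" for x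
  proof (cases "x \<in> slit e")
    case True
    show ?thesis
      by (rule has_derivative_transform_within_open[OF \<phi>1[OF True] open_slit True]) (simp add: \<phi>_def)
  next
    case False
    then have x: "x \<in> slit (- e)" using slit_Un[OF e(1)] that by auto
    have "((\<lambda>x. \<phi>2 x + k) has_derivative (\<lambda>h. \<Sum>i\<in>UNIV. h $ i * W i x)) (at x)"
      using has_derivative_add[OF \<phi>2[OF x] has_derivative_const[of k]] by simp
    then show ?thesis
      by (rule has_derivative_transform_within_open[OF _ open_slit x]) (use k in \<open>force simp: \<phi>_def\<close>)
  qed
  have p: "partial i \<phi> x = W i x" if "x \<noteq> 0" for i x
    using partial_eq_has_derivative[OF D[OF that], of i]
    by (simp add: axis_def if_distrib[of "\<lambda>c. c * _"] cong: if_cong)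
  have "smooth_on (partial i \<phi>) punctured" for i
    by (rule smooth_on_cong[OF _ _ W[of i]]) (auto simp: p open_delete)
  then have "smooth_on \<phi> punctured"
    using D unfolding smooth_on_rec[of \<phi>] differentiable_def by auto
  then show ?thesis using p by blast
qed

text \<open>Converse of Euler's relation in degree 0: along a ray the derivative is the radial
  derivative divided by s. It gives homogeneity to functions known through differential relations
  only, such as a potential of a tangential field.\<close>

lemma radial_constant:
  fixes \<phi> :: "real^'n \<Rightarrow> real"
  assumes \<phi>: "smooth_on \<phi> punctured"
    and rad: "\<And>x. x \<noteq> 0 \<Longrightarrow> (\<Sum>i\<in>UNIV. x $ i * partial i \<phi> x) = 0"
    and x: "x \<noteq> 0" and l: "l > 0"
  shows "\<phi> (l *\<^sub>R x) = \<phi> x"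
proof -
  have "((\<lambda>s. \<phi> (s *\<^sub>R x)) has_real_derivative 0) (at s within {0<..})" if s: "s \<in> {0<..}" for s
  proof -
    have sx: "s *\<^sub>R x \<noteq> 0" using s x by simp
    have "s * (\<Sum>i\<in>UNIV. x $ i * partial i \<phi> (s *\<^sub>R x)) = 0"
      using rad[OF sx] by (simp add: sum_distrib_left mult.assoc)
    then have "(\<Sum>i\<in>UNIV. x $ i * partial i \<phi> (s *\<^sub>R x)) = 0" using s by simp
    moreover have "\<phi> differentiable (at (0 + s *\<^sub>R x))"
      using smooth_on_differentiable[OF \<phi>] sx by simp
    from has_real_derivative_along_line[OF this]
    have "((\<lambda>s. \<phi> (s *\<^sub>R x)) has_real_derivative (\<Sum>i\<in>UNIV. x $ i * partial i \<phi> (s *\<^sub>R x))) (at s)"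
      by simp
    ultimately show ?thesis using has_field_derivative_at_within by metis
  qed
  then obtain c where "\<And>s. s \<in> {0<..} \<Longrightarrow> \<phi> (s *\<^sub>R x) = c"
    using has_field_derivative_zero_constant[of "{0<..}" "\<lambda>s. \<phi> (s *\<^sub>R x)"] by auto
  from this[of l] this[of 1] l show ?thesis by simp
qed

text \<open>Both sides are the derivative of f (s x) at s = 1. The real exponent admits the degrees
  -1 of the velocity and -2 of the pressure.\<close>

lemma euler_homogeneous:
  fixes f :: "real^'n \<Rightarrow> real"
  assumes "f differentiable (at x)" and hom: "\<And>l. l > 0 \<Longrightarrow> f (l *\<^sub>R x) = l powr k * f x"
  shows "(\<Sum>i\<in>UNIV. x $ i * partial i f x) = k * f x"
proof -
  have D1: "((\<lambda>s. f (s *\<^sub>R x)) has_real_derivative (\<Sum>i\<in>UNIV. x $ i * partial i f x)) (at 1)"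
    using has_real_derivative_along_line[of f 0 1 x] assms(1) by simp
  have "((\<lambda>s. s powr k * f x) has_real_derivative (k * 1 powr (k - 1)) * f x) (at 1)"
    by (auto intro!: derivative_eq_intros)
  then have "((\<lambda>s. s powr k * f x) has_real_derivative k * f x) (at 1)" by simp
  then have "((\<lambda>s. f (s *\<^sub>R x)) has_real_derivative k * f x) (at 1)"
    by (rule has_field_derivative_transform_within_open[where S = "{0<..}"]) (auto simp: hom)
  with D1 show ?thesis by (rule DERIV_unique)
qed

section \<open>Self-similar Navier-Stokes flows\<close>

lemma partial_cong_punctured:
  "x \<noteq> 0 \<Longrightarrow> (\<And>y. y \<noteq> 0 \<Longrightarrow> f y = g y) \<Longrightarrow> partial i f x = partial i g x"
  by (rule partial_cong[of punctured]) (auto simp: open_delete)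

lemma open_punctured: "open (punctured :: (real^'n) set)"
  by (simp add: open_delete)

section \<open>The Laplacian of sums, products and exponentials, and the squared norm\<close>

lemma laplacian_cong:
  assumes "open S" "x \<in> S" "\<And>y. y \<in> S \<Longrightarrow> f y = g y"
  shows "laplacian f x = laplacian g x"
  unfolding laplacian_def using assms
  by (intro sum.cong refl partial_cong[OF assms(1,2)]) (blast intro: partial_cong)

lemma laplacian_const: "laplacian (\<lambda>y. c) (x :: real^'n) = 0"
proof -
  have "partial i (\<lambda>y. c) = (\<lambda>x. 0)" for i :: 'n by (simp add: fun_eq_iff)
  then show ?thesis by (simp add: laplacian_def)
qed

definition grad_inner :: "(real^'n \<Rightarrow> real) \<Rightarrow> (real^'n \<Rightarrow> real) \<Rightarrow> real^'n \<Rightarrow> real"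
  where "grad_inner f g x = (\<Sum>i\<in>UNIV. partial i f x * partial i g x)"

context
  fixes S :: "(real^'n) set"
  assumes S: "open S"
begin

lemma laplacian_add:
  assumes "smooth_on f S" "smooth_on g S" "x \<in> S"
  shows "laplacian (\<lambda>y. f y + g y) x = laplacian f x + laplacian g x"
proof -
  note d = smooth_on_differentiable smooth_on_differentiable[OF smooth_on_partial]
  have "partial i (partial i (\<lambda>y. f y + g y)) x = partial i (\<lambda>y. partial i f y + partial i g y) x" for i
    by (rule partial_cong[OF S assms(3)]) (simp add: partial_add d[OF assms(1)] d[OF assms(2)])
  then show ?thesis
    by (simp add: laplacian_def partial_add d[OF assms(1,3)] d[OF assms(2,3)] sum.distrib)
qed

lemma laplacian_mult:
  fixes f g :: "real^'n \<Rightarrow> real"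
  assumes "smooth_on f S" "smooth_on g S" "x \<in> S"
  shows "laplacian (\<lambda>y. f y * g y) x = f x * laplacian g x + g x * laplacian f x + 2 * grad_inner f g x"
proof -
  note d = smooth_on_differentiable smooth_on_differentiable[OF smooth_on_partial]
  have "partial i (partial i (\<lambda>y. f y * g y)) x = partial i (\<lambda>y. f y * partial i g y + partial i f y * g y) x" for i
    by (rule partial_cong[OF S assms(3)]) (simp add: partial_mult d[OF assms(1)] d[OF assms(2)])
  moreover have "partial i (\<lambda>y. f y * partial i g y + partial i f y * g y) x
    = f x * partial i (partial i g) x + g x * partial i (partial i f) x + 2 * (partial i f x * partial i g x)" for i
    by (simp add: partial_add partial_mult d[OF assms(1,3)] d[OF assms(2,3)])
  ultimately show ?thesis
    by (simp add: laplacian_def grad_inner_def sum.distrib sum_distrib_left)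
qed

lemma laplacian_cmult:
  fixes f :: "real^'n \<Rightarrow> real"
  assumes "smooth_on f S" "x \<in> S"
  shows "laplacian (\<lambda>y. c * f y) x = c * laplacian f x"
  using laplacian_mult[OF smooth_on_const assms, of c] by (simp add: laplacian_const grad_inner_def)

lemma laplacian_sum:
  assumes "finite J" "\<And>j. j \<in> J \<Longrightarrow> smooth_on (f j) S" "x \<in> S"
  shows "laplacian (\<lambda>y. \<Sum>j\<in>J. f j y) x = (\<Sum>j\<in>J. laplacian (f j) x)"
  using assms(1,2)
proof (induction rule: finite_induct)
  case empty
  then show ?case by (simp add: laplacian_const)
next
  case (insert a J)
  then show ?case
    by (simp add: laplacian_add smooth_on_sum[OF S] assms(3))
qed

lemma laplacian_exp:
  fixes f :: "real^'n \<Rightarrow> real"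
  assumes "smooth_on f S" "x \<in> S"
  shows "laplacian (\<lambda>y. exp (f y)) x = exp (f x) * (laplacian f x + grad_inner f f x)"
proof -
  note d = smooth_on_differentiable[OF assms(1)] smooth_on_differentiable[OF smooth_on_partial[OF assms(1)]]
  note e = smooth_on_differentiable[OF smooth_on_exp[OF S assms(1)]]
  have p: "partial i (\<lambda>y. exp (f y)) y = exp (f y) * partial i f y" if "y \<in> S" for i y
    by (rule partial_compose_real[OF d(1)[OF that] DERIV_exp])
  have "partial i (partial i (\<lambda>y. exp (f y))) x = partial i (\<lambda>y. exp (f y) * partial i f y) x" for i
    by (rule partial_cong[OF S assms(2)]) (simp add: p)
  then show ?thesis
    by (simp add: laplacian_def grad_inner_def partial_mult d[OF assms(2)] e[OF assms(2)] p[OF assms(2)]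
        sum.distrib sum_distrib_left algebra_simps)
qed

lemma smooth_on_laplacian: "smooth_on f S \<Longrightarrow> smooth_on (laplacian f) S"
  unfolding laplacian_def[abs_def] by (intro smooth_on_sum S smooth_on_partial) auto

end

lemma laplacian_coord: "laplacian (\<lambda>y. y $ j) x = 0"
proof -
  have "partial i (\<lambda>y. y $ j) = (\<lambda>x. if i = j then 1 else 0)" for i
    by (simp add: fun_eq_iff partial_coord)
  then show ?thesis by (simp add: laplacian_def)
qed

definition sqnorm :: "real^'n \<Rightarrow> real" where "sqnorm x = (\<Sum>i\<in>UNIV. x $ i * x $ i)"

lemma sqnorm_norm: "sqnorm x = (norm x)\<^sup>2"
  by (simp add: sqnorm_def power2_norm_eq_inner inner_vec_def)

lemma sqnorm_pos: "x \<noteq> 0 \<Longrightarrow> sqnorm x > 0"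
  by (simp add: sqnorm_norm)

lemma smooth_on_sqnorm: "smooth_on sqnorm (punctured :: (real^'n) set)"
  unfolding sqnorm_def[abs_def]
  by (intro smooth_on_sum smooth_on_mult smooth_on_coord open_punctured) auto

lemma partial_sqnorm: "partial i sqnorm x = 2 * x $ i"
proof -
  have "partial i sqnorm x = (\<Sum>j\<in>UNIV. partial i (\<lambda>x. x $ j * x $ j) x)"
    unfolding sqnorm_def[abs_def] by (rule partial_sum) (simp add: differentiable_coord)
  also have "\<dots> = (\<Sum>j\<in>UNIV. if i = j then 2 * x $ j else 0)"
    by (intro sum.cong) (auto simp: partial_mult differentiable_coord partial_coord)
  finally show ?thesis by simp
qed

lemma laplacian_sqnorm: "laplacian sqnorm (x :: real^'n) = 2 * real CARD('n)"
proof -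
  have "partial i sqnorm = (\<lambda>x. 2 * x $ i)" for i :: 'n
    by (simp add: fun_eq_iff partial_sqnorm)
  then show ?thesis
    by (simp add: laplacian_def partial_cmult differentiable_coord partial_coord)
qed

text \<open>For s = |x|^2 the form (a_i x_j - a_j x_i)/s is the part of w containing the direction
  x, and the left-hand side measures the tangential rest. The expansion uses a . x = 0, which
  antisymmetry gives. For the vorticity, with a = \<nabla>f, the bracket on the right is the source
  term in the equation of \<open>G\<close>.\<close>

lemma antisymmetric_decomposition:
  fixes w :: "'n::finite \<Rightarrow> 'n \<Rightarrow> real" and x :: "'n \<Rightarrow> real"
  assumes anti: "\<And>i j. w i j = - w j i"
    and a: "\<And>i. a i = (\<Sum>j\<in>UNIV. w i j * x j)" and s: "s = (\<Sum>i\<in>UNIV. x i * x i)"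
  shows "(\<Sum>i\<in>UNIV. \<Sum>j\<in>UNIV. (s * w i j - (a i * x j - a j * x i))\<^sup>2)
    = 2 * s * (s / 2 * (\<Sum>i\<in>UNIV. \<Sum>j\<in>UNIV. (w i j)\<^sup>2) - (\<Sum>i\<in>UNIV. (a i)\<^sup>2))"
proof -
  let ?A = "\<Sum>i\<in>UNIV. (a i)\<^sup>2"
  have 1: "(\<Sum>i\<in>UNIV. \<Sum>j\<in>UNIV. w i j * (a i * x j)) = ?A"
  proof (intro sum.cong refl)
    fix i show "(\<Sum>j\<in>UNIV. w i j * (a i * x j)) = (a i)\<^sup>2"
      using arg_cong[OF a[of i], of "\<lambda>t. a i * t"]
      by (simp add: power2_eq_square sum_distrib_left mult_ac)
  qed
  have 2: "(\<Sum>i\<in>UNIV. \<Sum>j\<in>UNIV. w i j * (a j * x i)) = - ?A"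
  proof -
    have "(\<Sum>i\<in>UNIV. \<Sum>j\<in>UNIV. w i j * (a j * x i)) = (\<Sum>j\<in>UNIV. \<Sum>i\<in>UNIV. - (w j i * (a j * x i)))"
      by (subst sum.swap) (intro sum.cong refl, subst anti, simp)
    then show ?thesis using 1 by (simp add: sum_negf)
  qed
  have 3: "(\<Sum>i\<in>UNIV. \<Sum>j\<in>UNIV. (a i * x j)\<^sup>2) = s * ?A"
    "(\<Sum>i\<in>UNIV. \<Sum>j\<in>UNIV. (a j * x i)\<^sup>2) = s * ?A"
    unfolding s sum_product by (auto simp: power2_eq_square mult_ac intro: sum.swap)
  have ax: "(\<Sum>i\<in>UNIV. a i * x i) = 0"
  proof -
    have "(\<Sum>i\<in>UNIV. a i * x i) = (\<Sum>i\<in>UNIV. \<Sum>j\<in>UNIV. w i j * (x i * x j))"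
      by (simp add: a sum_distrib_right sum_distrib_left mult_ac)
    moreover have "(\<Sum>i\<in>UNIV. \<Sum>j\<in>UNIV. w i j * (x i * x j)) = - (\<Sum>j\<in>UNIV. \<Sum>i\<in>UNIV. w j i * (x j * x i))"
      unfolding sum_negf[symmetric]
      by (subst sum.swap) (intro sum.cong refl, subst anti, simp)
    ultimately show ?thesis by linarith
  qed
  have 4: "(\<Sum>i\<in>UNIV. \<Sum>j\<in>UNIV. (a i * x j) * (a j * x i)) = 0"
    using arg_cong2[OF ax ax, of "(*)"] unfolding sum_product by (simp add: mult_ac)
  have "(s * w i j - (a i * x j - a j * x i))\<^sup>2 = s\<^sup>2 * (w i j)\<^sup>2 - 2 * s * (w i j * (a i * x j))
    + 2 * s * (w i j * (a j * x i)) + (a i * x j)\<^sup>2 + (a j * x i)\<^sup>2 - 2 * ((a i * x j) * (a j * x i))" for i j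
    by (simp add: power2_eq_square algebra_simps)
  then have "(\<Sum>i\<in>UNIV. \<Sum>j\<in>UNIV. (s * w i j - (a i * x j - a j * x i))\<^sup>2)
    = s\<^sup>2 * (\<Sum>i\<in>UNIV. \<Sum>j\<in>UNIV. (w i j)\<^sup>2) - 2 * s * (\<Sum>i\<in>UNIV. \<Sum>j\<in>UNIV. w i j * (a i * x j))
    + 2 * s * (\<Sum>i\<in>UNIV. \<Sum>j\<in>UNIV. w i j * (a j * x i)) + (\<Sum>i\<in>UNIV. \<Sum>j\<in>UNIV. (a i * x j)\<^sup>2)
    + (\<Sum>i\<in>UNIV. \<Sum>j\<in>UNIV. (a j * x i)\<^sup>2) - 2 * (\<Sum>i\<in>UNIV. \<Sum>j\<in>UNIV. (a i * x j) * (a j * x i))"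
    by (simp only: sum.distrib sum_subtractf sum_distrib_left)
  then show ?thesis
    unfolding 1 2 3 4 by (simp add: power2_eq_square algebra_simps)
qed

text \<open>What a constant director leaves of the system. The velocity is a family of scalar
  components, so that the calculus of scalar functions applies to each of them.\<close>

locale homogeneous_navier_stokes =
  fixes U :: "'n \<Rightarrow> real^'n \<Rightarrow> real" and p :: "real^'n \<Rightarrow> real"
  assumes dim: "CARD('n) \<ge> 3"
    and smooth_U: "smooth_on (U i) punctured" and smooth_p: "smooth_on p punctured"
    and div_free: "x \<noteq> 0 \<Longrightarrow> (\<Sum>i\<in>UNIV. partial i (U i) x) = 0"
    and momentum: "x \<noteq> 0 \<Longrightarrow>
      - laplacian (U i) x + (\<Sum>j\<in>UNIV. U j x * partial j (U i) x) + partial i p x = 0"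
    and scaling_U: "x \<noteq> 0 \<Longrightarrow> l > 0 \<Longrightarrow> U i x = l * U i (l *\<^sub>R x)"
    and scaling_p: "x \<noteq> 0 \<Longrightarrow> l > 0 \<Longrightarrow> p x = l\<^sup>2 * p (l *\<^sub>R x)"
begin

lemma dU [simp]: "x \<noteq> 0 \<Longrightarrow> U i differentiable (at x)"
  using smooth_on_differentiable[OF smooth_U] by simp

lemma dpU [simp]: "x \<noteq> 0 \<Longrightarrow> partial j (U i) differentiable (at x)"
  using smooth_on_differentiable[OF smooth_on_partial[OF smooth_U]] by simp

lemma dp [simp]: "x \<noteq> 0 \<Longrightarrow> p differentiable (at x)"
  using smooth_on_differentiable[OF smooth_p] by simp

lemma euler_U: "x \<noteq> 0 \<Longrightarrow> (\<Sum>j\<in>UNIV. x $ j * partial j (U i) x) = - U i x"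
  using euler_homogeneous[of "U i" x "-1"] scaling_U[of x _ i]
  by (simp add: powr_minus field_simps)

lemma euler_p: "x \<noteq> 0 \<Longrightarrow> (\<Sum>j\<in>UNIV. x $ j * partial j p x) = - 2 * p x"
proof -
  assume x: "x \<noteq> 0"
  have "p (l *\<^sub>R x) = l powr (-2) * p x" if "l > 0" for l
    using scaling_p[OF x that] that by (simp add: powr_minus powr_numeral field_simps)
  from euler_homogeneous[OF dp[OF x] this] show ?thesis by simp
qed

definition f :: "real^'n \<Rightarrow> real" where "f x = (\<Sum>i\<in>UNIV. x $ i * U i x)"
definition H :: "real^'n \<Rightarrow> real" where "H x = (\<Sum>i\<in>UNIV. U i x * U i x) / 2 + p x"
text \<open>The vorticity is an antisymmetric matrix, which makes sense in every dimension. Double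
  sums of its squares count each coordinate plane twice, hence the factors 1/2 below.\<close>

definition \<omega> :: "'n \<Rightarrow> 'n \<Rightarrow> real^'n \<Rightarrow> real" where "\<omega> i j x = partial i (U j) x - partial j (U i) x"
definition adv :: "(real^'n \<Rightarrow> real) \<Rightarrow> real^'n \<Rightarrow> real" where "adv g x = (\<Sum>i\<in>UNIV. U i x * partial i g x)"

lemma smooth_f: "smooth_on f punctured"
  unfolding f_def[abs_def]
  by (intro smooth_on_sum smooth_on_mult smooth_on_coord open_punctured smooth_U) auto

lemma smooth_H: "smooth_on H punctured"
proof -
  have "smooth_on (\<lambda>x. (1/2) * (\<Sum>i\<in>UNIV. U i x * U i x) + p x) punctured"
    by (intro smooth_on_add smooth_on_sum smooth_on_mult smooth_on_const open_punctured smooth_U smooth_p) auto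
  then show ?thesis unfolding H_def[abs_def] by simp
qed

lemma smooth_\<omega>: "smooth_on (\<omega> i j) punctured"
  unfolding \<omega>_def[abs_def] by (intro smooth_on_diff open_punctured smooth_on_partial smooth_U)

lemma df [simp]: "x \<noteq> 0 \<Longrightarrow> f differentiable (at x)"
  using smooth_on_differentiable[OF smooth_f] by simp

lemma d\<omega> [simp]: "x \<noteq> 0 \<Longrightarrow> \<omega> i j differentiable (at x)"
  using smooth_on_differentiable[OF smooth_\<omega>] by simp

lemma partial_f: "x \<noteq> 0 \<Longrightarrow> partial i f x = U i x + (\<Sum>j\<in>UNIV. x $ j * partial i (U j) x)"
proof -
  assume x: "x \<noteq> 0"
  have "partial i f x = (\<Sum>j\<in>UNIV. partial i (\<lambda>x. x $ j * U j x) x)"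
    unfolding f_def[abs_def] by (rule partial_sum) (simp add: differentiable_coord x)
  also have "\<dots> = (\<Sum>j\<in>UNIV. x $ j * partial i (U j) x + (if i = j then U j x else 0))"
    by (intro sum.cong refl) (auto simp: partial_mult differentiable_coord partial_coord x)
  finally show ?thesis by (simp add: sum.distrib)
qed

text \<open>Degree -1 makes the radial derivative of U_i equal to -U_i, and subtracting it supplies
  exactly the term U_i in the gradient of x . u.\<close>

lemma \<omega>_radial: "x \<noteq> 0 \<Longrightarrow> (\<Sum>j\<in>UNIV. \<omega> i j x * x $ j) = partial i f x"
  using euler_U[of x i]
  by (simp add: \<omega>_def partial_f algebra_simps sum_subtractf)

lemma scaling_f: "x \<noteq> 0 \<Longrightarrow> l > 0 \<Longrightarrow> f (l *\<^sub>R x) = f x"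
  unfolding f_def by (simp add: scaling_U[of x l] mult_ac)

lemma scaling_H: "x \<noteq> 0 \<Longrightarrow> l > 0 \<Longrightarrow> l\<^sup>2 * H (l *\<^sub>R x) = H x"
  unfolding H_def by (simp add: scaling_U[of x l] scaling_p[of x l] sum_distrib_left algebra_simps power2_eq_square)

lemma euler_f: "x \<noteq> 0 \<Longrightarrow> (\<Sum>j\<in>UNIV. x $ j * partial j f x) = 0"
  using euler_homogeneous[of f x 0] scaling_f by simp

lemma euler_H: "x \<noteq> 0 \<Longrightarrow> (\<Sum>j\<in>UNIV. x $ j * partial j H x) = - 2 * H x"
proof -
  assume x: "x \<noteq> 0"
  have "H (l *\<^sub>R x) = l powr (-2) * H x" if "l > 0" for l
    using scaling_H[OF x that] that by (simp add: powr_minus powr_numeral field_simps)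
  moreover have "H differentiable (at x)" using smooth_on_differentiable[OF smooth_H] x by simp
  ultimately show ?thesis using euler_homogeneous[of H x "-2"] by simp
qed

text \<open>One has \<Delta>(x . u) = x . \<Delta>u + 2 div u. The radial component of the momentum
  equation then brings in x . \<nabla>p = -2 p and x . (u . \<nabla>u) = u . \<nabla>f -
  |u|^2.\<close>

lemma laplacian_f: "x \<noteq> 0 \<Longrightarrow> laplacian f x = adv f x - 2 * H x"
proof -
  assume x: "x \<noteq> 0"
  then have xS: "x \<in> punctured" by simp
  have sm: "smooth_on (\<lambda>y. y $ j * U j y) punctured" for j
    by (intro smooth_on_mult smooth_on_coord open_punctured smooth_U)
  have "laplacian f x = (\<Sum>j\<in>UNIV. laplacian (\<lambda>y. y $ j * U j y) x)"
    unfolding f_def[abs_def]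
    by (intro laplacian_sum[OF open_punctured _ _ xS] sm) auto
  also have "\<dots> = (\<Sum>j\<in>UNIV. x $ j * laplacian (U j) x + 2 * partial j (U j) x)"
    by (intro sum.cong refl)
      (simp add: laplacian_mult[OF open_punctured smooth_on_coord smooth_U xS] laplacian_coord
        grad_inner_def partial_coord if_distrib[of "\<lambda>c. c * _"] cong: if_cong)
  also have "\<dots> = (\<Sum>j\<in>UNIV. x $ j * laplacian (U j) x)"
    using div_free[OF x] by (simp add: sum.distrib flip: sum_distrib_left)
  also have "\<dots> = (\<Sum>j\<in>UNIV. x $ j * ((\<Sum>i\<in>UNIV. U i x * partial i (U j) x) + partial j p x))"
  proof (intro sum.cong refl)
    fix j show "x $ j * laplacian (U j) x = x $ j * ((\<Sum>i\<in>UNIV. U i x * partial i (U j) x) + partial j p x)"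
      using momentum[OF x, of j] by simp
  qed
  also have "\<dots> = (\<Sum>j\<in>UNIV. \<Sum>i\<in>UNIV. U i x * (x $ j * partial i (U j) x)) - 2 * p x"
    using euler_p[OF x] by (simp add: distrib_left sum.distrib sum_distrib_left mult_ac)
  also have "(\<Sum>j\<in>UNIV. \<Sum>i\<in>UNIV. U i x * (x $ j * partial i (U j) x))
    = (\<Sum>i\<in>UNIV. U i x * (partial i f x - U i x))"
    by (subst sum.swap) (simp add: partial_f[OF x] sum_distrib_left)
  finally show ?thesis
    by (simp add: adv_def H_def right_diff_distrib sum_subtractf)
qed

text \<open>The momentum equation in Lamb's form: the convective term is the gradient of |u|^2/2
  plus a contraction of u with the vorticity.\<close>

lemma partial_H: "x \<noteq> 0 \<Longrightarrow> partial i H x = laplacian (U i) x - (\<Sum>j\<in>UNIV. U j x * \<omega> j i x)"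
proof -
  assume x: "x \<noteq> 0"
  have "partial i (\<lambda>x. (\<Sum>i\<in>UNIV. U i x * U i x)) x = (\<Sum>j\<in>UNIV. partial i (\<lambda>x. U j x * U j x) x)"
    by (rule partial_sum) (simp add: x)
  then have s: "partial i (\<lambda>x. (\<Sum>i\<in>UNIV. U i x * U i x)) x = 2 * (\<Sum>j\<in>UNIV. U j x * partial i (U j) x)"
    by (simp add: partial_mult x sum_distrib_left mult.commute)
  have "partial i H x = partial i (\<lambda>x. (1/2) * (\<Sum>i\<in>UNIV. U i x * U i x) + p x) x"
    unfolding H_def[abs_def] by simp
  also have "\<dots> = (\<Sum>j\<in>UNIV. U j x * partial i (U j) x) + partial i p x"
  proof -
    have "(\<lambda>x. \<Sum>i\<in>UNIV. U i x * U i x) differentiable (at x)" by (simp add: x)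
    then show ?thesis
      by (subst partial_add, simp_all only: partial_cmult s) (auto simp: x)
  qed
  finally show ?thesis
    using momentum[OF x, of i] by (simp add: \<omega>_def right_diff_distrib sum_subtractf)
qed

lemma partial_div: "x \<noteq> 0 \<Longrightarrow> (\<Sum>i\<in>UNIV. partial i (partial j (U i)) x) = 0"
proof -
  assume x: "x \<noteq> 0"
  have "(\<Sum>i\<in>UNIV. partial i (partial j (U i)) x) = (\<Sum>i\<in>UNIV. partial j (partial i (U i)) x)"
    using partial_commute[OF smooth_U open_punctured] x by simp
  also have "\<dots> = partial j (\<lambda>x. \<Sum>i\<in>UNIV. partial i (U i) x) x"
    by (rule partial_sum[symmetric]) (simp add: x)
  also have "\<dots> = partial j (\<lambda>x. 0) x"
    by (rule partial_cong_punctured[OF x div_free])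
  finally show ?thesis by simp
qed

lemma div_laplacian: "x \<noteq> 0 \<Longrightarrow> (\<Sum>i\<in>UNIV. partial i (laplacian (U i)) x) = 0"
proof -
  assume x: "x \<noteq> 0"
  note c = partial_commute[OF _ open_punctured]
  have "partial i (laplacian (U i)) x = (\<Sum>j\<in>UNIV. partial j (partial i (partial j (U i))) x)" for i
  proof -
    have "partial i (laplacian (U i)) x = (\<Sum>j\<in>UNIV. partial i (partial j (partial j (U i))) x)"
      unfolding laplacian_def[abs_def]
      using smooth_on_differentiable[OF smooth_on_partial[OF smooth_on_partial[OF smooth_U]]] x
      by (intro partial_sum) auto
    then show ?thesis using c[OF smooth_on_partial[OF smooth_U]] x by simp
  qed
  then have "(\<Sum>i\<in>UNIV. partial i (laplacian (U i)) x)
    = (\<Sum>j\<in>UNIV. \<Sum>i\<in>UNIV. partial j (partial i (partial j (U i))) x)"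
    by (simp add: sum.swap[of "\<lambda>i j. partial j (partial i (partial j (U i))) x"])
  also have "\<dots> = (\<Sum>j\<in>UNIV. partial j (\<lambda>x. \<Sum>i\<in>UNIV. partial i (partial j (U i)) x) x)"
    using smooth_on_differentiable[OF smooth_on_partial[OF smooth_on_partial[OF smooth_U]]] x
    by (intro sum.cong refl partial_sum[symmetric]) auto
  also have "\<dots> = (\<Sum>j\<in>UNIV. partial j (\<lambda>x. 0) x)"
    by (intro sum.cong refl partial_cong_punctured[OF x] partial_div)
  finally show ?thesis by simp
qed

lemma laplacian_U_\<omega>: "x \<noteq> 0 \<Longrightarrow> (\<Sum>i\<in>UNIV. partial i (\<omega> j i) x) = - laplacian (U j) x"
proof -
  assume x: "x \<noteq> 0"
  have "partial i (\<omega> j i) x = partial i (partial j (U i)) x - partial i (partial i (U j)) x" for i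
    unfolding \<omega>_def[abs_def] by (rule partial_diff) (auto simp: x)
  then show ?thesis by (simp add: sum_subtractf partial_div[OF x] laplacian_def)
qed

lemma \<omega>_anti: "\<omega> i j x = - \<omega> j i x" by (simp add: \<omega>_def)

text \<open>The divergence of \<open>partial_H\<close>. The field \<Delta>u is divergence free, the
  divergence of the vorticity is -\<Delta>u, and u . \<nabla>H = u . \<Delta>u because antisymmetry
  removes the vorticity term. The squared vorticity remains.\<close>

lemma laplacian_H: "x \<noteq> 0 \<Longrightarrow> laplacian H x = adv H x + (\<Sum>i\<in>UNIV. \<Sum>j\<in>UNIV. (\<omega> i j x)\<^sup>2) / 2"
proof -
  assume x: "x \<noteq> 0"
  have dl: "laplacian (U i) differentiable (at x)" for i
    using smooth_on_differentiable[OF smooth_on_laplacian[OF open_punctured smooth_U]] x by simp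
  have "partial i (partial i H) x = partial i (laplacian (U i)) x
    - (\<Sum>j\<in>UNIV. U j x * partial i (\<omega> j i) x + partial i (U j) x * \<omega> j i x)" for i
  proof -
    have "partial i (partial i H) x = partial i (\<lambda>x. laplacian (U i) x - (\<Sum>j\<in>UNIV. U j x * \<omega> j i x)) x"
      by (rule partial_cong_punctured[OF x partial_H])
    also have "\<dots> = partial i (laplacian (U i)) x - (\<Sum>j\<in>UNIV. partial i (\<lambda>x. U j x * \<omega> j i x) x)"
      by (subst partial_diff) (auto simp: dl x partial_sum intro!: differentiable_sum)
    finally show ?thesis by (simp add: partial_mult x)
  qed
  then have "laplacian H x = - (\<Sum>i\<in>UNIV. \<Sum>j\<in>UNIV. U j x * partial i (\<omega> j i) x)
      - (\<Sum>i\<in>UNIV. \<Sum>j\<in>UNIV. partial i (U j) x * \<omega> j i x)"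
    by (simp add: laplacian_def[of H] sum_subtractf div_laplacian[OF x] sum.distrib)
  moreover have "(\<Sum>i\<in>UNIV. \<Sum>j\<in>UNIV. U j x * partial i (\<omega> j i) x) = - (\<Sum>j\<in>UNIV. U j x * laplacian (U j) x)"
    by (subst sum.swap) (simp add: laplacian_U_\<omega>[OF x] sum_negf flip: sum_distrib_left)
  moreover have "(\<Sum>i\<in>UNIV. \<Sum>j\<in>UNIV. partial i (U j) x * \<omega> j i x) = - (\<Sum>i\<in>UNIV. \<Sum>j\<in>UNIV. (\<omega> i j x)\<^sup>2) / 2"
  proof -
    have a: "(\<Sum>i\<in>UNIV. \<Sum>j\<in>UNIV. partial j (U i) x * \<omega> j i x) = - (\<Sum>i\<in>UNIV. \<Sum>j\<in>UNIV. partial i (U j) x * \<omega> j i x)"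
      by (subst sum.swap) (subst \<omega>_anti, simp add: sum_negf)
    have "(\<Sum>i\<in>UNIV. \<Sum>j\<in>UNIV. (\<omega> i j x)\<^sup>2)
      = (\<Sum>i\<in>UNIV. \<Sum>j\<in>UNIV. partial j (U i) x * \<omega> j i x - partial i (U j) x * \<omega> j i x)"
      by (intro sum.cong refl) (simp add: \<omega>_def power2_eq_square algebra_simps)
    then show ?thesis using a by (simp add: sum_subtractf)
  qed
  moreover have "adv H x = (\<Sum>j\<in>UNIV. U j x * laplacian (U j) x)"
  proof -
    have "(\<Sum>i\<in>UNIV. \<Sum>j\<in>UNIV. U i x * (U j x * \<omega> j i x)) = - (\<Sum>i\<in>UNIV. \<Sum>j\<in>UNIV. U i x * (U j x * \<omega> j i x))"
      by (subst sum.swap) (subst \<omega>_anti, simp add: sum_negf mult_ac)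
    then show ?thesis
      by (simp add: adv_def partial_H[OF x] right_diff_distrib sum_subtractf sum_distrib_left)
  qed
  ultimately show ?thesis by simp
qed

definition G :: "real^'n \<Rightarrow> real" where
  "G x = sqnorm x * H x + ((- 1 / 2) * (f x * f x) + (real CARD('n) - 4) * f x)"

lemma smooth_G: "smooth_on G punctured"
  unfolding G_def[abs_def]
  by (intro smooth_on_add smooth_on_mult smooth_on_const open_punctured smooth_on_sqnorm smooth_H smooth_f)

lemma adv_sqnorm: "adv sqnorm x = 2 * f x"
  by (simp add: adv_def partial_sqnorm f_def sum_distrib_left mult_ac)

lemma laplacian_G:
  assumes x: "x \<noteq> 0"
  shows "laplacian G x - adv G x
    = sqnorm x / 2 * (\<Sum>i\<in>UNIV. \<Sum>j\<in>UNIV. (\<omega> i j x)\<^sup>2) - (\<Sum>i\<in>UNIV. (partial i f x)\<^sup>2)"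
proof -
  have xS: "x \<in> punctured" using x by simp
  note op = open_punctured
  note sm = smooth_on_mult[OF op smooth_on_sqnorm smooth_H] smooth_on_mult[OF op smooth_f smooth_f]
    smooth_on_mult[OF op smooth_on_const smooth_on_mult[OF op smooth_f smooth_f]]
    smooth_on_mult[OF op smooth_on_const smooth_f]
  note d = sm[THEN smooth_on_differentiable, OF xS]
  have dH: "H differentiable (at x)" using smooth_on_differentiable[OF smooth_H xS] .
  have ds: "sqnorm differentiable (at x)" using smooth_on_differentiable[OF smooth_on_sqnorm xS] .
  \<comment> \<open>H has degree -2. Doubled, this contributes -8 H against the 2 n H from the
    Laplacian of r^2, which is the origin of the coefficient n - 4 in \<open>G\<close>.\<close>
  have gH: "grad_inner sqnorm H x = - 4 * H x"
    using euler_H[OF x] by (simp add: grad_inner_def partial_sqnorm mult.assoc flip: sum_distrib_left)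
  have gf: "grad_inner f f x = (\<Sum>i\<in>UNIV. (partial i f x)\<^sup>2)"
    by (simp add: grad_inner_def power2_eq_square)
  have lap: "laplacian G x = (sqnorm x * laplacian H x + H x * (2 * real CARD('n)) + 2 * (- 4 * H x))
    + ((- 1 / 2) * (f x * laplacian f x + f x * laplacian f x + 2 * (\<Sum>i\<in>UNIV. (partial i f x)\<^sup>2))
    + (real CARD('n) - 4) * laplacian f x)"
    unfolding G_def[abs_def]
    by (subst laplacian_add[OF op sm(1) smooth_on_add[OF op sm(3,4)] xS],
        subst laplacian_add[OF op sm(3,4) xS],
        subst laplacian_mult[OF op smooth_on_sqnorm smooth_H xS],
        subst laplacian_cmult[OF op sm(2) xS],
        subst laplacian_cmult[OF op smooth_f xS],
        subst laplacian_mult[OF op smooth_f smooth_f xS])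
      (simp only: gH gf laplacian_sqnorm)
  have "partial i G x = sqnorm x * partial i H x + partial i sqnorm x * H x - f x * partial i f x
    + (real CARD('n) - 4) * partial i f x" for i
  proof -
    have "partial i G x = (sqnorm x * partial i H x + partial i sqnorm x * H x)
      + ((- 1 / 2) * (f x * partial i f x + partial i f x * f x) + (real CARD('n) - 4) * partial i f x)"
      unfolding G_def[abs_def]
      by (subst partial_add[OF d(1) differentiable_add[OF d(3,4)]],
          subst partial_add[OF d(3,4)],
          subst partial_mult[OF ds dH],
          subst partial_cmult[OF d(2)],
          subst partial_cmult[OF df[OF x]],
          subst partial_mult[OF df[OF x] df[OF x]]) simp
    then show ?thesis by simp
  qed
  note pG = this
  have "adv G x = (\<Sum>i\<in>UNIV. sqnorm x * (U i x * partial i H x) + (U i x * partial i sqnorm x) * H x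
      - f x * (U i x * partial i f x) + (real CARD('n) - 4) * (U i x * partial i f x))"
    unfolding adv_def by (intro sum.cong refl) (simp only: pG, simp add: algebra_simps)
  then have adv: "adv G x = sqnorm x * adv H x + adv sqnorm x * H x - f x * adv f x + (real CARD('n) - 4) * adv f x"
    by (simp only: adv_def sum.distrib sum_subtractf sum_distrib_left sum_distrib_right)
  show ?thesis
    unfolding lap adv adv_sqnorm laplacian_f[OF x] laplacian_H[OF x]
    by (simp add: algebra_simps)
qed

text \<open>The equation of \<open>G\<close> has the sum of the squares of \<open>T\<close> over 2
  r^2 as its right-hand side. Its sign makes \<open>G\<close> constant, and constancy in turn makes
  every square vanish, so both conclusions come from one application of the maximum
  principle.\<close>

lemma G_const_and_vorticity:
  "\<exists>c. (\<forall>x. x \<noteq> 0 \<longrightarrow> G x = c)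
    \<and> (\<forall>x i j. x \<noteq> 0 \<longrightarrow> sqnorm x * \<omega> i j x = partial i f x * x $ j - partial j f x * x $ i)"
proof -
  define T where "T i j x = sqnorm x * \<omega> i j x - (partial i f x * x $ j - partial j f x * x $ i)" for i j x
  have LG: "laplacian G x - adv G x = (\<Sum>i\<in>UNIV. \<Sum>j\<in>UNIV. (T i j x)\<^sup>2) / (2 * sqnorm x)" if x: "x \<noteq> 0" for x
  proof -
    have "(\<Sum>i\<in>UNIV. \<Sum>j\<in>UNIV. (T i j x)\<^sup>2) = 2 * sqnorm x * (laplacian G x - adv G x)"
      unfolding T_def laplacian_G[OF x]
      by (rule antisymmetric_decomposition[OF \<omega>_anti \<omega>_radial[OF x, symmetric] sqnorm_def])
    then show ?thesis using sqnorm_pos[OF x] by simp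
  qed
  have "\<exists>c. \<forall>x. x \<noteq> 0 \<longrightarrow> G x = c"
  proof (rule homogeneous_strong_maximum[OF _ smooth_G, where b = "\<lambda>i x. - U i x"])
    show "CARD('n) \<ge> 2" using dim by simp
    show "G (l *\<^sub>R x) = G x" if "x \<noteq> 0" "l > 0" for x l
      using scaling_H[OF that] scaling_f[OF that]
      by (simp add: G_def sqnorm_norm power_mult_distrib)
    show "continuous_on punctured (\<lambda>x. - U i x)" for i
      by (intro continuous_on_minus smooth_on_continuous_on smooth_U)
    fix x :: "real^'n" assume x: "x \<noteq> 0"
    have "laplacian G x - adv G x \<ge> 0"
      unfolding LG[OF x] using sqnorm_pos[OF x] by (intro divide_nonneg_pos sum_nonneg) auto
    then show "(\<Sum>i\<in>UNIV. partial i (partial i G) x) + (\<Sum>i\<in>UNIV. - U i x * partial i G x) \<ge> 0"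
      by (simp add: laplacian_def adv_def sum_negf)
  qed
  then obtain c where c: "\<And>x. x \<noteq> 0 \<Longrightarrow> G x = c" by blast
  have "T i j x = 0" if x: "x \<noteq> 0" for i j x
  proof -
    have pG: "partial i G y = 0" if "y \<noteq> 0" for i y
      using partial_cong_punctured[OF that c] by simp
    then have "partial i (partial i G) x = 0" for i
      using partial_cong_punctured[OF x pG] by simp
    then have "laplacian G x - adv G x = 0"
      using pG[OF x] by (simp add: laplacian_def adv_def)
    then have "(\<Sum>i\<in>UNIV. \<Sum>j\<in>UNIV. (T i j x)\<^sup>2) = 0" using LG[OF x] sqnorm_pos[OF x] by simp
    then show ?thesis by (simp add: sum_nonneg_eq_0_iff sum_nonneg)
  qed
  then show ?thesis using c by (force simp: T_def)
qed

end

section \<open>The potential of the tangential velocity\<close>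

lemma smooth_on_inverse_sqnorm: "smooth_on (\<lambda>x. inverse (sqnorm x)) (punctured :: (real^'n) set)"
  using sqnorm_pos by (intro smooth_on_inverse open_punctured smooth_on_sqnorm) force

lemma partial_inverse_sqnorm:
  assumes "x \<noteq> 0"
  shows "partial i (\<lambda>x. inverse (sqnorm x)) x = - 2 * x $ i * (inverse (sqnorm x))\<^sup>2"
proof -
  have "sqnorm differentiable (at x)" using smooth_on_differentiable[OF smooth_on_sqnorm] assms by simp
  from partial_compose_real[OF this DERIV_inverse] sqnorm_pos[OF assms]
  show ?thesis by (simp add: partial_sqnorm power2_eq_square numeral_2_eq_2)
qed

lemma smooth_on_coord_over_sqnorm:
  "smooth_on (\<lambda>x. x $ i * inverse (sqnorm x)) (punctured :: (real^'n) set)"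
  by (intro smooth_on_mult smooth_on_coord smooth_on_inverse_sqnorm open_punctured)

lemma partial_coord_over_sqnorm:
  assumes "x \<noteq> 0"
  shows "partial j (\<lambda>x. x $ i * inverse (sqnorm x)) x
    = (if i = j then inverse (sqnorm x) else 0) - 2 * x $ i * x $ j * (inverse (sqnorm x))\<^sup>2"
proof -
  have d: "(\<lambda>x. inverse (sqnorm x)) differentiable (at x)"
    using smooth_on_differentiable[OF smooth_on_inverse_sqnorm] assms by simp
  show ?thesis
    by (subst partial_mult[OF differentiable_coord d])
       (simp add: partial_inverse_sqnorm[OF assms] partial_coord)
qed

lemma div_coord_over_sqnorm:
  fixes x :: "real^'n"
  assumes "x \<noteq> 0"
  shows "(\<Sum>i\<in>UNIV. partial i (\<lambda>x. x $ i * inverse (sqnorm x)) x) = (real CARD('n) - 2) * inverse (sqnorm x)"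
proof -
  define r where "r = inverse (sqnorm x)"
  have "(\<Sum>i\<in>UNIV. 2 * x $ i * x $ i * r\<^sup>2) = 2 * sqnorm x * r\<^sup>2"
    by (simp add: sqnorm_def sum_distrib_left sum_distrib_right mult_ac)
  then have "(\<Sum>i\<in>UNIV. partial i (\<lambda>x. x $ i * inverse (sqnorm x)) x)
    = real CARD('n) * inverse (sqnorm x) - 2 * sqnorm x * (inverse (sqnorm x))\<^sup>2"
    unfolding partial_coord_over_sqnorm[OF assms] sum_subtractf r_def by simp
  moreover have "sqnorm x * (inverse (sqnorm x))\<^sup>2 = inverse (sqnorm x)"
    using sqnorm_pos[OF assms] by (simp add: power2_eq_square)
  ultimately show ?thesis by (simp add: left_diff_distrib mult.assoc)
qed

context homogeneous_navier_stokes
begin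

text \<open>The tangential part of the velocity.\<close>

definition W :: "'n \<Rightarrow> real^'n \<Rightarrow> real" where
  "W i x = U i x - f x * (x $ i * inverse (sqnorm x))"

lemma smooth_W: "smooth_on (W i) punctured"
  unfolding W_def[abs_def]
  by (intro smooth_on_diff smooth_on_mult smooth_U smooth_f smooth_on_coord_over_sqnorm open_punctured)

lemma partial_W:
  assumes x: "x \<noteq> 0"
  shows "partial j (W i) x = partial j (U i) x
    - (f x * partial j (\<lambda>x. x $ i * inverse (sqnorm x)) x + partial j f x * (x $ i * inverse (sqnorm x)))"
proof -
  have d: "(\<lambda>x. x $ i * inverse (sqnorm x)) differentiable (at x)"
    using smooth_on_differentiable[OF smooth_on_coord_over_sqnorm] x by simp
  show ?thesis
    unfolding W_def[abs_def]
    by (subst partial_diff[OF dU[OF x] differentiable_mult[OF df[OF x] d]],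
        subst partial_mult[OF df[OF x] d]) simp
qed

lemma radial_W: "x \<noteq> 0 \<Longrightarrow> (\<Sum>i\<in>UNIV. x $ i * W i x) = 0"
proof -
  assume x: "x \<noteq> 0"
  define k where "k = f x * inverse (sqnorm x)"
  have "x $ i * W i x = x $ i * U i x - k * (x $ i * x $ i)" for i
    by (simp add: W_def k_def algebra_simps)
  then have "(\<Sum>i\<in>UNIV. x $ i * W i x) = f x - k * sqnorm x"
    by (simp add: f_def sqnorm_def sum_subtractf sum_distrib_left)
  then show ?thesis using sqnorm_pos[OF x] by (simp add: k_def)
qed

lemma div_W: "x \<noteq> 0 \<Longrightarrow> (\<Sum>i\<in>UNIV. partial i (W i) x) = - (real CARD('n) - 2) * f x * inverse (sqnorm x)"
proof -
  assume x: "x \<noteq> 0"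
  have "(\<Sum>i\<in>UNIV. partial i (W i) x) = 0 - (f x * ((real CARD('n) - 2) * inverse (sqnorm x))
      + inverse (sqnorm x) * (\<Sum>i\<in>UNIV. x $ i * partial i f x))"
    unfolding partial_W[OF x] sum_subtractf sum.distrib div_free[OF x]
    by (simp add: sum_distrib_left[symmetric] div_coord_over_sqnorm[OF x])
       (simp add: sum_distrib_left mult_ac)
  then show ?thesis using euler_f[OF x] by (simp add: algebra_simps)
qed

text \<open>f has degree 0, so the radial part of the velocity does not act on it and the drift can
  be replaced by \<open>W\<close>, which will be a gradient.\<close>

lemma adv_f_W: "x \<noteq> 0 \<Longrightarrow> adv f x = (\<Sum>i\<in>UNIV. W i x * partial i f x)"
proof -
  assume x: "x \<noteq> 0"
  have "(\<Sum>i\<in>UNIV. W i x * partial i f x)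
    = adv f x - f x * inverse (sqnorm x) * (\<Sum>i\<in>UNIV. x $ i * partial i f x)"
    by (simp add: W_def adv_def algebra_simps sum_subtractf sum_distrib_left)
  then show ?thesis using euler_f[OF x] by simp
qed

text \<open>The antisymmetrised derivative of the radial field f x/r^2 is (x_j \<partial>_i f - x_i
  \<partial>_j f)/r^2. The vorticity identity says that it equals the vorticity of u, so the
  difference \<open>W\<close> is closed.\<close>

lemma potential_exists:
  "\<exists>\<phi> c. smooth_on \<phi> punctured \<and> (\<forall>x i. x \<noteq> 0 \<longrightarrow> partial i \<phi> x = W i x) \<and> (\<forall>x. x \<noteq> 0 \<longrightarrow> G x = c)"
proof -
  obtain c where c: "\<And>x. x \<noteq> 0 \<Longrightarrow> G x = c"
    and vort: "\<And>x i j. x \<noteq> 0 \<Longrightarrow> sqnorm x * \<omega> i j x = partial i f x * x $ j - partial j f x * x $ i"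
    using G_const_and_vorticity by blast
  have "partial i (W j) x = partial j (W i) x" if x: "x \<noteq> 0" for i j x
  proof -
    have "\<omega> i j x = (partial i f x * x $ j - partial j f x * x $ i) * inverse (sqnorm x)"
      using vort[OF x, of i j] sqnorm_pos[OF x] by (simp add: field_simps)
    then show ?thesis
      unfolding partial_W[OF x] partial_coord_over_sqnorm[OF x]
      by (simp add: \<omega>_def algebra_simps)
  qed
  from poincare_lemma_punctured[OF dim smooth_W this] c show ?thesis by blast
qed

text \<open>\<open>potential_exists\<close> gives some potential and some constant; fixing a pair
  here lets \<open>q\<close> and the equations below refer to them.\<close>

context
  fixes \<phi> :: "real^'n \<Rightarrow> real" and c :: real
  assumes smooth_\<phi>: "smooth_on \<phi> punctured"
    and partial_\<phi>: "x \<noteq> 0 \<Longrightarrow> partial i \<phi> x = W i x"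
    and G_c: "x \<noteq> 0 \<Longrightarrow> G x = c"
begin

lemma scaling_\<phi>: "x \<noteq> 0 \<Longrightarrow> l > 0 \<Longrightarrow> \<phi> (l *\<^sub>R x) = \<phi> x"
  by (rule radial_constant[OF smooth_\<phi>]) (simp_all add: partial_\<phi> radial_W)

lemma laplacian_\<phi>:
  assumes x: "x \<noteq> 0"
  shows "laplacian \<phi> x = - (real CARD('n) - 2) * f x * inverse (sqnorm x)"
proof -
  have "partial i (partial i \<phi>) x = partial i (W i) x" for i
    by (rule partial_cong_punctured[OF x partial_\<phi>])
  then show ?thesis using div_W[OF x] by (simp add: laplacian_def)
qed

lemma two_H: "x \<noteq> 0 \<Longrightarrow> 2 * H x = (2 * c + (f x)\<^sup>2 - 2 * (real CARD('n) - 4) * f x) * inverse (sqnorm x)"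
proof -
  assume x: "x \<noteq> 0"
  have "sqnorm x * (2 * H x) = 2 * c + (f x)\<^sup>2 - 2 * (real CARD('n) - 4) * f x"
    using G_c[OF x] by (simp add: G_def power2_eq_square algebra_simps)
  then show ?thesis using sqnorm_pos[OF x] by (simp add: field_simps)
qed

definition q :: "real \<Rightarrow> real^'n \<Rightarrow> real" where "q b x = (f x + b) * exp (- \<phi> x)"

lemma smooth_fb: "smooth_on (\<lambda>x. f x + b) punctured"
  by (intro smooth_on_add smooth_f smooth_on_const open_punctured)

lemma smooth_exp_\<phi>: "smooth_on (\<lambda>x. exp (- \<phi> x)) punctured"
  by (intro smooth_on_exp smooth_on_minus smooth_\<phi> open_punctured)

lemma smooth_q: "smooth_on (q b) punctured"
  unfolding q_def[abs_def] by (intro smooth_on_mult smooth_fb smooth_exp_\<phi> open_punctured)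

lemma scaling_q: "x \<noteq> 0 \<Longrightarrow> l > 0 \<Longrightarrow> q b (l *\<^sub>R x) = q b x"
  by (simp add: q_def scaling_f scaling_\<phi>)

lemma laplacian_q:
  assumes x: "x \<noteq> 0"
  shows "laplacian (q b) x + (\<Sum>i\<in>UNIV. W i x * partial i (q b) x)
    = exp (- \<phi> x) * inverse (sqnorm x) *
      ((real CARD('n) - 3) * (f x)\<^sup>2 + (2 * (real CARD('n) - 4) + (real CARD('n) - 2) * b) * f x - 2 * c)"
proof -
  have xS: "x \<in> punctured" using x by simp
  note op = open_punctured
  have sm: "smooth_on (\<lambda>x. - \<phi> x) punctured" by (intro smooth_on_minus smooth_\<phi> op)
  have d\<phi>: "\<phi> differentiable (at y)" if "y \<noteq> 0" for y
    using smooth_on_differentiable[OF smooth_\<phi>] that by simp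
  have pm: "partial i (\<lambda>x. - \<phi> x) y = - W i y" if "y \<noteq> 0" for i y
    using partial_minus[OF d\<phi>[OF that]] partial_\<phi>[OF that] by simp
  have pe: "partial i (\<lambda>x. exp (- \<phi> x)) x = - exp (- \<phi> x) * W i x" for i
    using partial_compose_real[OF smooth_on_differentiable[OF sm xS] DERIV_exp] pm[OF x] by simp
  have pf: "partial i (\<lambda>x. f x + b) x = partial i f x" for i
    by (subst partial_add) (auto simp: x)
  have lf: "laplacian (\<lambda>x. f x + b) x = laplacian f x"
    by (subst laplacian_add[OF op smooth_f smooth_on_const xS]) (simp add: laplacian_const)
  have lm: "laplacian (\<lambda>x. - \<phi> x) x = - laplacian \<phi> x"
    using laplacian_cmult[OF op smooth_\<phi> xS, of "-1"] by simp
  define w where "w = (\<Sum>i\<in>UNIV. W i x * W i x)"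
  have gm: "grad_inner (\<lambda>x. - \<phi> x) (\<lambda>x. - \<phi> x) x = w"
    by (simp add: grad_inner_def pm[OF x] w_def)
  have le: "laplacian (\<lambda>x. exp (- \<phi> x)) x = exp (- \<phi> x) * (- laplacian \<phi> x + w)"
    by (subst laplacian_exp[OF op sm xS]) (simp add: lm gm)
  have ge: "grad_inner (\<lambda>x. f x + b) (\<lambda>x. exp (- \<phi> x)) x = - exp (- \<phi> x) * adv f x"
    by (simp add: grad_inner_def pf pe adv_f_W[OF x] sum_distrib_left sum_negf mult_ac)
  have lq: "laplacian (q b) x = (f x + b) * (exp (- \<phi> x) * (- laplacian \<phi> x + w))
      + exp (- \<phi> x) * laplacian f x + 2 * (- exp (- \<phi> x) * adv f x)"
    unfolding q_def[abs_def]
    by (subst laplacian_mult[OF op smooth_fb smooth_exp_\<phi> xS]) (simp only: le lf ge)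
  have "partial i (q b) x = (f x + b) * (- exp (- \<phi> x) * W i x) + partial i f x * exp (- \<phi> x)" for i
    unfolding q_def[abs_def]
    by (subst partial_mult[OF smooth_on_differentiable[OF smooth_fb xS] smooth_on_differentiable[OF smooth_exp_\<phi> xS]])
       (simp only: pe pf)
  note pq = this
  have "W i x * partial i (q b) x
    = exp (- \<phi> x) * (W i x * partial i f x) - (f x + b) * exp (- \<phi> x) * (W i x * W i x)" for i
    by (simp only: pq) (simp add: algebra_simps)
  then have aq: "(\<Sum>i\<in>UNIV. W i x * partial i (q b) x)
    = exp (- \<phi> x) * adv f x - (f x + b) * exp (- \<phi> x) * w"
    by (simp add: sum_subtractf w_def adv_f_W[OF x] sum_distrib_left)
  have "laplacian (q b) x + (\<Sum>i\<in>UNIV. W i x * partial i (q b) x)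
    = exp (- \<phi> x) * (laplacian f x - adv f x - (f x + b) * laplacian \<phi> x)"
    unfolding lq aq by (simp add: algebra_simps)
  \<comment> \<open>Each term is a polynomial in f over r^2: H by the constancy of \<open>G\<close>,
    and the Laplacian of \<phi> because u is divergence free.\<close>
  also have "laplacian f x - adv f x - (f x + b) * laplacian \<phi> x
    = inverse (sqnorm x) * ((real CARD('n) - 3) * (f x)\<^sup>2 + (2 * (real CARD('n) - 4) + (real CARD('n) - 2) * b) * f x - 2 * c)"
    unfolding laplacian_f[OF x] two_H[OF x] laplacian_\<phi>[OF x]
    by (simp add: algebra_simps power2_eq_square)
  finally show ?thesis by (simp add: mult.assoc)
qed

text \<open>The value of \<open>b\<close> that cancels the term linear in \<open>f\<close> in the equation for \<open>q b\<close>.\<close>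

definition b\<^sub>n :: real where "b\<^sub>n = - 2 * (real CARD('n) - 4) / (real CARD('n) - 2)"

lemma laplacian_q_bn:
  assumes x: "x \<noteq> 0"
  shows "laplacian (q b\<^sub>n) x + (\<Sum>i\<in>UNIV. W i x * partial i (q b\<^sub>n) x)
    = exp (- \<phi> x) * inverse (sqnorm x) * ((real CARD('n) - 3) * (f x)\<^sup>2 - 2 * c)"
proof -
  have "real CARD('n) - 2 \<noteq> 0" using dim by simp
  then have "(real CARD('n) - 2) * b\<^sub>n = - 2 * (real CARD('n) - 4)"
    by (simp add: b\<^sub>n_def)
  then show ?thesis using laplacian_q[OF x, of b\<^sub>n] by simp
qed

lemma q_const:
  assumes "\<And>x. x \<noteq> 0 \<Longrightarrow> (real CARD('n) - 3) * (f x)\<^sup>2 \<ge> 2 * c"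
  shows "\<exists>C. \<forall>x. x \<noteq> 0 \<longrightarrow> q b\<^sub>n x = C"
proof (rule homogeneous_strong_maximum[OF _ smooth_q, where b = W])
  show "(\<Sum>i\<in>UNIV. partial i (partial i (q b\<^sub>n)) x) + (\<Sum>i\<in>UNIV. W i x * partial i (q b\<^sub>n) x) \<ge> 0"
    if x: "x \<noteq> 0" for x
    using assms[OF x] sqnorm_pos[OF x] laplacian_q_bn[OF x] by (simp add: laplacian_def)
qed (use dim scaling_q smooth_on_continuous_on[OF smooth_W] in auto)

lemma q_const':
  assumes "\<And>x. x \<noteq> 0 \<Longrightarrow> (real CARD('n) - 3) * (f x)\<^sup>2 \<le> 2 * c"
  shows "\<exists>C. \<forall>x. x \<noteq> 0 \<longrightarrow> q b\<^sub>n x = C"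
proof -
  have dq: "q b\<^sub>n differentiable (at x)" "partial i (q b\<^sub>n) differentiable (at x)" if "x \<noteq> 0" for x i
    using smooth_on_differentiable[OF smooth_q] smooth_on_differentiable[OF smooth_on_partial[OF smooth_q]] that by auto
  have m: "partial i (\<lambda>x. - q b\<^sub>n x) x = - partial i (q b\<^sub>n) x" if "x \<noteq> 0" for x i
    by (rule partial_minus[OF dq(1)[OF that]])
  have m2: "partial i (partial i (\<lambda>x. - q b\<^sub>n x)) x = - partial i (partial i (q b\<^sub>n)) x" if "x \<noteq> 0" for x i
    by (rule trans[OF partial_cong_punctured[OF that m] partial_minus[OF dq(2)[OF that]]])
  have "\<exists>C. \<forall>x. x \<noteq> 0 \<longrightarrow> - q b\<^sub>n x = C"
  proof (rule homogeneous_strong_maximum[OF _ smooth_on_minus[OF open_punctured smooth_q], where b = W])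
    show "(\<Sum>i\<in>UNIV. partial i (partial i (\<lambda>x. - q b\<^sub>n x)) x) + (\<Sum>i\<in>UNIV. W i x * partial i (\<lambda>x. - q b\<^sub>n x) x) \<ge> 0"
      if x: "x \<noteq> 0" for x
    proof -
      have "exp (- \<phi> x) * inverse (sqnorm x) * ((real CARD('n) - 3) * (f x)\<^sup>2 - 2 * c) \<le> 0"
        using assms[OF x] sqnorm_pos[OF x] by (intro mult_nonneg_nonpos) auto
      then show ?thesis
        using laplacian_q_bn[OF x] by (simp add: laplacian_def m[OF x] m2[OF x] sum_negf)
    qed
  qed (use dim scaling_q smooth_on_continuous_on[OF smooth_W] in auto)
  then obtain C where "\<And>x. x \<noteq> 0 \<Longrightarrow> - q b\<^sub>n x = C" by blast
  then have "\<forall>x. x \<noteq> 0 \<longrightarrow> q b\<^sub>n x = - C" by force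
  then show ?thesis by blast
qed

lemma q_const_imp:
  assumes "\<And>x. x \<noteq> 0 \<Longrightarrow> q b\<^sub>n x = C" and x: "x \<noteq> 0"
  shows "(real CARD('n) - 3) * (f x)\<^sup>2 = 2 * c"
proof -
  have p: "partial i (q b\<^sub>n) y = 0" if "y \<noteq> 0" for i y
    using partial_cong_punctured[OF that assms(1)] by simp
  have "partial i (partial i (q b\<^sub>n)) x = 0" for i
    using partial_cong_punctured[OF x p] by simp
  then show ?thesis using laplacian_q_bn[OF x] p[OF x] sqnorm_pos[OF x] by (simp add: laplacian_def)
qed

text \<open>A substitute for the vanishing mean of f over the sphere. The Laplacian of \<phi> is a
  negative multiple of f, so if f has one sign then \<phi> or -\<phi> is subharmonic of degree 0,
  hence constant.\<close>

lemma f_constant_sign: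
  assumes "(\<forall>x. x \<noteq> 0 \<longrightarrow> f x \<ge> 0) \<or> (\<forall>x. x \<noteq> 0 \<longrightarrow> f x \<le> 0)" and x: "x \<noteq> 0"
  shows "f x = 0"
proof -
  have n2: "real CARD('n) - 2 > 0" using dim by simp
  have "\<exists>s::real. s \<noteq> 0 \<and> (\<forall>x. x \<noteq> 0 \<longrightarrow> s * laplacian \<phi> x \<ge> 0)"
    using assms(1)
  proof
    assume a: "\<forall>x. x \<noteq> 0 \<longrightarrow> f x \<ge> 0"
    have "(-1) * laplacian \<phi> x \<ge> 0" if "x \<noteq> 0" for x
    proof -
      have "(-1) * laplacian \<phi> x = (real CARD('n) - 2) * f x * inverse (sqnorm x)"
        by (simp add: laplacian_\<phi>[OF that] algebra_simps)
      then show ?thesis using a n2 sqnorm_pos[OF that] that by simp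
    qed
    then show ?thesis by (metis neg_equal_0_iff_equal zero_neq_one)
  next
    assume a: "\<forall>x. x \<noteq> 0 \<longrightarrow> f x \<le> 0"
    have "1 * laplacian \<phi> x \<ge> 0" if "x \<noteq> 0" for x
    proof -
      have "(real CARD('n) - 2) * f x \<le> 0" using a n2 that by (simp add: mult_le_0_iff)
      then have "(real CARD('n) - 2) * f x * inverse (sqnorm x) \<le> 0"
        using sqnorm_pos[OF that] by (simp add: mult_le_0_iff)
      then show ?thesis by (simp add: laplacian_\<phi>[OF that] algebra_simps)
    qed
    then show ?thesis by (metis zero_neq_one)
  qed
  then obtain s :: real where s: "s \<noteq> 0" "\<And>x. x \<noteq> 0 \<Longrightarrow> s * laplacian \<phi> x \<ge> 0" by blast
  have sm: "smooth_on (\<lambda>x. s * \<phi> x) punctured"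
    by (intro smooth_on_mult smooth_on_const smooth_\<phi> open_punctured)
  have l: "laplacian (\<lambda>x. s * \<phi> x) x = s * laplacian \<phi> x" if "x \<noteq> 0" for x
    by (rule laplacian_cmult[OF open_punctured smooth_\<phi>]) (use that in simp)
  have "\<exists>C. \<forall>x. x \<noteq> 0 \<longrightarrow> s * \<phi> x = C"
  proof (rule homogeneous_strong_maximum[OF _ sm, where b = "\<lambda>i x. 0"])
    show "(\<Sum>i\<in>UNIV. partial i (partial i (\<lambda>x. s * \<phi> x)) x) + (\<Sum>i\<in>UNIV. 0 * partial i (\<lambda>x. s * \<phi> x) x) \<ge> 0"
      if "x \<noteq> 0" for x
      using s(2)[OF that] l[OF that] by (simp add: laplacian_def)
  qed (use dim scaling_\<phi> in auto)
  then obtain C where C: "\<And>x. x \<noteq> 0 \<Longrightarrow> s * \<phi> x = C" by blast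
  have p: "partial i (\<lambda>x. s * \<phi> x) y = 0" if "y \<noteq> 0" for i y
    using partial_cong_punctured[OF that C] by simp
  have "partial i (partial i (\<lambda>x. s * \<phi> x)) x = 0" for i
    using partial_cong_punctured[OF x p] by simp
  then have "s * laplacian \<phi> x = 0" using l[OF x] by (simp add: laplacian_def)
  then show ?thesis using s(1) n2 sqnorm_pos[OF x] by (simp add: laplacian_\<phi>[OF x])
qed

text \<open>If c \<le> 0, the equation of \<open>q\<close> has a nonnegative right-hand side, so
  \<open>q\<close> is constant and (n - 3) f^2 = 2 c \<le> 0. If c > 0, a minimum m of f has f m
  \<le> 0 by \<open>f_constant_sign\<close>, whence H m > 0; but the equation of f gives -2 H m
  \<ge> 0 at a minimum.\<close>

lemma f_zero_dim4:
  assumes n: "CARD('n) \<ge> 4" and x: "x \<noteq> 0"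
  shows "f x = 0"
proof (cases "c \<le> 0")
  case True
  have "(real CARD('n) - 3) * (f x)\<^sup>2 \<ge> 2 * c" if "x \<noteq> 0" for x
    by (rule order_trans[of _ 0]) (use True n in auto)
  from q_const[OF this] obtain C where C: "\<And>x. x \<noteq> 0 \<Longrightarrow> q b\<^sub>n x = C" by auto
  have "(real CARD('n) - 3) * (f x)\<^sup>2 = 2 * c" by (rule q_const_imp[OF C x])
  then have "(real CARD('n) - 3) * (f x)\<^sup>2 \<le> 0" using True by linarith
  then show ?thesis using n by (simp add: mult_le_0_iff)
next
  case False
  have sub: "sphere (0 :: real^'n) 1 \<subseteq> punctured" by auto
  obtain m where m: "m \<in> sphere 0 1" "\<And>z. z \<in> sphere 0 1 \<Longrightarrow> f m \<le> f z"
    using continuous_attains_inf[of "sphere (0 :: real^'n) 1" f]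
      continuous_on_subset[OF smooth_on_continuous_on[OF smooth_f] sub] by auto
  have m0: "m \<noteq> 0" using m(1) by auto
  have min: "f m \<le> f z" if "z \<noteq> 0" for z
    using scaling_f[OF that, of "inverse (norm z)"] m(2)[of "inverse (norm z) *\<^sub>R z"] that by simp
  have fm: "f m \<le> 0"
  proof (rule ccontr)
    assume "\<not> f m \<le> 0"
    then have "\<forall>x. x \<noteq> 0 \<longrightarrow> f x \<ge> 0" using min by force
    then have "f m = 0" using f_constant_sign[OF _ m0] by blast
    then show False using \<open>\<not> f m \<le> 0\<close> by simp
  qed
  obtain r where r: "r > 0" "ball m r \<subseteq> punctured"
    using open_punctured m0 openE[of punctured m] by auto
  note crit = partial_local_max[OF smooth_on_minus[OF open_punctured smooth_f] r]
  have pm: "partial i (\<lambda>x. - f x) y = - partial i f y" if "y \<noteq> 0" for i y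
    by (rule partial_minus[OF df[OF that]])
  have dpf: "partial i f differentiable (at m)" for i
    using smooth_on_differentiable[OF smooth_on_partial[OF smooth_f]] m0 by simp
  have ppm: "partial i (partial i (\<lambda>x. - f x)) m = - partial i (partial i f) m" for i
    by (subst partial_cong_punctured[OF m0 pm]) (auto intro: partial_minus dpf)
  have le: "- f y \<le> - f m" if "y \<in> ball m r" for y
  proof -
    have "y \<in> punctured" using r(2) that by blast
    then show ?thesis using min[of y] by simp
  qed
  have "partial i f m = 0" "partial i (partial i f) m \<ge> 0" for i
    using crit[OF le, of i] by (auto simp: pm[OF m0] ppm)
  then have "laplacian f m - adv f m \<ge> 0" by (simp add: laplacian_def adv_def sum_nonneg)
  then have "(2 * c + (f m)\<^sup>2 - 2 * (real CARD('n) - 4) * f m) * inverse (sqnorm m) \<le> 0"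
    unfolding laplacian_f[OF m0] two_H[OF m0] by simp
  then have "2 * c + (f m)\<^sup>2 - 2 * (real CARD('n) - 4) * f m \<le> 0"
    using sqnorm_pos[OF m0] by (simp add: mult_le_0_iff)
  moreover have "(real CARD('n) - 4) * f m \<le> 0" using fm n by (intro mult_nonneg_nonpos) auto
  moreover have "(f m)\<^sup>2 \<ge> 0" by simp
  ultimately show ?thesis using False by linarith
qed

text \<open>The coefficient n - 3 vanishes, so the right-hand side of the equation for
  \<open>q\<close> is -2 c times a positive function, and \<open>q\<close> or its negative is a
  subsolution. A constant C \<le> 0 would mean f \<le> -2 everywhere, against
  \<open>f_constant_sign\<close>.\<close>

lemma liouville_dim3:
  assumes n: "CARD('n) = 3"
  shows "\<exists>C>0. \<forall>x. x \<noteq> 0 \<longrightarrow> f x + 2 = C * exp (\<phi> x)"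
proof -
  have "\<exists>C. \<forall>x. x \<noteq> 0 \<longrightarrow> q b\<^sub>n x = C"
    using q_const q_const' n by (cases "c \<le> 0") auto
  then obtain C where C: "\<And>x. x \<noteq> 0 \<Longrightarrow> q b\<^sub>n x = C" by blast
  have "b\<^sub>n = 2" using n by (simp add: b\<^sub>n_def)
  then have eq: "f x + 2 = C * exp (\<phi> x)" if "x \<noteq> 0" for x
    using C[OF that] by (simp add: q_def exp_minus field_simps)
  have "C > 0"
  proof (rule ccontr)
    assume "\<not> C > 0"
    then have neg: "f x \<le> - 2" if "x \<noteq> 0" for x
      using eq[OF that] by (smt (verit) exp_gt_zero mult_nonpos_nonneg)
    then have "\<forall>x. x \<noteq> 0 \<longrightarrow> f x \<le> 0" by force
    moreover obtain x0 :: "real^'n" where "x0 \<noteq> 0" by (metis zero_neq_one)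
    ultimately show False using f_constant_sign[of x0] neg[of x0] by simp
  qed
  then show ?thesis using eq by blast
qed

end

text \<open>With f = 0 the vorticity vanishes and the components of u are harmonic. Then r^2 |u|^2
  has degree 0 and Laplacian 2 r^2 |\<nabla>u|^2 + (2 n - 8) |u|^2, which is nonnegative for n \<ge>
  4. Constancy gives \<nabla>u = 0, and then degree -1 gives u = 0.\<close>

lemma zero_dim4:
  assumes n: "CARD('n) \<ge> 4" and x: "x \<noteq> 0"
  shows "U i x = 0"
proof -
  obtain \<phi> c where "smooth_on \<phi> punctured" "\<And>x i. x \<noteq> 0 \<Longrightarrow> partial i \<phi> x = W i x" "\<And>x. x \<noteq> 0 \<Longrightarrow> G x = c"
    using potential_exists by blast
  note f0 = f_zero_dim4[OF this n]
  have pf: "partial i f x = 0" if "x \<noteq> 0" for i x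
    using partial_cong_punctured[OF that f0] by simp
  have w0: "\<omega> i j x = 0" if "x \<noteq> 0" for i j x
    using G_const_and_vorticity pf[OF that] that sqnorm_pos[OF that] by force
  have lU: "laplacian (U i) x = 0" if "x \<noteq> 0" for i x
    using laplacian_U_\<omega>[OF that, of i] partial_cong_punctured[OF that w0] by simp
  define P where "P x = (\<Sum>i\<in>UNIV. U i x * U i x)" for x
  have smUU: "smooth_on (\<lambda>x. U i x * U i x) punctured" for i
    by (intro smooth_on_mult smooth_U open_punctured)
  have smP: "smooth_on P punctured"
    unfolding P_def[abs_def] by (intro smooth_on_sum smUU open_punctured) auto
  have smV: "smooth_on (\<lambda>x. sqnorm x * P x) punctured"
    by (intro smooth_on_mult smooth_on_sqnorm smP open_punctured)
  have lP: "laplacian P x = 2 * (\<Sum>i\<in>UNIV. grad_inner (U i) (U i) x)" if x: "x \<noteq> 0" for x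
  proof -
    have xS: "x \<in> punctured" using x by simp
    have "laplacian P x = (\<Sum>i\<in>UNIV. laplacian (\<lambda>x. U i x * U i x) x)"
      unfolding P_def[abs_def] by (intro laplacian_sum[OF open_punctured _ _ xS] smUU) auto
    then show ?thesis
      by (simp add: laplacian_mult[OF open_punctured smooth_U smooth_U xS] lU[OF x] sum_distrib_left)
  qed
  have eP: "grad_inner sqnorm P x = - 4 * P x" if x: "x \<noteq> 0" for x
  proof -
    have "partial i P x = (\<Sum>j\<in>UNIV. partial i (\<lambda>x. U j x * U j x) x)" for i
      unfolding P_def[abs_def] by (rule partial_sum) (simp add: x)
    then have pP: "partial i P x = (\<Sum>j\<in>UNIV. 2 * (U j x * partial i (U j) x))" for i
      by (simp add: partial_mult x mult.commute)
    have "grad_inner sqnorm P x = (\<Sum>i\<in>UNIV. \<Sum>j\<in>UNIV. 4 * U j x * (x $ i * partial i (U j) x))"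
      by (simp add: grad_inner_def partial_sqnorm pP sum_distrib_left mult_ac)
    also have "\<dots> = (\<Sum>j\<in>UNIV. 4 * U j x * (\<Sum>i\<in>UNIV. x $ i * partial i (U j) x))"
      by (subst sum.swap) (simp add: sum_distrib_left)
    finally show ?thesis by (simp add: euler_U[OF x] P_def sum_negf sum_distrib_left mult_ac)
  qed
  have lV: "laplacian (\<lambda>x. sqnorm x * P x) x
    = 2 * sqnorm x * (\<Sum>i\<in>UNIV. grad_inner (U i) (U i) x) + (2 * real CARD('n) - 8) * P x" if x: "x \<noteq> 0" for x
    using x by (subst laplacian_mult[OF open_punctured smooth_on_sqnorm smP])
      (simp_all add: lP eP laplacian_sqnorm algebra_simps)
  have gn: "(\<Sum>i\<in>UNIV. grad_inner (U i) (U i) x) \<ge> 0" for x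
    unfolding grad_inner_def by (intro sum_nonneg) simp
  have Pn: "(2 * real CARD('n) - 8) * P x \<ge> 0" for x
  proof -
    have "P x \<ge> 0" unfolding P_def by (intro sum_nonneg) simp
    then show ?thesis using n by simp
  qed
  have "\<exists>C. \<forall>x. x \<noteq> 0 \<longrightarrow> sqnorm x * P x = C"
  proof (rule homogeneous_strong_maximum[OF _ smV, where b = "\<lambda>i x. 0"])
    show "sqnorm (l *\<^sub>R x) * P (l *\<^sub>R x) = sqnorm x * P x" if "x \<noteq> 0" "l > 0" for x l
      using that by (simp add: P_def scaling_U[OF that] sqnorm_def sum_distrib_left sum_distrib_right mult_ac)
    show "(\<Sum>i\<in>UNIV. partial i (partial i (\<lambda>x. sqnorm x * P x)) x) + (\<Sum>i\<in>UNIV. 0 * partial i (\<lambda>x. sqnorm x * P x) x) \<ge> 0"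
      if "x \<noteq> 0" for x
      using lV[OF that] gn[of x] Pn[of x] sqnorm_pos[OF that] by (simp add: laplacian_def)
  qed (use n in auto)
  then obtain C where C: "\<And>x. x \<noteq> 0 \<Longrightarrow> sqnorm x * P x = C" by blast
  have p: "partial i (\<lambda>x. sqnorm x * P x) y = 0" if "y \<noteq> 0" for i y
    using partial_cong_punctured[OF that C] by simp
  have "partial i (partial i (\<lambda>x. sqnorm x * P x)) x = 0" for i
    using partial_cong_punctured[OF x p] by simp
  then have "laplacian (\<lambda>x. sqnorm x * P x) x = 0" by (simp add: laplacian_def)
  then have "2 * sqnorm x * (\<Sum>i\<in>UNIV. grad_inner (U i) (U i) x) \<le> 0"
    using lV[OF x] Pn[of x] by linarith
  then have "(\<Sum>i\<in>UNIV. grad_inner (U i) (U i) x) = 0"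
    using gn[of x] sqnorm_pos[OF x] by (simp add: mult_le_0_iff)
  then have "grad_inner (U i) (U i) x = 0"
    by (subst (asm) sum_nonneg_eq_0_iff) (auto simp: grad_inner_def intro!: sum_nonneg)
  then have "partial j (U i) x = 0" for j
    unfolding grad_inner_def by (subst (asm) sum_nonneg_eq_0_iff) auto
  then show ?thesis using euler_U[OF x, of i] by simp
qed

end

section \<open>Liouville equation and Landau solutions\<close>

lemma smooth_on_from_partials:
  assumes "open S" "\<And>x. x \<in> S \<Longrightarrow> f differentiable (at x)"
    and "\<And>i x. x \<in> S \<Longrightarrow> partial i f x = g i x" "\<And>i. smooth_on (g i) S"
  shows "smooth_on f S"
proof -
  have "smooth_on (partial i f) S" for i
    by (rule smooth_on_cong[OF assms(1) _ assms(4)[of i]]) (simp add: assms(3))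
  then show ?thesis using assms(2) by (simp add: smooth_on_rec[of f])
qed

text \<open>The logarithm of |x|, written with a polynomial inside. The derivatives of the norm
  follow from it by the rules for exponentials.\<close>

definition lognorm :: "real^'n \<Rightarrow> real" where "lognorm x = (1/2) * ln (sqnorm x)"

lemma exp_lognorm: "x \<noteq> 0 \<Longrightarrow> exp (lognorm x) = norm x"
  by (simp add: lognorm_def sqnorm_norm ln_realpow)

lemma differentiable_ln_sqnorm:
  "x \<noteq> 0 \<Longrightarrow> (\<lambda>x. ln (sqnorm x)) differentiable (at x)"
  using differentiable_compose_real[OF smooth_on_differentiable[OF smooth_on_sqnorm] DERIV_ln] sqnorm_pos
  by blast

lemma partial_lognorm:
  assumes x: "x \<noteq> 0"
  shows "partial i lognorm x = x $ i * inverse (sqnorm x)"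
proof -
  have "partial i (\<lambda>x. ln (sqnorm x)) x = inverse (sqnorm x) * partial i sqnorm x"
    using x by (intro partial_compose_real[OF smooth_on_differentiable[OF smooth_on_sqnorm] DERIV_ln] sqnorm_pos) auto
  then show ?thesis
    unfolding lognorm_def[abs_def]
    by (subst partial_cmult[OF differentiable_ln_sqnorm[OF x]]) (simp add: partial_sqnorm)
qed

lemma smooth_lognorm: "smooth_on lognorm (punctured :: (real^'n) set)"
proof (rule smooth_on_from_partials[OF open_punctured _ partial_lognorm smooth_on_coord_over_sqnorm])
  show "lognorm differentiable (at x)" if "x \<in> punctured" for x :: "real^'n"
    unfolding lognorm_def[abs_def]
    by (intro differentiable_mult differentiable_const differentiable_ln_sqnorm) (use that in simp)
qed simp

lemma laplacian_lognorm:
  assumes x: "x \<noteq> 0"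
  shows "laplacian lognorm (x :: real^'n) = (real CARD('n) - 2) * inverse (sqnorm x)"
proof -
  have "partial i (partial i lognorm) x = partial i (\<lambda>x. x $ i * inverse (sqnorm x)) x" for i
    by (rule partial_cong_punctured[OF x partial_lognorm])
  then show ?thesis by (simp add: laplacian_def div_coord_over_sqnorm[OF x])
qed

lemma smooth_norm: "smooth_on norm (punctured :: (real^'n) set)"
  by (rule smooth_on_cong[OF open_punctured _ smooth_on_exp[OF open_punctured smooth_lognorm]])
     (simp add: exp_lognorm)

lemma partial_norm:
  assumes x: "x \<noteq> 0"
  shows "partial i norm (x :: real^'n) = x $ i / norm x"
proof -
  have d: "lognorm differentiable (at x)" using smooth_on_differentiable[OF smooth_lognorm] x by simp
  have "partial i norm x = partial i (\<lambda>x. exp (lognorm x)) x"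
    by (rule partial_cong_punctured[OF x]) (simp add: exp_lognorm)
  also have "\<dots> = norm x * (x $ i * inverse (sqnorm x))"
    by (subst partial_compose_real[OF d DERIV_exp]) (simp add: partial_lognorm[OF x] exp_lognorm[OF x])
  finally show ?thesis using x by (simp add: sqnorm_norm power2_eq_square field_simps)
qed

lemma laplacian_norm:
  assumes x: "x \<noteq> 0"
  shows "laplacian norm (x :: real^'n) = (real CARD('n) - 1) / norm x"
proof -
  have xS: "x \<in> punctured" using x by simp
  have g: "grad_inner lognorm lognorm x = inverse (sqnorm x)"
  proof -
    have "grad_inner lognorm lognorm x = (\<Sum>i\<in>UNIV. (x $ i * x $ i) * (inverse (sqnorm x))\<^sup>2)"
      by (simp add: grad_inner_def partial_lognorm[OF x] power2_eq_square mult_ac)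
    also have "\<dots> = sqnorm x * (inverse (sqnorm x))\<^sup>2"
      by (simp add: sqnorm_def sum_distrib_right)
    finally show ?thesis using sqnorm_pos[OF x] by (simp add: power2_eq_square)
  qed
  have "laplacian norm x = laplacian (\<lambda>x. exp (lognorm x)) x"
    by (rule laplacian_cong[OF open_punctured xS]) (simp add: exp_lognorm)
  also have "\<dots> = norm x * ((real CARD('n) - 2) * inverse (sqnorm x) + inverse (sqnorm x))"
    by (subst laplacian_exp[OF open_punctured smooth_lognorm xS])
       (simp only: exp_lognorm[OF x] laplacian_lognorm[OF x] g)
  also have "\<dots> = (real CARD('n) - 1) * (norm x * inverse (sqnorm x))" by (simp add: algebra_simps)
  also have "norm x * inverse (sqnorm x) = 1 / norm x"
    using x by (simp add: sqnorm_norm power2_eq_square field_simps)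
  finally show ?thesis by simp
qed

lemma laplacian_partial:
  fixes f :: "real^'n \<Rightarrow> real"
  assumes f: "smooth_on f S" and S: "open S" "x \<in> S"
  shows "laplacian (partial j f) x = partial j (laplacian f) x"
proof -
  have "partial i (partial i (partial j f)) x = partial j (partial i (partial i f)) x" for i
  proof -
    have "partial i (partial i (partial j f)) x = partial i (partial j (partial i f)) x"
      by (rule partial_cong[OF S]) (rule partial_commute[OF f S(1)])
    also have "\<dots> = partial j (partial i (partial i f)) x"
      by (rule partial_commute[OF smooth_on_partial[OF f] S])
    finally show ?thesis .
  qed
  moreover have "partial j (laplacian f) x = (\<Sum>i\<in>UNIV. partial j (partial i (partial i f)) x)"
    unfolding laplacian_def[abs_def]
    by (intro partial_sum smooth_on_differentiable[OF smooth_on_partial[OF smooth_on_partial[OF f]] S(2)])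
  ultimately show ?thesis by (simp add: laplacian_def)
qed

text \<open>A symmetric matrix annihilating \<open>x\<close> lives on a plane, where \<open>|B|\<^sup>2 \<ge> (tr B)\<^sup>2 / 2\<close>.\<close>

lemma tangential_matrix_decomposition:
  fixes B :: "'n::finite \<Rightarrow> 'n \<Rightarrow> real" and x :: "'n \<Rightarrow> real"
  assumes n: "CARD('n) = 3"
    and rad: "\<And>i. (\<Sum>j\<in>UNIV. x j * B i j) = 0"
    and s: "s = (\<Sum>i\<in>UNIV. x i * x i)" and m: "m = (\<Sum>i\<in>UNIV. B i i)"
  shows "(\<Sum>i\<in>UNIV. \<Sum>j\<in>UNIV. (s * B i j - m / 2 * ((if i = j then s else 0) - x i * x j))\<^sup>2)
    = s\<^sup>2 * ((\<Sum>i\<in>UNIV. \<Sum>j\<in>UNIV. (B i j)\<^sup>2) - m\<^sup>2 / 2)"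
proof -
  \<comment> \<open>\<open>D\<close> is s times the identity, so (D - x x^T)/s projects onto the
    plane orthogonal to x. Subtracting m/2 times this projection from B removes the trace.\<close>
  define D where "D i j = (if i = j then s else 0)" for i j :: 'n
  have DD: "(\<Sum>i\<in>UNIV. \<Sum>j\<in>UNIV. D i j * D i j) = 3 * s\<^sup>2"
    using n by (simp add: D_def if_distrib[of "\<lambda>c. c * _"] power2_eq_square cong: if_cong)
  have Dx: "(\<Sum>i\<in>UNIV. \<Sum>j\<in>UNIV. D i j * (x i * x j)) = s * s"
    by (simp add: D_def if_distrib[of "\<lambda>c. c * _"] s sum_distrib_left cong: if_cong)
  have DB: "(\<Sum>i\<in>UNIV. \<Sum>j\<in>UNIV. B i j * D i j) = s * m"
    by (simp add: D_def if_distrib[of "\<lambda>c. _ * c"] m sum_distrib_left mult.commute cong: if_cong)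
  have Bx: "(\<Sum>i\<in>UNIV. \<Sum>j\<in>UNIV. B i j * (x i * x j)) = 0"
  proof -
    have "(\<Sum>i\<in>UNIV. \<Sum>j\<in>UNIV. B i j * (x i * x j)) = (\<Sum>i\<in>UNIV. x i * (\<Sum>j\<in>UNIV. x j * B i j))"
      by (simp add: sum_distrib_left mult_ac)
    then show ?thesis by (simp add: rad)
  qed
  have xx: "(\<Sum>i\<in>UNIV. \<Sum>j\<in>UNIV. (x i * x j) * (x i * x j)) = s * s"
    unfolding s sum_product by (simp add: mult_ac)
  have "(s * B i j - m / 2 * (D i j - x i * x j))\<^sup>2 = s\<^sup>2 * (B i j)\<^sup>2 - s * m * (B i j * D i j)
    + s * m * (B i j * (x i * x j)) + m\<^sup>2 / 4 * (D i j * D i j) - m\<^sup>2 / 2 * (D i j * (x i * x j))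
    + m\<^sup>2 / 4 * ((x i * x j) * (x i * x j))" for i j
    by (simp add: power2_eq_square field_simps)
  then have "(\<Sum>i\<in>UNIV. \<Sum>j\<in>UNIV. (s * B i j - m / 2 * (D i j - x i * x j))\<^sup>2)
    = s\<^sup>2 * (\<Sum>i\<in>UNIV. \<Sum>j\<in>UNIV. (B i j)\<^sup>2) - s * m * (s * m) + s * m * 0 + m\<^sup>2 / 4 * (3 * s\<^sup>2)
    - m\<^sup>2 / 2 * (s * s) + m\<^sup>2 / 4 * (s * s)"
    by (simp only: sum.distrib sum_subtractf sum_distrib_left[symmetric] DD Dx DB Bx xx)
  then show ?thesis
    unfolding D_def by (simp add: power2_eq_square field_simps)
qed

text \<open>The Hessian B of \<Psi> annihilates x because \<Psi> has degree 1, so it acts on a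
  plane, and the trace inequality there gives the sign of the Laplacian of M. Equality makes B a
  multiple of the projection onto the plane, as for a multiple of r.\<close>

theorem liouville_rigidity:
  fixes \<Psi> :: "real^'n \<Rightarrow> real"
  assumes n: "CARD('n) = 3" and smooth: "smooth_on \<Psi> punctured"
    and pos: "\<And>x. x \<noteq> 0 \<Longrightarrow> \<Psi> x > 0"
    and euler: "\<And>x. x \<noteq> 0 \<Longrightarrow> (\<Sum>i\<in>UNIV. x $ i * partial i \<Psi> x) = \<Psi> x"
    and eq: "\<And>x. x \<noteq> 0 \<Longrightarrow> \<Psi> x * laplacian \<Psi> x = 1 + grad_inner \<Psi> \<Psi> x"
  shows "\<exists>a e. a > 0 \<and> a\<^sup>2 = 1 + e \<bullet> e
    \<and> (\<forall>x. x \<noteq> 0 \<longrightarrow> \<Psi> x = a * norm x - e \<bullet> x \<and> (\<forall>i. partial i \<Psi> x = a * x $ i / norm x - e $ i))"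
proof -
  note op = open_punctured
  define M where "M = laplacian \<Psi>"
  note sP = smooth_on_partial[OF smooth]
  have sM: "smooth_on M punctured" unfolding M_def by (rule smooth_on_laplacian[OF op smooth])
  have d: "g differentiable (at x)" if "smooth_on g punctured" "x \<noteq> 0" for g :: "real^'n \<Rightarrow> real" and x
    using smooth_on_differentiable[OF that(1)] that(2) by simp
  have radial: "(\<Sum>j\<in>UNIV. x $ j * partial i (partial j \<Psi>) x) = 0" if x: "x \<noteq> 0" for x i
  proof -
    have "partial i \<Psi> x = partial i (\<lambda>x. \<Sum>j\<in>UNIV. x $ j * partial j \<Psi> x) x"
      by (rule partial_cong_punctured[OF x]) (simp add: euler)
    also have "\<dots> = (\<Sum>j\<in>UNIV. partial i (\<lambda>x. x $ j * partial j \<Psi> x) x)"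
      by (rule partial_sum) (simp add: differentiable_coord d[OF sP x])
    also have "\<dots> = (\<Sum>j\<in>UNIV. x $ j * partial i (partial j \<Psi>) x + (if i = j then partial j \<Psi> x else 0))"
      by (intro sum.cong refl) (auto simp: partial_mult differentiable_coord partial_coord d[OF sP x])
    finally show ?thesis by (simp add: sum.distrib)
  qed
  have eulerM: "(\<Sum>j\<in>UNIV. x $ j * partial j M x) = - M x" if x: "x \<noteq> 0" for x
  proof -
    have xS: "x \<in> punctured" using x by simp
    have sm: "smooth_on (\<lambda>x. x $ j * partial j \<Psi> x) punctured" for j
      by (intro smooth_on_mult smooth_on_coord sP op)
    have "M x = laplacian (\<lambda>x. \<Sum>j\<in>UNIV. x $ j * partial j \<Psi> x) x"
      unfolding M_def by (rule laplacian_cong[OF op xS]) (simp add: euler)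
    also have "\<dots> = (\<Sum>j\<in>UNIV. laplacian (\<lambda>x. x $ j * partial j \<Psi> x) x)"
      by (intro laplacian_sum[OF op _ _ xS] sm) auto
    also have "\<dots> = (\<Sum>j\<in>UNIV. x $ j * partial j M x + 2 * partial j (partial j \<Psi>) x)"
      by (intro sum.cong refl)
        (simp add: laplacian_mult[OF op smooth_on_coord sP xS] laplacian_coord laplacian_partial[OF smooth op xS] M_def
          grad_inner_def partial_coord if_distrib[of "\<lambda>c. c * _"] cong: if_cong)
    also have "\<dots> = (\<Sum>j\<in>UNIV. x $ j * partial j M x) + 2 * M x"
      by (simp add: sum.distrib M_def laplacian_def sum_distrib_left)
    finally show ?thesis by simp
  qed
  define B where "B x i j = partial i (partial j \<Psi>) x" for x i j
  define T where "T x i j = sqnorm x * B x i j - M x / 2 * ((if i = j then sqnorm x else 0) - x $ i * x $ j)" for x i j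
  have BT: "(\<Sum>i\<in>UNIV. \<Sum>j\<in>UNIV. (T x i j)\<^sup>2) = (sqnorm x)\<^sup>2 * ((\<Sum>i\<in>UNIV. \<Sum>j\<in>UNIV. (B x i j)\<^sup>2) - (M x)\<^sup>2 / 2)"
    if x: "x \<noteq> 0" for x
    unfolding T_def
    by (rule tangential_matrix_decomposition[OF n]) (auto simp: B_def radial[OF x] sqnorm_def M_def laplacian_def)
  \<comment> \<open>A Bochner identity: the Laplacian is taken of both sides of the equation for
    \<Psi>, and the terms 2 \<nabla>\<Psi> . \<nabla>M cancel.\<close>
  have LM: "\<Psi> x * laplacian M x = 2 * (\<Sum>i\<in>UNIV. \<Sum>j\<in>UNIV. (B x i j)\<^sup>2) - (M x)\<^sup>2" if x: "x \<noteq> 0" for x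
  proof -
    have xS: "x \<in> punctured" using x by simp
    have sm: "smooth_on (\<lambda>x. partial j \<Psi> x * partial j \<Psi> x) punctured" for j
      by (intro smooth_on_mult sP op)
    have sms: "smooth_on (\<lambda>x. \<Sum>j\<in>UNIV. partial j \<Psi> x * partial j \<Psi> x) punctured"
      by (intro smooth_on_sum sm op) auto
    have "laplacian (\<lambda>x. \<Psi> x * M x) x = laplacian (\<lambda>x. 1 + (\<Sum>j\<in>UNIV. partial j \<Psi> x * partial j \<Psi> x)) x"
      by (rule laplacian_cong[OF op xS]) (use eq in \<open>simp add: M_def grad_inner_def\<close>)
    also have "\<dots> = (\<Sum>j\<in>UNIV. laplacian (\<lambda>x. partial j \<Psi> x * partial j \<Psi> x) x)"
      by (subst laplacian_add[OF op smooth_on_const sms xS])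
         (simp add: laplacian_const laplacian_sum[OF op _ sm xS])
    also have "\<dots> = (\<Sum>j\<in>UNIV. 2 * (partial j \<Psi> x * partial j M x) + 2 * grad_inner (partial j \<Psi>) (partial j \<Psi>) x)"
      by (intro sum.cong refl)
         (simp add: laplacian_mult[OF op sP sP xS] laplacian_partial[OF smooth op xS] M_def)
    also have "\<dots> = 2 * grad_inner \<Psi> M x + 2 * (\<Sum>j\<in>UNIV. \<Sum>i\<in>UNIV. (B x i j)\<^sup>2)"
      by (simp add: sum.distrib sum_distrib_left grad_inner_def B_def power2_eq_square)
    finally show ?thesis
      unfolding laplacian_mult[OF op smooth sM xS]
      by (simp add: M_def power2_eq_square) (subst sum.swap, simp)
  qed
  have LM0: "laplacian M x = 2 * (\<Sum>i\<in>UNIV. \<Sum>j\<in>UNIV. (T x i j)\<^sup>2) / ((sqnorm x)\<^sup>2 * \<Psi> x)" if x: "x \<noteq> 0" for x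
  proof -
    have "(sqnorm x)\<^sup>2 * (\<Psi> x * laplacian M x) = 2 * (\<Sum>i\<in>UNIV. \<Sum>j\<in>UNIV. (T x i j)\<^sup>2)"
      unfolding LM[OF x] BT[OF x] by (simp add: algebra_simps)
    then show ?thesis using pos[OF x] sqnorm_pos[OF x] by (simp add: field_simps)
  qed
  \<comment> \<open>M has degree -1, so r M has degree 0. In dimension 3 the terms M \<Delta>r = 2
    M/r and 2 \<nabla>r . \<nabla>M = -2 M/r cancel, and r M is subharmonic along with M.\<close>
  define K where "K x = norm x * M x" for x
  have sK: "smooth_on K punctured" unfolding K_def[abs_def] by (intro smooth_on_mult smooth_norm sM op)
  have gnM: "grad_inner norm M x = - M x / norm x" if x: "x \<noteq> 0" for x
    using eulerM[OF x] by (simp add: grad_inner_def partial_norm[OF x] flip: sum_divide_distrib)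
  have LK: "laplacian K x = norm x * laplacian M x" if x: "x \<noteq> 0" for x
  proof -
    have xS: "x \<in> punctured" using x by simp
    show ?thesis unfolding K_def[abs_def]
      by (subst laplacian_mult[OF op smooth_norm sM xS]) (simp add: laplacian_norm[OF x] gnM[OF x] n)
  qed
  have "\<exists>c. \<forall>x. x \<noteq> 0 \<longrightarrow> K x = c"
  proof (rule homogeneous_strong_maximum[OF _ sK, where b = "\<lambda>i x. 0"])
    show "K (l *\<^sub>R x) = K x" if "x \<noteq> 0" "l > 0" for x l
    proof (rule radial_constant[OF sK _ that])
      fix x :: "real^'n" assume x: "x \<noteq> 0"
      have "partial i K x = norm x * partial i M x + x $ i / norm x * M x" for i
        unfolding K_def[abs_def]
        by (subst partial_mult[OF d[OF smooth_norm x] d[OF sM x]]) (simp add: partial_norm[OF x])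
      then have "(\<Sum>i\<in>UNIV. x $ i * partial i K x)
        = norm x * (\<Sum>i\<in>UNIV. x $ i * partial i M x) + sqnorm x / norm x * M x"
        by (simp add: sqnorm_def sum_distrib_left sum_distrib_right sum_divide_distrib sum.distrib algebra_simps)
      then show "(\<Sum>i\<in>UNIV. x $ i * partial i K x) = 0"
        using x by (simp add: eulerM[OF x] sqnorm_norm power2_eq_square)
    qed
    fix x :: "real^'n" assume x: "x \<noteq> 0"
    have "laplacian K x \<ge> 0"
      unfolding LK[OF x] LM0[OF x] using pos[OF x] by (intro mult_nonneg_nonneg divide_nonneg_nonneg sum_nonneg) auto
    then show "(\<Sum>i\<in>UNIV. partial i (partial i K) x) + (\<Sum>i\<in>UNIV. 0 * partial i K x) \<ge> 0"
      by (simp add: laplacian_def)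
  qed (use n in auto)
  then obtain k where k: "\<And>x. x \<noteq> 0 \<Longrightarrow> K x = k" by blast
  \<comment> \<open>The Laplacian of a r in dimension 3 is 2 a/r.\<close>
  define a where "a = k / 2"
  have Ma: "M x = 2 * a / norm x" if "x \<noteq> 0" for x
    using k[OF that] that by (simp add: K_def a_def field_simps)
  have T0: "T x i j = 0" if x: "x \<noteq> 0" for x i j
  proof -
    have p: "partial i K y = 0" if "y \<noteq> 0" for i y
      using partial_cong_punctured[OF that k] by simp
    have "partial i (partial i K) x = 0" for i
      using partial_cong_punctured[OF x p] by simp
    then have "laplacian K x = 0" by (simp add: laplacian_def)
    then have "(\<Sum>i\<in>UNIV. \<Sum>j\<in>UNIV. (T x i j)\<^sup>2) = 0"
      using LK[OF x] LM0[OF x] x pos[OF x] sqnorm_pos[OF x] by simp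
    then show ?thesis by (simp add: sum_nonneg_eq_0_iff sum_nonneg)
  qed
  \<comment> \<open>The vanishing of \<open>T\<close> says that \<Psi> and a r have the same
    Hessian, so the gradient of their difference is constant.\<close>
  have "\<exists>c. \<forall>x. x \<noteq> 0 \<longrightarrow> partial j \<Psi> x - a * (x $ j * inverse (norm x)) = c" for j
  proof -
    define g where "g x = partial j \<Psi> x - a * (x $ j * inverse (norm x))" for x
    have si: "smooth_on (\<lambda>x. inverse (norm x)) (punctured :: (real^'n) set)"
      by (intro smooth_on_inverse smooth_norm op) auto
    have smi: "smooth_on (\<lambda>x. x $ j * inverse (norm x)) punctured"
      by (intro smooth_on_mult smooth_on_coord si op)
    have sg: "smooth_on g punctured"
      unfolding g_def[abs_def] by (intro smooth_on_diff smooth_on_mult smooth_on_const smi sP op)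
    have pg: "partial i g x = 0" if x: "x \<noteq> 0" for i x
    proof -
      have pinv: "partial i (\<lambda>x. inverse (norm x)) x = - (x $ i) / norm x ^ 3"
        by (subst partial_compose_real[OF d[OF smooth_norm x] DERIV_inverse])
           (use x in \<open>simp_all add: partial_norm[OF x] power2_eq_square power3_eq_cube field_simps numeral_2_eq_2\<close>)
      have p1: "partial i g x = B x i j - a * (x $ j * (- (x $ i) / norm x ^ 3) + (if i = j then 1 else 0) * inverse (norm x))"
        unfolding g_def[abs_def] B_def
        by (subst partial_diff[OF d[OF sP x] differentiable_mult[OF differentiable_const d[OF smi x]]],
            subst partial_cmult[OF d[OF smi x]],
            subst partial_mult[OF differentiable_coord d[OF si x]])
          (simp only: pinv partial_coord)
      have "(norm x)\<^sup>2 * B x i j = a / norm x * ((if i = j then (norm x)\<^sup>2 else 0) - x $ i * x $ j)"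
        using T0[OF x, of i j] by (simp add: T_def Ma[OF x] sqnorm_norm)
      then have "B x i j = a / norm x ^ 3 * ((if i = j then (norm x)\<^sup>2 else 0) - x $ i * x $ j)"
        using x by (simp add: field_simps power2_eq_square power3_eq_cube)
      then show ?thesis unfolding p1
        using x by (simp add: field_simps power2_eq_square power3_eq_cube)
    qed
    have con: "connected (punctured :: (real^'n) set)"
      using connected_punctured_universe[of "0 :: real^'n"] n by (simp add: Compl_eq_Diff_UNIV)
    have "g constant_on punctured"
    proof (rule has_derivative_zero_connected_constant_on[OF con op finite.emptyI smooth_on_continuous_on[OF sg]], rule ballI)
      fix x :: "real^'n" assume "x \<in> punctured - {}"
      then have x: "x \<noteq> 0" by simp
      show "(g has_derivative (\<lambda>h. 0)) (at x within punctured)"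
        using has_derivative_at_withinI[OF has_derivative_partial[OF d[OF sg x]]] pg[OF x] by simp
    qed
    then show ?thesis unfolding g_def constant_on_def by auto
  qed
  then obtain e' where e': "\<And>j x. x \<noteq> 0 \<Longrightarrow> partial j \<Psi> x - a * (x $ j * inverse (norm x)) = e' j"
    by metis
  define e where "e = (\<chi> j. - e' j)"
  have pP: "partial i \<Psi> x = a * x $ i / norm x - e $ i" if "x \<noteq> 0" for x i
    using e'[OF that, of i] by (simp add: e_def field_simps)
  have P: "\<Psi> x = a * norm x - e \<bullet> x" if x: "x \<noteq> 0" for x
  proof -
    have "\<Psi> x = (\<Sum>i\<in>UNIV. a / norm x * (x $ i * x $ i) - e $ i * x $ i)"
      unfolding euler[OF x, symmetric] pP[OF x] by (simp add: algebra_simps)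
    also have "\<dots> = a / norm x * sqnorm x - e \<bullet> x"
      by (simp add: sum_subtractf sum_distrib_left sqnorm_def inner_vec_def)
    finally show ?thesis using x by (simp add: sqnorm_norm power2_eq_square)
  qed
  \<comment> \<open>The differential equation at a single point determines a^2 - e . e, and its
    positive right-hand side the sign of a.\<close>
  obtain x0 :: "real^'n" where x0: "x0 \<noteq> 0" by (metis zero_neq_one)
  have gn: "grad_inner \<Psi> \<Psi> x0 = a\<^sup>2 - 2 * a * (e \<bullet> x0) / norm x0 + e \<bullet> e"
  proof -
    have "grad_inner \<Psi> \<Psi> x0 = (\<Sum>i\<in>UNIV. (a / norm x0)\<^sup>2 * (x0 $ i * x0 $ i) - 2 * a / norm x0 * (e $ i * x0 $ i) + e $ i * e $ i)"
      unfolding grad_inner_def pP[OF x0]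
      by (intro sum.cong refl) (simp add: power2_eq_square algebra_simps)
    also have "\<dots> = (a / norm x0)\<^sup>2 * sqnorm x0 - 2 * a / norm x0 * (e \<bullet> x0) + e \<bullet> e"
      by (simp add: sum_subtractf sum.distrib sum_distrib_left sqnorm_def inner_vec_def)
    finally show ?thesis using x0 by (simp add: sqnorm_norm power_divide)
  qed
  have e0: "\<Psi> x0 * M x0 = 1 + grad_inner \<Psi> \<Psi> x0" using eq[OF x0] by (simp add: M_def)
  have "grad_inner \<Psi> \<Psi> x0 \<ge> 0" unfolding grad_inner_def by (intro sum_nonneg) simp
  then have "\<Psi> x0 * M x0 > 0" using e0 by linarith
  then have "M x0 > 0" using pos[OF x0] by (simp add: zero_less_mult_iff)
  then have a0: "a > 0" using Ma[OF x0] x0 by (simp add: zero_less_divide_iff)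
  have "\<Psi> x0 * M x0 = 2 * a\<^sup>2 - 2 * a * (e \<bullet> x0) / norm x0"
    using x0 by (simp add: P[OF x0] Ma[OF x0] power2_eq_square field_simps)
  then have "a\<^sup>2 = 1 + e \<bullet> e" using e0 gn by linarith
  then show ?thesis using a0 P pP by blast
qed

context homogeneous_navier_stokes
begin

text \<open>With \<Psi> = a r - e . x the formula reads u = 2 x/\<Psi>^2 - 2 \<nabla>\<Psi>/\<Psi>,
  in which a Landau field can be recognised.\<close>

theorem velocity_dim3:
  assumes n: "CARD('n) = 3"
  shows "\<exists>a e. a > 0 \<and> a\<^sup>2 = 1 + e \<bullet> e \<and> (\<forall>x i. x \<noteq> 0 \<longrightarrow> a * norm x - e \<bullet> x > 0 \<and>
    U i x = 2 * x $ i / (a * norm x - e \<bullet> x)\<^sup>2 - 2 * (a * x $ i / norm x - e $ i) / (a * norm x - e \<bullet> x))"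
proof -
  note op = open_punctured
  obtain \<phi> c where s\<phi>: "smooth_on \<phi> punctured" and p\<phi>: "\<And>x i. x \<noteq> 0 \<Longrightarrow> partial i \<phi> x = W i x"
    and G: "\<And>x. x \<noteq> 0 \<Longrightarrow> G x = c"
    using potential_exists by blast
  obtain C where C: "C > 0" "\<And>x. x \<noteq> 0 \<Longrightarrow> f x + 2 = C * exp (\<phi> x)"
    using liouville_dim3[OF s\<phi> p\<phi> G n] by blast
  \<comment> \<open>This makes exp(2 k) = 2/C, which absorbs the constant of the Liouville relation:
    \<Psi>^2 (f + 2) = 2 r^2.\<close>
  define k where "k = - ln (C / 2) / 2"
  define \<kappa> where "\<kappa> x = lognorm x + ((- 1 / 2) * \<phi> x + k)" for x
  define \<Psi> where "\<Psi> x = exp (\<kappa> x)" for x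
  have sm2: "smooth_on (\<lambda>x. (- 1 / 2) * \<phi> x) punctured" "smooth_on (\<lambda>x. (- 1 / 2) * \<phi> x + k) punctured"
    by (intro smooth_on_add smooth_on_mult smooth_on_const s\<phi> op)+
  have s\<kappa>: "smooth_on \<kappa> punctured"
    unfolding \<kappa>_def[abs_def] by (intro smooth_on_add smooth_lognorm sm2 op)
  have s\<Psi>: "smooth_on \<Psi> punctured" unfolding \<Psi>_def[abs_def] by (intro smooth_on_exp s\<kappa> op)
  have d: "g differentiable (at x)" if "smooth_on g punctured" "x \<noteq> 0" for g :: "real^'n \<Rightarrow> real" and x
    using smooth_on_differentiable[OF that(1)] that(2) by simp
  have p\<kappa>: "partial i \<kappa> x = x $ i * inverse (sqnorm x) - W i x / 2" if x: "x \<noteq> 0" for i x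
    unfolding \<kappa>_def[abs_def]
    by (subst partial_add[OF d[OF smooth_lognorm x] d[OF sm2(2) x]],
        subst partial_add[OF d[OF sm2(1) x] differentiable_const],
        subst partial_cmult[OF d[OF s\<phi> x]])
      (simp add: partial_lognorm[OF x] p\<phi>[OF x])
  have p\<Psi>: "partial i \<Psi> x = \<Psi> x * (x $ i * inverse (sqnorm x) - W i x / 2)" if x: "x \<noteq> 0" for i x
    using partial_compose_real[OF d[OF s\<kappa> x] DERIV_exp, of i] p\<kappa>[OF x] unfolding \<Psi>_def by simp
  have \<Psi>2: "(\<Psi> x)\<^sup>2 * (f x + 2) = 2 * sqnorm x" if x: "x \<noteq> 0" for x
  proof -
    have "exp (2 * k) = 2 / C"
    proof -
      have "2 * k = - ln (C / 2)" by (simp add: k_def)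
      then show ?thesis using C(1) by (simp add: exp_minus)
    qed
    moreover have "(\<Psi> x)\<^sup>2 = (exp (lognorm x))\<^sup>2 * exp (- \<phi> x) * exp (2 * k)"
      unfolding \<Psi>_def \<kappa>_def by (simp add: exp_add[symmetric] exp_double[symmetric] algebra_simps)
    ultimately show ?thesis
      using C(1) C(2)[OF x] by (simp add: exp_lognorm[OF x] sqnorm_norm exp_minus field_simps)
  qed
  \<comment> \<open>In dimension 3 the logarithm of r contributes 1/r^2 and -\<phi>/2 contributes
    f/(2 r^2); their sum is (f + 2)/(2 r^2).\<close>
  have l\<kappa>: "laplacian \<kappa> x = inverse ((\<Psi> x)\<^sup>2)" if x: "x \<noteq> 0" for x
  proof -
    have xS: "x \<in> punctured" using x by simp
    have "laplacian \<kappa> x = laplacian lognorm x + ((- 1 / 2) * laplacian \<phi> x + 0)"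
      unfolding \<kappa>_def[abs_def]
      by (subst laplacian_add[OF op smooth_lognorm sm2(2) xS],
          subst laplacian_add[OF op sm2(1) smooth_on_const xS],
          subst laplacian_cmult[OF op s\<phi> xS]) (simp only: laplacian_const)
    also have "\<dots> = inverse (sqnorm x) * ((f x + 2) / 2)"
    proof -
      have "laplacian \<phi> x = - (real CARD('n) - 2) * f x * inverse (sqnorm x)"
        by (rule laplacian_\<phi>[OF s\<phi> p\<phi> G x])
      then show ?thesis unfolding laplacian_lognorm[OF x] by (simp add: n algebra_simps)
    qed
    finally have "laplacian \<kappa> x = inverse (sqnorm x) * ((f x + 2) / 2)" .
    moreover have "\<Psi> x > 0" by (simp add: \<Psi>_def)
    then have "f x + 2 = 2 * sqnorm x * inverse ((\<Psi> x)\<^sup>2)"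
      using \<Psi>2[OF x] by (simp add: field_simps)
    ultimately show ?thesis using sqnorm_pos[OF x] by simp
  qed
  have eq: "\<Psi> x * laplacian \<Psi> x = 1 + grad_inner \<Psi> \<Psi> x" if x: "x \<noteq> 0" for x
  proof -
    have xS: "x \<in> punctured" using x by simp
    have "grad_inner \<Psi> \<Psi> x = (\<Psi> x)\<^sup>2 * grad_inner \<kappa> \<kappa> x"
      by (simp add: grad_inner_def p\<Psi>[OF x] p\<kappa>[OF x] sum_distrib_left power2_eq_square mult_ac)
    moreover have "laplacian \<Psi> x = \<Psi> x * (inverse ((\<Psi> x)\<^sup>2) + grad_inner \<kappa> \<kappa> x)"
      using laplacian_exp[OF op s\<kappa> xS] l\<kappa>[OF x] unfolding \<Psi>_def by simp
    moreover have "\<Psi> x * (\<Psi> x * inverse ((\<Psi> x)\<^sup>2)) = 1"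
      by (simp add: \<Psi>_def power2_eq_square field_simps)
    ultimately show ?thesis by (simp add: power2_eq_square distrib_left)
  qed
  have euler: "(\<Sum>i\<in>UNIV. x $ i * partial i \<Psi> x) = \<Psi> x" if x: "x \<noteq> 0" for x
  proof -
    have "x $ i * partial i \<Psi> x = \<Psi> x * (inverse (sqnorm x) * (x $ i * x $ i)) - \<Psi> x / 2 * (x $ i * W i x)" for i
      by (simp add: p\<Psi>[OF x] algebra_simps)
    then have "(\<Sum>i\<in>UNIV. x $ i * partial i \<Psi> x)
      = \<Psi> x * (inverse (sqnorm x) * sqnorm x) - \<Psi> x / 2 * (\<Sum>i\<in>UNIV. x $ i * W i x)"
      by (simp add: sum_subtractf sum_distrib_left sqnorm_def[of x])
    then show ?thesis using radial_W[OF x] sqnorm_pos[OF x] by simp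
  qed
  have \<Psi>_pos: "\<Psi> x > 0" for x by (simp add: \<Psi>_def)
  obtain a e where ae: "a > 0" "a\<^sup>2 = 1 + e \<bullet> e"
    and P: "\<And>x. x \<noteq> 0 \<Longrightarrow> \<Psi> x = a * norm x - e \<bullet> x"
    and pP: "\<And>x i. x \<noteq> 0 \<Longrightarrow> partial i \<Psi> x = a * x $ i / norm x - e $ i"
    using liouville_rigidity[OF n s\<Psi> \<Psi>_pos euler eq] by blast
  \<comment> \<open>\<nabla>\<Psi>/\<Psi> = x/r^2 - W/2 is solved for \<open>W\<close>. The radial
    part f x/r^2 = 2 x/\<Psi>^2 - 2 x/r^2 is added, and the terms 2 x/r^2 cancel.\<close>
  have "\<Psi> x > 0 \<and> U i x = 2 * x $ i / (\<Psi> x)\<^sup>2 - 2 * partial i \<Psi> x / \<Psi> x" if x: "x \<noteq> 0" for x i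
  proof -
    have p: "\<Psi> x > 0" by (simp add: \<Psi>_def)
    have "f x = 2 * sqnorm x / (\<Psi> x)\<^sup>2 - 2" using \<Psi>2[OF x] p by (simp add: field_simps)
    then have fx: "f x * inverse (sqnorm x) = 2 / (\<Psi> x)\<^sup>2 - 2 * inverse (sqnorm x)"
      using sqnorm_pos[OF x] p by (simp add: field_simps)
    have "2 * partial i \<Psi> x / \<Psi> x = 2 * (x $ i * inverse (sqnorm x)) - W i x"
      using p by (simp add: p\<Psi>[OF x])
    then have "U i x = 2 * (x $ i * inverse (sqnorm x)) - 2 * partial i \<Psi> x / \<Psi> x + x $ i * (f x * inverse (sqnorm x))"
      by (simp add: W_def)
    then show ?thesis using p unfolding fx by (simp add: algebra_simps)
  qed
  then show ?thesis using ae P pP by metis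
qed

end

section \<open>Landau fields in closed form\<close>

lemma landau_potential:
  assumes e: "norm e = 1" and a: "a > 1" and y: "y \<noteq> 0"
  shows "landau_psi a (polar_angle e y) *\<^sub>R azimuthal e y = (2 / (a * norm y - e \<bullet> y)) *\<^sub>R cross3 e y"
proof -
  define t where "t = e \<bullet> y / norm y"
  have ny: "norm y > 0" using y by simp
  have cs: "\<bar>e \<bullet> y\<bar> \<le> norm y" using Cauchy_Schwarz_ineq2[of e y] e by simp
  then have t: "- 1 \<le> t" "t \<le> 1" using ny by (auto simp: t_def field_simps abs_le_iff)
  have "(norm (cross3 e y))\<^sup>2 = (norm y)\<^sup>2 - (e \<bullet> y)\<^sup>2"
    using norm_cross_dot[of e y] e by simp
  also have "\<dots> = (norm y)\<^sup>2 * (1 - t\<^sup>2)"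
    using ny by (simp add: t_def power_divide field_simps)
  finally have nc: "norm (cross3 e y) = norm y * sqrt (1 - t\<^sup>2)"
    by (metis norm_ge_zero real_sqrt_abs abs_of_nonneg real_sqrt_mult)
  have sc: "sin (polar_angle e y) = sqrt (1 - t\<^sup>2)" "cos (polar_angle e y) = t"
    using t by (auto simp: polar_angle_def t_def[symmetric] sin_arccos)
  have pos: "a - t > 0" using t a by linarith
  \<comment> \<open>Off the axis |e x y| = |y| sin \<phi> cancels the normalisation of the azimuthal
    vector; on the axis both sides are 0, since the vector product vanishes.\<close>
  have az: "sqrt (1 - t\<^sup>2) *\<^sub>R azimuthal e y = (1 / norm y) *\<^sub>R cross3 e y"
  proof (cases "cross3 e y = 0")
    case False
    then have "sqrt (1 - t\<^sup>2) \<noteq> 0" using nc by auto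
    then show ?thesis using ny unfolding azimuthal_def nc by (simp add: field_simps)
  qed (simp add: azimuthal_def)
  have "landau_psi a (polar_angle e y) *\<^sub>R azimuthal e y = (2 / (a - t)) *\<^sub>R (sqrt (1 - t\<^sup>2) *\<^sub>R azimuthal e y)"
    unfolding landau_psi_def sc by simp
  also have "\<dots> = (2 / (a - t) / norm y) *\<^sub>R cross3 e y"
    unfolding az by simp
  also have "2 / (a - t) / norm y = 2 / (a * norm y - e \<bullet> y)"
  proof -
    have "norm y * (a - t) = a * norm y - e \<bullet> y" using ny by (simp add: t_def algebra_simps)
    then show ?thesis by (metis divide_divide_eq_left mult.commute)
  qed
  finally show ?thesis .
qed

lemma landau_denominator_pos:
  fixes y :: "real^'n"
  assumes e: "norm e = 1" and a: "a > 1" and y: "y \<noteq> 0"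
  shows "a * norm y - e \<bullet> y > 0"
proof -
  have "e \<bullet> y \<le> norm y" using Cauchy_Schwarz_ineq2[of e y] e by simp
  moreover have "norm y < a * norm y" using a y by simp
  ultimately show ?thesis by linarith
qed

text \<open>The first component of the curl of (2/E) times the vector product of e and y, where
  \<partial>_j E = u y_j - e_j and u = a/|y|. It is stated for scalars so that cyclic shifts of the
  indices give the other two components.\<close>

lemma landau_curl_identity:
  fixes a :: real
  assumes uN: "u * N = a" and N: "N * N = y1 * y1 + y2 * y2 + y3 * y3"
    and e: "e1 * e1 + e2 * e2 + e3 * e3 = 1"
    and E: "E = a * N - (e1 * y1 + e2 * y2 + e3 * y3)" and E0: "E > 0"
  shows "((e1 * y2 - e2 * y1) * (2 * (- (inverse E)\<^sup>2 * (u * y2 - e2))) + e1 * (2 * inverse E))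
    - ((e3 * y1 - e1 * y3) * (2 * (- (inverse E)\<^sup>2 * (u * y3 - e3))) + (- e1) * (2 * inverse E))
    = 2 * (a\<^sup>2 - 1) * y1 / E\<^sup>2 - 2 * (u * y1 - e1) / E"
proof -
  define D where "D = inverse E"
  have DE: "D * E = 1" using E0 by (simp add: D_def)
  have key: "(e1 * y2 - e2 * y1) * (u * y2 - e2) - (e3 * y1 - e1 * y3) * (u * y3 - e3)
    = e1 * E - y1 * (a * a - 1 - u * E)"
  proof -
    define S where "S = e1 * y1 + e2 * y2 + e3 * y3"
    have "(e1 * y2 - e2 * y1) * (u * y2 - e2) - (e3 * y1 - e1 * y3) * (u * y3 - e3)
      = u * (e1 * (y1 * y1 + y2 * y2 + y3 * y3) - y1 * S) - (e1 * S - y1 * (e1 * e1 + e2 * e2 + e3 * e3))"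
      by (simp add: S_def algebra_simps)
    also have "\<dots> = e1 * ((u * N) * N) - y1 * (u * S) - e1 * S + y1"
      unfolding N[symmetric] e by (simp add: algebra_simps)
    also have "u * S = (u * N) * a - u * E" by (simp add: E S_def algebra_simps)
    finally show ?thesis unfolding uN by (simp add: E S_def algebra_simps)
  qed
  have "((e1 * y2 - e2 * y1) * (2 * (- D\<^sup>2 * (u * y2 - e2))) + e1 * (2 * D))
    - ((e3 * y1 - e1 * y3) * (2 * (- D\<^sup>2 * (u * y3 - e3))) + (- e1) * (2 * D))
    = 4 * e1 * D - 2 * D\<^sup>2 * ((e1 * y2 - e2 * y1) * (u * y2 - e2) - (e3 * y1 - e1 * y3) * (u * y3 - e3))"
    by (simp add: algebra_simps)
  also have "\<dots> = 2 * (a\<^sup>2 - 1) * y1 * D\<^sup>2 - 2 * (u * y1 - e1) * D"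
    unfolding key power2_eq_square using DE by algebra
  finally show ?thesis by (simp add: D_def divide_inverse power_inverse)
qed

text \<open>With E = a |y| - e . y the field is 2 (a^2 - 1) y/E^2 - 2 \<nabla>E/E. Taking \<Psi> =
  E/sqrt(a^2 - 1) brings it to the form in \<open>velocity_dim3\<close>.\<close>

lemma landau_field_explicit:
  assumes e: "norm e = 1" and a: "a > 1" and y: "y \<noteq> 0"
  shows "landau_field e a y $ k = 2 * (a\<^sup>2 - 1) * y $ k / (a * norm y - e \<bullet> y)\<^sup>2
    - 2 * (a * y $ k / norm y - e $ k) / (a * norm y - e \<bullet> y)"
proof -
  define D where "D y = inverse (a * norm y - e \<bullet> y)" for y
  define A where "A y = landau_psi a (polar_angle e y) *\<^sub>R azimuthal e y" for y
  have An: "A z $ i = cross3 e z $ i * (2 * D z)" if "z \<noteq> 0" for z i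
    unfolding A_def landau_potential[OF e a that] D_def by (simp add: divide_inverse)
  note op = open_punctured
  have se: "smooth_on (\<lambda>y. a * norm y - e \<bullet> y) punctured"
    by (intro smooth_on_diff smooth_on_mult smooth_on_const smooth_norm op)
       (simp add: inner_vec_def, intro smooth_on_sum smooth_on_mult smooth_on_const smooth_on_coord op, simp)
  have sD: "smooth_on D punctured"
    unfolding D_def[abs_def] using landau_denominator_pos[OF e a]
    by (intro smooth_on_inverse se op) force
  have dD: "D differentiable (at y)" using smooth_on_differentiable[OF sD] y by simp
  have dn: "norm differentiable (at y)" using smooth_on_differentiable[OF smooth_norm] y by simp
  have pe: "partial j (\<lambda>y. a * norm y - e \<bullet> y) y = a * y $ j / norm y - e $ j" for j
  proof -
    have "partial j (\<lambda>y. e \<bullet> y) y = e $ j"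
      using partial_linear[OF bounded_linear_inner_right[of e], of "\<lambda>y. y" y j]
      by (simp add: partial_def inner_axis)
    moreover have "(\<lambda>y. e \<bullet> y) differentiable (at y)"
      by (intro bounded_linear_imp_differentiable bounded_linear_inner_right)
    ultimately show ?thesis
      by (subst partial_diff) (auto simp: dn partial_cmult[OF dn] partial_norm[OF y] intro!: differentiable_mult)
  qed
  have pD: "partial j D y = - (D y)\<^sup>2 * (a * y $ j / norm y - e $ j)" for j
    unfolding D_def[abs_def]
    by (subst partial_compose_real[OF smooth_on_differentiable[OF se] DERIV_inverse])
       (use y landau_denominator_pos[OF e a y] in \<open>auto simp: pe numeral_2_eq_2\<close>)
  have pA: "partial j (\<lambda>y. A y $ i) y = (cross3 e y $ i) * (2 * partial j D y) + cross3 e (axis j 1) $ i * (2 * D y)" for i j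
  proof -
    have bl: "bounded_linear (\<lambda>y. cross3 e y $ i)"
      using bounded_linear_compose[OF bounded_linear_vec_nth] bilinear_cross
      by (metis bilinear_conv_bounded_bilinear bounded_bilinear.bounded_linear_right)
    have d: "(\<lambda>y. cross3 e y $ i) differentiable (at y)"
      by (rule bounded_linear_imp_differentiable[OF bl])
    have p: "partial j (\<lambda>y. cross3 e y $ i) y = cross3 e (axis j 1) $ i"
      using partial_linear[OF bl, of "\<lambda>y. y" y j] by (simp add: partial_def)
    have "partial j (\<lambda>y. A y $ i) y = partial j (\<lambda>y. cross3 e y $ i * (2 * D y)) y"
      by (rule partial_cong_punctured[OF y An])
    then show ?thesis
      by (simp add: partial_mult[OF d differentiable_mult[OF differentiable_const dD]] partial_cmult[OF dD] p)
  qed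
  define N where "N = norm y"
  have N: "N > 0" "N * N = y$1 * y$1 + y$2 * y$2 + y$3 * y$3"
    using y power2_norm_eq_inner[of y] by (auto simp: N_def inner_vec_def sum_3 power2_eq_square)
  have ee: "e$1 * e$1 + e$2 * e$2 + e$3 * e$3 = 1"
    using e power2_norm_eq_inner[of e] by (simp add: inner_vec_def sum_3)
  define E where "E = a * N - (e$1 * y$1 + e$2 * y$2 + e$3 * y$3)"
  have E0: "E > 0" using landau_denominator_pos[OF e a y] by (simp add: E_def N_def inner_vec_def sum_3)
  have DE: "D y = inverse E" by (simp add: D_def E_def N_def inner_vec_def sum_3)
  define u where "u = a / N"
  have uN: "u * N = a" using N(1) by (simp add: u_def)
  note alg = landau_curl_identity[OF uN _ _ _ E0]
  have pD': "partial j D y = - (inverse E)\<^sup>2 * (u * y $ j - e $ j)" for j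
    by (simp add: pD DE u_def N_def)
  have c: "landau_field e a y = curl A y" by (simp add: landau_field_def A_def[abs_def])
  have "landau_field e a y $ k = 2 * (a\<^sup>2 - 1) * y $ k / E\<^sup>2 - 2 * (u * y $ k - e $ k) / E"
    using exhaust_3[of k]
  proof (elim disjE)
    assume k: "k = 1"
    show ?thesis unfolding c k
      by (rule trans[OF _ alg[of "y$1" "y$2" "y$3" "e$1" "e$2" "e$3"]])
         (use N ee in \<open>simp_all add: E_def curl_def pA pD' DE cross_components axis_def mult.commute\<close>)
  next
    assume k: "k = 2"
    show ?thesis unfolding c k
      by (rule trans[OF _ alg[of "y$2" "y$3" "y$1" "e$2" "e$3" "e$1"]])
         (use N ee in \<open>simp_all add: E_def curl_def pA pD' DE cross_components axis_def mult.commute\<close>)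
  next
    assume k: "k = 3"
    show ?thesis unfolding c k
      by (rule trans[OF _ alg[of "y$3" "y$1" "y$2" "e$3" "e$1" "e$2"]])
         (use N ee in \<open>simp_all add: E_def curl_def pA pD' DE cross_components axis_def mult.commute\<close>)
  qed
  moreover have "E = a * norm y - e \<bullet> y" by (simp add: E_def N_def inner_vec_def sum_3)
  ultimately show ?thesis by (simp add: u_def N_def)
qed

section \<open>The director field\<close>

lemma partial_component:
  "f differentiable (at x) \<Longrightarrow> partial i (\<lambda>y. f y $ k) x = partial i f x $ k"
  by (rule partial_linear[OF bounded_linear_vec_nth])

lemma smooth_on_component:
  "open S \<Longrightarrow> smooth_on f S \<Longrightarrow> smooth_on (\<lambda>y. f y $ k) S"
  by (rule smooth_on_linear[OF _ bounded_linear_vec_nth])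

lemma laplacian_linear:
  assumes S: "open S" "x \<in> S" and l: "bounded_linear l" and f: "smooth_on f S"
  shows "laplacian (\<lambda>y. l (f y)) x = l (laplacian f x)"
proof -
  have "partial i (partial i (\<lambda>y. l (f y))) x = l (partial i (partial i f) x)" for i
  proof -
    have "partial i (partial i (\<lambda>y. l (f y))) x = partial i (\<lambda>y. l (partial i f y)) x"
      by (rule partial_cong[OF S]) (rule partial_linear[OF l smooth_on_differentiable[OF f]])
    also have "\<dots> = l (partial i (partial i f) x)"
      by (rule partial_linear[OF l smooth_on_differentiable[OF smooth_on_partial[OF f] S(2)]])
    finally show ?thesis .
  qed
  then show ?thesis by (simp add: laplacian_def linear_sum[OF bounded_linear.linear[OF l]])
qed

text \<open>Cauchy-Schwarz: the operator norm of the derivative is at most its Hilbert-Schmidt norm,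
  the one in which smallness is measured.\<close>

lemma norm_derivative_le_grad_norm:
  fixes f :: "real^'n \<Rightarrow> 'b::real_normed_vector"
  shows "norm (\<Sum>i\<in>UNIV. v $ i *\<^sub>R partial i f x) \<le> norm v * grad_norm f x"
proof -
  have "norm (\<Sum>i\<in>UNIV. v $ i *\<^sub>R partial i f x) \<le> (\<Sum>i\<in>UNIV. \<bar>v $ i\<bar> * \<bar>norm (partial i f x)\<bar>)"
    by (rule order_trans[OF norm_sum]) simp
  also have "\<dots> \<le> L2_set (\<lambda>i. v $ i) UNIV * L2_set (\<lambda>i. norm (partial i f x)) UNIV"
    by (rule L2_set_mult_ineq)
  also have "\<dots> = norm v * grad_norm f x"
    by (simp add: norm_vec_def grad_norm_def L2_set_def)
  finally show ?thesis .
qed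

text \<open>As y and z are orthonormal, the curve is a great circle of unit speed. It stays on the
  unit sphere, where the gradient bound holds, and the mean value inequality applies.\<close>

lemma great_arc_lipschitz:
  fixes d :: "real^'n \<Rightarrow> 'b::real_normed_vector" and y z :: "real^'n"
  assumes d: "smooth_on d punctured" and B: "\<And>x. norm x = 1 \<Longrightarrow> grad_norm d x \<le> B"
    and yz: "norm y = 1" "norm z = 1" "y \<bullet> z = 0" and ab: "a \<le> b"
  shows "norm (d (cos b *\<^sub>R y + sin b *\<^sub>R z) - d (cos a *\<^sub>R y + sin a *\<^sub>R z)) \<le> B * (b - a)"
proof -
  define g where "g t = cos t *\<^sub>R y + sin t *\<^sub>R z" for t
  define g' where "g' t = (- sin t) *\<^sub>R y + cos t *\<^sub>R z" for t
  have yz': "y \<bullet> y = 1" "z \<bullet> z = 1" "z \<bullet> y = 0" using yz by (auto simp: dot_square_norm inner_commute)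
  have "g t \<bullet> g t = 1" "g' t \<bullet> g' t = 1" for t
    using sin_cos_squared_add3[of t]
    by (simp_all add: g_def g'_def inner_add_left inner_add_right inner_diff_left inner_diff_right yz yz')
  then have ng: "norm (g t) = 1" "norm (g' t) = 1" for t
    by (simp_all add: norm_eq_sqrt_inner)
  have g0: "g t \<in> punctured" for t using ng(1)[of t] by (metis DiffI UNIV_I norm_zero singletonD zero_neq_one)
  have dg: "(g has_derivative (\<lambda>h. h *\<^sub>R g' t)) (at t within A)" for t A
    unfolding g_def g'_def by (auto intro!: derivative_eq_intros simp: algebra_simps)
  have D: "((\<lambda>t. d (g t)) has_derivative (\<lambda>h. \<Sum>i\<in>UNIV. (h *\<^sub>R g' t) $ i *\<^sub>R partial i d (g t))) (at t within {a..b})" for t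
    by (rule has_derivative_compose[OF dg has_derivative_partial[OF smooth_on_differentiable[OF d g0]]])
  have "norm (d (g b) - d (g a)) \<le> B * norm (b - a)"
  proof (rule differentiable_bound[OF _ D])
    fix t
    show "onorm (\<lambda>h. \<Sum>i\<in>UNIV. (h *\<^sub>R g' t) $ i *\<^sub>R partial i d (g t)) \<le> B"
    proof (rule onorm_le)
      fix h :: real
      have "norm (\<Sum>i\<in>UNIV. (h *\<^sub>R g' t) $ i *\<^sub>R partial i d (g t)) \<le> norm (h *\<^sub>R g' t) * grad_norm d (g t)"
        by (rule norm_derivative_le_grad_norm)
      also have "\<dots> = \<bar>h\<bar> * grad_norm d (g t)" using ng(2) by simp
      also have "\<dots> \<le> B * norm h" using mult_left_mono[OF B[OF ng(1)[of t]], of "\<bar>h\<bar>"] by (simp add: mult.commute)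
      finally show "norm (\<Sum>i\<in>UNIV. (h *\<^sub>R g' t) $ i *\<^sub>R partial i d (g t)) \<le> B * norm h" .
    qed
  qed (use ab in auto)
  then show ?thesis using ab by (simp add: g_def)
qed

lemma inner_unit_dist:
  fixes v w :: "'a::real_inner"
  assumes "norm v = 1" "norm w = 1" "norm (v - w) \<le> r"
  shows "v \<bullet> w \<ge> 1 - r\<^sup>2 / 2"
proof -
  have "(norm (v - w))\<^sup>2 = 2 - 2 * (v \<bullet> w)"
    using assms(1,2) by (simp add: power2_norm_eq_inner inner_diff_left inner_diff_right inner_commute norm_eq_1)
  moreover have "(norm (v - w))\<^sup>2 \<le> r\<^sup>2" using assms(3) by (intro power_mono) auto
  ultimately show ?thesis by linarith
qed

text \<open>
  If \<open>\<theta>\<close> is the angle between \<open>x\<close> and \<open>y\<close>, then \<open>d x\<close> is within \<open>\<theta>/2\<close> of \<open>d y\<close> and within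
  \<open>(\<pi> - \<theta>)/2\<close> of \<open>d (- y)\<close>, so the vector \<open>v = d y + d (- y)\<close> works.
\<close>

lemma values_in_hemisphere:
  fixes d :: "real^'n \<Rightarrow> 'b::real_inner"
  assumes n: "CARD('n) \<ge> 2" and d: "smooth_on d punctured"
    and unit: "\<And>x. x \<noteq> 0 \<Longrightarrow> norm (d x) = 1"
    and B: "\<And>x. norm x = 1 \<Longrightarrow> grad_norm d x \<le> 1 / 2"
  shows "\<exists>v. \<forall>x. norm x = 1 \<longrightarrow> v \<bullet> d x > 0"
proof -
  obtain i0 i1 :: 'n where ne: "i0 \<noteq> i1"
    using n card_le_Suc0_iff_eq[of "UNIV :: 'n set"] by fastforce
  define y :: "real^'n" where "y = axis i0 1"
  have y1: "norm y = 1" "y \<bullet> y = 1" by (auto simp: y_def inner_axis_axis)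
  have "(d y + d (- y)) \<bullet> d x > 0" if x: "norm x = 1" for x
  proof -
    define t where "t = y \<bullet> x"
    have t: "- 1 \<le> t" "t \<le> 1" using Cauchy_Schwarz_ineq2[of y x] y1 x by (auto simp: t_def)
    define \<theta> where "\<theta> = arccos t"
    have \<theta>: "0 \<le> \<theta>" "\<theta> \<le> pi" "cos \<theta> = t" "sin \<theta> = sqrt (1 - t\<^sup>2)"
      using t by (auto simp: \<theta>_def arccos_lbound arccos_ubound sin_arccos)
    have xx: "x \<bullet> x = 1" using x by (simp add: dot_square_norm)
    have nr: "(norm (x - t *\<^sub>R y))\<^sup>2 = 1 - t\<^sup>2"
      unfolding power2_norm_eq_inner
      by (simp add: inner_diff_left inner_diff_right y1 xx inner_commute t_def power2_eq_square)
    then have nr': "norm (x - t *\<^sub>R y) = sin \<theta>" unfolding \<theta>(4) by (metis norm_ge_zero real_sqrt_abs abs_of_nonneg)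
    obtain z where z: "norm z = 1" "y \<bullet> z = 0" "x = cos \<theta> *\<^sub>R y + sin \<theta> *\<^sub>R z"
    proof (cases "sin \<theta> = 0")
      case True
      have "x = t *\<^sub>R y" using nr' True by simp
      \<comment> \<open>Here x is y or -y, and any unit vector orthogonal to y completes the great
        circle.\<close>
      then show ?thesis
        using that[of "axis i1 1"] ne True \<theta>(3) by (auto simp: y_def inner_axis_axis)
    next
      case False
      have "norm ((1 / sin \<theta>) *\<^sub>R (x - t *\<^sub>R y)) = 1"
        using nr' False by (simp add: nr'[symmetric])
      moreover have "y \<bullet> ((1 / sin \<theta>) *\<^sub>R (x - t *\<^sub>R y)) = 0"
        by (simp add: inner_diff_right y1 t_def)
      moreover have "x = cos \<theta> *\<^sub>R y + sin \<theta> *\<^sub>R ((1 / sin \<theta>) *\<^sub>R (x - t *\<^sub>R y))"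
        using False \<theta>(3) by simp
      ultimately show ?thesis using that by blast
    qed
    have x0: "x \<noteq> 0" "y \<noteq> 0" "- y \<noteq> 0" using x y1 by auto
    have arc: "norm (d (cos b *\<^sub>R y + sin b *\<^sub>R z) - d (cos a *\<^sub>R y + sin a *\<^sub>R z)) \<le> 1 / 2 * (b - a)"
      if "a \<le> b" for a b
      by (rule great_arc_lipschitz[OF d B y1(1) z(1,2) that])
    have 1: "norm (d x - d y) \<le> \<theta> / 2" using arc[OF \<theta>(1)] z(3) by simp
    have 2: "norm (d (- y) - d x) \<le> (pi - \<theta>) / 2" using arc[OF \<theta>(2)] z(3) by simp
    have "d x \<bullet> d y \<ge> 1 - (\<theta> / 2)\<^sup>2 / 2" "d (- y) \<bullet> d x \<ge> 1 - ((pi - \<theta>) / 2)\<^sup>2 / 2"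
      by (rule inner_unit_dist[OF unit unit 1] inner_unit_dist[OF unit unit 2]; fact x0)+
    \<comment> \<open>The inner product of d x with v is at least 2 minus this sum. On [0, \<pi>]
      one has \<theta>^2 + (\<pi> - \<theta>)^2 \<le> \<pi>^2, so the sum is at most \<pi>^2/8 < 2,
      because \<pi> < 4.\<close>
    moreover have "(\<theta> / 2)\<^sup>2 / 2 + ((pi - \<theta>) / 2)\<^sup>2 / 2 < 2"
    proof -
      have "\<theta>\<^sup>2 + (pi - \<theta>)\<^sup>2 \<le> pi\<^sup>2"
        using mult_nonneg_nonneg[of \<theta> "pi - \<theta>"] \<theta> by (simp add: power2_eq_square algebra_simps)
      moreover have "pi\<^sup>2 < 4\<^sup>2" using pi_less_4 by (intro power_strict_mono) auto
      ultimately show ?thesis by (simp add: power_divide)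
    qed
    ultimately show ?thesis by (simp add: inner_add_left inner_add_right inner_commute)
  qed
  then show ?thesis by blast
qed

lemma director_constant:
  fixes u d :: "real^'n \<Rightarrow> real^'n"
  assumes n: "CARD('n) \<ge> 2" and u: "smooth_on u punctured" and d: "smooth_on d punctured"
    and unit: "\<And>x. x \<noteq> 0 \<Longrightarrow> norm (d x) = 1"
    and hom: "\<And>x l. x \<noteq> 0 \<Longrightarrow> l > 0 \<Longrightarrow> d x = d (l *\<^sub>R x)"
    and eq: "\<And>x. x \<noteq> 0 \<Longrightarrow> laplacian d x + (grad_norm d x)\<^sup>2 *\<^sub>R d x = advect u d x"
    and small: "\<And>x. x \<noteq> 0 \<Longrightarrow> grad_norm d x < 1 / (2 * norm x)"
  shows "d constant_on punctured"
proof -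
  note op = open_punctured
  have "grad_norm d x \<le> 1 / 2" if "norm x = 1" for x
    using small[of x] that by fastforce
  from values_in_hemisphere[OF n d unit this]
  obtain v where v1: "\<And>x. norm x = 1 \<Longrightarrow> v \<bullet> d x > 0" by blast
  have v: "v \<bullet> d x > 0" if "x \<noteq> 0" for x
    using v1[of "(1 / norm x) *\<^sub>R x"] hom[OF that, of "1 / norm x"] that by simp
  \<comment> \<open>The maximum principle is for subsolutions; the minus sign turns the positive
    supersolution v . d into one.\<close>
  define w where "w x = - (v \<bullet> d x)" for x
  have bl: "bounded_linear (\<lambda>y. - (v \<bullet> y))"
    by (intro bounded_linear_minus bounded_linear_inner_right)
  have sw: "smooth_on w punctured"
    unfolding w_def[abs_def] by (rule smooth_on_linear[OF op bl d])
  have pw: "partial i w x = - (v \<bullet> partial i d x)" if "x \<noteq> 0" for i x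
    unfolding w_def[abs_def] using partial_linear[OF bl smooth_on_differentiable[OF d]] that by simp
  have lw: "laplacian w x = - (v \<bullet> laplacian d x)" if "x \<noteq> 0" for x
    unfolding w_def[abs_def] using laplacian_linear[OF op _ bl d] that by simp
  have Lw: "laplacian w x + (\<Sum>i\<in>UNIV. - (u x $ i) * partial i w x) = (grad_norm d x)\<^sup>2 * (v \<bullet> d x)"
    if x: "x \<noteq> 0" for x
  proof -
    have "(\<Sum>i\<in>UNIV. - (u x $ i) * partial i w x) = v \<bullet> advect u d x"
      by (simp add: pw[OF x] advect_def inner_sum_right)
    also have "\<dots> = v \<bullet> laplacian d x + (grad_norm d x)\<^sup>2 * (v \<bullet> d x)"
      unfolding eq[OF x, symmetric] by (simp add: inner_add_right)
    finally show ?thesis by (simp add: lw[OF x])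
  qed
  have "\<exists>c. \<forall>x. x \<noteq> 0 \<longrightarrow> w x = c"
  proof (rule homogeneous_strong_maximum[OF n sw, where b = "\<lambda>i x. - (u x $ i)"])
    show "w (l *\<^sub>R x) = w x" if "x \<noteq> 0" "l > 0" for x l
      using hom[OF that] by (simp add: w_def)
    show "continuous_on punctured (\<lambda>x. - (u x $ i))" for i
      by (intro continuous_on_minus smooth_on_continuous_on smooth_on_component[OF op u])
    show "(\<Sum>i\<in>UNIV. partial i (partial i w) x) + (\<Sum>i\<in>UNIV. - (u x $ i) * partial i w x) \<ge> 0"
      if "x \<noteq> 0" for x
      using Lw[OF that] v[OF that] by (simp add: laplacian_def)
  qed
  then obtain c where c: "\<And>x. x \<noteq> 0 \<Longrightarrow> w x = c" by blast
  \<comment> \<open>For constant w the left-hand side of \<open>Lw\<close> is 0, and the factor v .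
    d is positive.\<close>
  have "grad_norm d x = 0" if x: "x \<noteq> 0" for x
  proof -
    have p: "partial i w y = 0" if "y \<noteq> 0" for i y
      using partial_cong_punctured[OF that c] by simp
    have "partial i (partial i w) x = 0" for i
      using partial_cong_punctured[OF x p] by simp
    then show ?thesis using Lw[OF x] p[OF x] v[OF x] by (simp add: laplacian_def)
  qed
  then have pd: "partial i d x = 0" if "x \<noteq> 0" for i x
    using that unfolding grad_norm_def by (simp add: sum_nonneg_eq_0_iff)
  have con: "connected (punctured :: (real^'n) set)"
    using connected_punctured_universe[of "0 :: real^'n"] n by (simp add: Compl_eq_Diff_UNIV)
  show ?thesis
  proof (rule has_derivative_zero_connected_constant_on[OF con op finite.emptyI smooth_on_continuous_on[OF d]], rule ballI)
    fix x :: "real^'n" assume "x \<in> punctured - {}"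
    then have x: "x \<in> punctured" by simp
    show "(d has_derivative (\<lambda>h. 0)) (at x within punctured)"
      using has_derivative_at_withinI[OF has_derivative_partial[OF smooth_on_differentiable[OF d x]]] pd x by simp
  qed
qed

text \<open>Dividing a r - e . x by m = |e| gives a Landau denominator with axis e/m and parameter
  a' = a/m. From a^2 = 1 + m^2 follow a' > 1 and a'^2 - 1 = 1/m^2, which matches the two
  normalisations. If e = 0, then a = 1 and the velocity vanishes, the case of the infinite
  parameter.\<close>

lemma (in homogeneous_navier_stokes) landau_dim3:
  assumes n: "CARD('n) = 3"
  shows "landau_solution (\<lambda>x. \<chi> i. U i x)"
proof -
  obtain a e where ae: "a > 0" "a\<^sup>2 = 1 + e \<bullet> e"
    and pos: "\<And>x. x \<noteq> 0 \<Longrightarrow> a * norm x - e \<bullet> x > 0"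
    and U: "\<And>x i. x \<noteq> 0 \<Longrightarrow>
      U i x = 2 * x $ i / (a * norm x - e \<bullet> x)\<^sup>2 - 2 * (a * x $ i / norm x - e $ i) / (a * norm x - e \<bullet> x)"
    using velocity_dim3[OF n] by blast
  show ?thesis
  proof (cases "e = 0")
    case True
    then have "a = 1" using ae by (simp add: power2_eq_1_iff)
    then have "U i x = 0" if "x \<noteq> 0" for i x
      using U[OF that, of i] that True by (simp add: power2_eq_square)
    then show ?thesis by (auto simp: landau_solution_def vec_eq_iff)
  next
    case False
    have "card (UNIV :: 3 set) = card (UNIV :: 'n set)" using n by simp
    \<comment> \<open>Any enumeration will do: \<open>relabel\<close> preserves inner products, and
      the closed form involves only these and the coordinates.\<close>
    then obtain s :: "3 \<Rightarrow> 'n" where s: "bij s"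
      using finite_same_card_bij[of "UNIV :: 3 set" "UNIV :: 'n set"] by auto
    have re: "(\<Sum>k\<in>UNIV. g (s k)) = (\<Sum>i\<in>UNIV. g i)" for g :: "'n \<Rightarrow> real"
      by (rule sum.reindex_bij_betw[OF s])
    have inn: "relabel s v \<bullet> relabel s w = v \<bullet> w" for v w
      by (simp add: relabel_def inner_vec_def re[of "\<lambda>i. v $ i * w $ i"])
    have nrm: "norm (relabel s v) = norm v" for v by (simp add: norm_eq_sqrt_inner inn)
    define m where "m = norm e"
    have m: "m > 0" "m\<^sup>2 = e \<bullet> e" using False by (auto simp: m_def power2_norm_eq_inner)
    define e' where "e' = relabel s ((1 / m) *\<^sub>R e)"
    define a' where "a' = a / m"
    have ne: "norm e' = 1" using m by (simp add: e'_def nrm m_def)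
    have "m\<^sup>2 < a\<^sup>2" using ae(2) m(2) by simp
    then have "m < a" using ae(1) by (simp add: power2_less_imp_less)
    then have a1: "a' > 1" using m(1) by (simp add: a'_def)
    have "a\<^sup>2 = 1 + m\<^sup>2" using ae(2) m(2) by simp
    then have a2: "a'\<^sup>2 - 1 = 1 / m\<^sup>2" using m(1) by (simp add: a'_def power_divide field_simps)
    have "relabel s (\<chi> i. U i x) = landau_field e' a' (relabel s x)" if x: "x \<in> punctured" for x
    proof -
      have x0: "x \<noteq> 0" using x by simp
      define P where "P = a * norm x - e \<bullet> x"
      have P: "P > 0" using pos[OF x0] by (simp add: P_def)
      have y0: "relabel s x \<noteq> 0" using x0 nrm[of x] by (metis norm_eq_zero)
      have E: "a' * norm (relabel s x) - e' \<bullet> relabel s x = P / m"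
        using m(1) by (simp add: a'_def e'_def nrm inn P_def field_simps)
      have "U (s k) x = landau_field e' a' (relabel s x) $ k" for k
        unfolding landau_field_explicit[OF ne a1 y0] E a2 U[OF x0] P_def[symmetric]
        using m(1) P x0 by (simp add: relabel_def a'_def e'_def nrm[unfolded relabel_def] power_divide field_simps power2_eq_square)
      then show ?thesis by (simp add: relabel_def vec_eq_iff)
    qed
    then show ?thesis unfolding landau_solution_def using s ne a1 by blast
  qed
qed

theorem theorem1p3:
  fixes u d :: "real^'n \<Rightarrow> real^'n"
  assumes "CARD('n) \<ge> 3"
    and "smooth_on u punctured"
    and "smooth_on d punctured"
    and "\<forall>x\<in>punctured. d x \<in> sphere 0 1"
    and "self_similar_solution u d"
    and "\<forall>x\<in>punctured. grad_norm d x < 1 / (2 * norm x)"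
  shows "(CARD('n) \<ge> 4 \<longrightarrow> (\<forall>x\<in>punctured. u x = 0) \<and> d constant_on punctured)
    \<and> (CARD('n) = 3 \<longrightarrow>
        ((\<forall>x\<in>punctured. u x = 0) \<or>
         (landau_solution u \<and> (\<exists>q. smooth_on q punctured \<and> navier_stokes u q)))
        \<and> d constant_on punctured)"
proof -
  note op = open_punctured
  obtain p where p: "smooth_on p punctured" and el: "ericksen_leslie u p d" and ss: "self_similar u p d"
    using assms(5) unfolding self_similar_solution_def by blast
  have dc: "d constant_on punctured"
  proof (rule director_constant[OF _ assms(2,3)])
    fix x :: "real^'n" assume "x \<noteq> 0"
    then have x: "x \<in> punctured" by simp
    show "norm (d x) = 1" using assms(4) x by auto
    show "laplacian d x + (grad_norm d x)\<^sup>2 *\<^sub>R d x = advect u d x"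
      using el x unfolding ericksen_leslie_def by blast
    show "grad_norm d x < 1 / (2 * norm x)" using assms(6) x by blast
    show "d x = d (l *\<^sub>R x)" if "l > 0" for l
      using ss x that unfolding self_similar_def by blast
  qed (use assms(1) in simp)
  then obtain d0 where d0: "\<And>x. x \<noteq> 0 \<Longrightarrow> d x = d0" by (auto simp: constant_on_def)
  have pd: "partial i d x = 0" if "x \<noteq> 0" for i x
    using partial_cong_punctured[OF that d0] by simp
  \<comment> \<open>A constant director removes the stress term, so the given pressure is a pressure
    for the Navier-Stokes equations.\<close>
  have td: "tensor_div (ericksen_tensor d) x = 0" if x: "x \<noteq> 0" for x
  proof -
    have "partial j (\<lambda>y. ericksen_tensor d y $ i $ j) x = 0" for i j
    proof -
      have "partial j (\<lambda>y. ericksen_tensor d y $ i $ j) x = partial j (\<lambda>y. 0 :: real) x"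
        by (rule partial_cong_punctured[OF x]) (simp add: ericksen_tensor_def pd)
      then show ?thesis by simp
    qed
    then show ?thesis by (simp add: tensor_div_def vec_eq_iff)
  qed
  have mom: "- laplacian u x + advect u u x + grad p x = 0" and div: "divergence u x = 0" if "x \<noteq> 0" for x
  proof -
    have "x \<in> punctured" using that by simp
    then have "- laplacian u x + advect u u x + grad p x = - tensor_div (ericksen_tensor d) x"
      "divergence u x = 0"
      using el unfolding ericksen_leslie_def by blast+
    then show "- laplacian u x + advect u u x + grad p x = 0" "divergence u x = 0"
      by (simp_all add: td[OF that])
  qed
  have ns: "navier_stokes u p" unfolding navier_stokes_def using mom div by blast
  have pc: "partial j (\<lambda>y. u y $ i) x = partial j u x $ i" if "x \<noteq> 0" for i j x
    by (rule partial_component[OF smooth_on_differentiable[OF assms(2)]]) (use that in simp)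
  interpret homogeneous_navier_stokes "\<lambda>i x. u x $ i" p
  proof
    fix x :: "real^'n" and i :: 'n assume x: "x \<noteq> 0"
    then have xS: "x \<in> punctured" by simp
    show "(\<Sum>i\<in>UNIV. partial i (\<lambda>x. u x $ i) x) = 0"
      using div[OF x] by (simp add: divergence_def)
    have "laplacian (\<lambda>y. u y $ i) x = laplacian u x $ i"
      by (rule laplacian_linear[OF op xS bounded_linear_vec_nth assms(2)])
    then show "- laplacian (\<lambda>y. u y $ i) x + (\<Sum>j\<in>UNIV. u x $ j * partial j (\<lambda>y. u y $ i) x) + partial i p x = 0"
      using arg_cong[OF mom[OF x], of "\<lambda>v. v $ i"] by (simp add: advect_def grad_def pc[OF x])
    fix l :: real assume l: "l > 0"
    show "p x = l\<^sup>2 * p (l *\<^sub>R x)"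
      using ss xS l unfolding self_similar_def by blast
    have ux: "u x = l *\<^sub>R u (l *\<^sub>R x)"
      using ss xS l unfolding self_similar_def by blast
    show "u x $ i = l * u (l *\<^sub>R x) $ i" by (subst ux) simp
  qed (use assms(1) p smooth_on_component[OF op assms(2)] in auto)
  show ?thesis
  proof (intro conjI impI dc)
    show "\<forall>x\<in>punctured. u x = 0" if "CARD('n) \<ge> 4"
      using zero_dim4[OF that] by (simp add: vec_eq_iff)
    \<comment> \<open>The second alternative is proved in every case, since
      \<open>landau_solution\<close> includes the zero field.\<close>
    assume "CARD('n) = 3"
    then have "landau_solution u" using landau_dim3 by simp
    then show "(\<forall>x\<in>punctured. u x = 0) \<or>
        (landau_solution u \<and> (\<exists>q. smooth_on q punctured \<and> navier_stokes u q))"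
      using ns p by blast
  qed
qed

end
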